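(* Let $d\ge 3$. Assume that $\varepsilon\in C^{(3)}(\mathbb{T}^d)$ is a real-valued even Morse function with a unique minimum at $0\in\mathbb{T}^d$ and that $\hat v\in\ell^1(\mathbb{Z}^d)$ is non-positive and even. Assume that for $k_0\in\mathbb{G}$ the threshold $\mathcal{E}_{\min}(k_0)$ is a singular point of multiplicity $n$ ($n=1,2,\dots$) of the operator $\widehat H_1(k_0)=\widehat H_0(k_0)+\widehat V$, and that $\widehat H_1(k_0)\ge\mathcal{E}_{\min}(k_0)I$. Let $\mathcal{H}_n\subset\ell^{2,e}(\mathbb{Z}^d)$ be the $n$-dimensional eigenspace of $\mathbb{B}_1(k_0,\mathcal{E}_{\min}(k_0))$ associated to the eigenvalue $1$. Then: (i) For any $\mu>1$ and $k\in\mathrm{M}_=(k_0;\mathcal{H}_n)$, the operator $\widehat H_\mu(k)=\widehat H_0(k)+\mu\widehat V$ has at least one eigenvalue below the threshold $\mathcal{E}_{\min}(k)$. (ii) For any $\mu>1$ and $k\in\mathcal{M}_=(k_0;\mathcal{H}_n)\cup\mathcal{M}_>(k_0;\mathcal{H}_n)$, the operator $\widehat H_\mu(k)=\widehat H_0(k)+\mu\widehat V$ has at least $n$ eigenvalues (counting multiplicities) below the threshold $\mathcal{E}_{\min}(k)$.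
   Context: Let $\mathbb{T}^d=(\mathbb{R}/2\pi\mathbb{Z})^d$, identified with $[-\pi,\pi)^d$ (so that $k/2$ is well defined for $k\in\mathbb{T}^d$), with normalized Haar measure $\eta(\mathrm{d}p)=\mathrm{d}^dp/(2\pi)^d$, and $(p,x)=\sum_j p_jx_j$. Let $\ell^{2,e}(\mathbb{Z}^d)$ be the Hilbert space of square-summable even functions on $\mathbb{Z}^d$. Let $\hat\varepsilon\in\ell^1(\mathbb{Z}^d)$ be real-valued and even, and $\varepsilon(p)=\sum_{x\in\mathbb{Z}^d}e^{\mathrm{i}(p,x)}\hat\varepsilon(x)$. For $k\in\mathbb{T}^d$ put $\mathcal{E}_k(p)=\varepsilon(\tfrac k2+p)+\varepsilon(\tfrac k2-p)$ and $\mathcal{E}_{\min}(k)=\min_q\mathcal{E}_k(q)$. On $\ell^{2,e}(\mathbb{Z}^d)$ define $(\widehat H_0(k)\hat f)(x)=\sum_{s\in\mathbb{Z}^d}\hat{\mathcal{E}}_k(x-s)\hat f(s)$ with $\hat{\mathcal{E}}_k(x)=\int_{\mathbb{T}^d}e^{-\mathrm{i}(p,x)}\mathcal{E}_k(p)\,\eta(\mathrm{d}p)$, $(\widehat V\hat f)(x)=\hat v(x)\hat f(x)$, $(|\widehat V|^{1/2}\hat f)(x)=|\hat v(x)|^{1/2}\hat f(x)$, and $\widehat H_\mu(k)=\widehat H_0(k)+\mu\widehat V$, $\mu>0$. The bottom (threshold) of the essential spectrum of $\widehat H_\mu(k)$ is $\mathcal{E}_{\min}(k)$. $\mathbb{G}\subset\mathbb{T}^d$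 denotes the maximal open neighborhood of $0\in\mathbb{T}^d$ such that for every $k\in\mathbb{G}$ the function $\mathcal{E}_k(\cdot)\in C^{(3)}(\mathbb{T}^d)$ is a Morse function and its minimum $\mathcal{E}_{\min}(k)$ is attained at the point $p=0$. For $d\ge3$, $k\in\mathbb{G}$, the generalized Birman–Schwinger operator $\mathbb{B}_1(k,\mathcal{E}_{\min}(k))$ is the compact operator on $\ell^{2,e}(\mathbb{Z}^d)$ with kernel $$|\hat v(x)|^{1/2}\left(\int_{\mathbb{T}^d}\frac{e^{\mathrm{i}(q,x-y)}}{\mathcal{E}_k(q)-\mathcal{E}_{\min}(k)}\eta(\mathrm{d}q)\right)|\hat v(y)|^{1/2},\quad x,y\in\mathbb{Z}^d.$$ The threshold $\mathcal{E}_{\min}(k)$ is a singular point of multiplicity $n$ of $\widehat H_1(k)$ if $1$ is an eigenvalue of multiplicity $n$ of $\mathbb{B}_1(k,\mathcal{E}_{\min}(k))$. Let $(\mathcal{F}\hat f)(p)=\sum_{x}e^{\mathrm{i}(p,x)}\hat f(x)$. For $k,k_0\in\mathbb{G}$, $s\in\mathbb{Z}^d$, $\hat\psi\in\ell^{2,e}(\mathbb{Z}^d)$ put $$\mathcal{C}_s(k,k_0;\hat\psi)=\int_{\mathbb{T}^d}\frac{[1-\cos(p,s)]\,|(\mathcal{F}|\widehat V|^{1/2}\hat\psi)(p)|^2\,\eta(\mathrm{d}p)}{(\mathcal{E}_k(p)-\mathcal{E}_{\min}(k))(\mathcal{E}_{k_0}(p)-\mathcal{E}_{\min}(k_0))},$$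 $$\mathrm{L}(k,k_0;\hat\psi)=2\sum_{s\in\mathbb{Z}^d,\,s\ne0}\hat\varepsilon(s)\left[\cos\left(\tfrac k2,s\right)-\cos\left(\tfrac{k_0}2,s\right)\right]\mathcal{C}_s(k,k_0;\hat\psi).$$ Define $M_>(k_0;\hat\psi)$, $M_=(k_0;\hat\psi)$ as the sets of $k\in\mathbb{G}$ with $\mathrm{L}(k,k_0;\hat\psi)>0$, $=0$ respectively. With unions and intersections over all $\hat\psi\in\mathcal{H}_n$ with $\|\hat\psi\|=1$: $$\mathrm{M}_=(k_0;\mathcal{H}_n)=\bigcup M_=(k_0;\hat\psi),\ \ \mathcal{M}_>(k_0;\mathcal{H}_n)=\bigcap M_>(k_0;\hat\psi),\ \ \mathcal{M}_=(k_0;\mathcal{H}_n)=\bigcap M_=(k_0;\hat\psi).$$ *)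

theory Defs
  imports
    "HOL-Analysis.Analysis"
    "HOL-Library.Function_Algebras"
    "HOL-Library.Extended_Nat"
begin

section \<open>The torus and functions on it\<close>

(* A function on the torus (R/2piZ)^d is a function on real^'d that is 2pi-periodic in every
   coordinate; points of the torus are represented in the cell [-pi,pi)^d. *)

definition cell :: "(real ^ 'd) set" where
  "cell = {p. \<forall>j. - pi \<le> p $ j \<and> p $ j < pi}"

definition torus_open :: "(real ^ 'd) set \<Rightarrow> bool" where
  "torus_open U \<longleftrightarrow>
     U \<subseteq> cell \<and> open {p. \<exists>m :: int ^ 'd. p + (\<chi> j. 2 * pi * of_int (m $ j)) \<in> U}"

definition haar :: "(real ^ 'd) measure" where
  "haar = density lborel (\<lambda>p. ennreal (indicator cell p / (2 * pi) ^ CARD('d)))"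

definition pair :: "real ^ 'd \<Rightarrow> int ^ 'd \<Rightarrow> real" where
  "pair p x = (\<Sum>j\<in>UNIV. p $ j * of_int (x $ j))"

definition partial :: "('d::finite) \<Rightarrow> (real ^ 'd \<Rightarrow> real) \<Rightarrow> real ^ 'd \<Rightarrow> real" where
  "partial j f p = frechet_derivative f (at p) (axis j 1)"

fun C_class :: "nat \<Rightarrow> (real ^ 'd \<Rightarrow> real) \<Rightarrow> bool" where
  "C_class 0 f \<longleftrightarrow> continuous_on UNIV f"
| "C_class (Suc r) f \<longleftrightarrow> f differentiable_on UNIV \<and> (\<forall>j. C_class r (partial j f))"

definition hessian :: "(real ^ 'd \<Rightarrow> real) \<Rightarrow> real ^ 'd \<Rightarrow> real ^ 'd ^ 'd" where
  "hessian f p = (\<chi> i j. partial i (partial j f) p)"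

definition morse :: "(real ^ 'd \<Rightarrow> real) \<Rightarrow> bool" where
  "morse f \<longleftrightarrow>
     C_class 2 f \<and> (\<forall>p. (\<forall>j. partial j f p = 0) \<longrightarrow> invertible (hessian f p))"


section \<open>The space of even square-summable functions, and multiplicities\<close>

definition ell2e :: "(int ^ 'd \<Rightarrow> complex) set" where
  "ell2e = {f. (\<lambda>x. (cmod (f x))\<^sup>2) summable_on UNIV \<and> (\<forall>x. f (- x) = f x)}"

definition ell2_inner :: "(int ^ 'd \<Rightarrow> complex) \<Rightarrow> (int ^ 'd \<Rightarrow> complex) \<Rightarrow> complex" where
  "ell2_inner f g = (\<Sum>\<^sub>\<infinity>x. f x * cnj (g x))"

definition ell2_norm :: "(int ^ 'd \<Rightarrow> complex) \<Rightarrow> real" where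
  "ell2_norm f = sqrt (\<Sum>\<^sub>\<infinity>x. (cmod (f x))\<^sup>2)"

definition cscale :: "complex \<Rightarrow> ('a \<Rightarrow> complex) \<Rightarrow> 'a \<Rightarrow> complex" where
  "cscale c f = (\<lambda>x. c * f x)"

interpretation cfun: vector_space "cscale :: complex \<Rightarrow> ('a \<Rightarrow> complex) \<Rightarrow> 'a \<Rightarrow> complex"
  by unfold_locales (auto simp: cscale_def fun_eq_iff algebra_simps)

type_synonym 'd operator = "(int ^ 'd \<Rightarrow> complex) \<Rightarrow> int ^ 'd \<Rightarrow> complex"

definition eigenspace :: "('d::finite) operator \<Rightarrow> real \<Rightarrow> (int ^ 'd \<Rightarrow> complex) set" where
  "eigenspace A z = {f \<in> ell2e. \<forall>x. A f x = of_real z * f x}"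

definition eigenvalue :: "('d::finite) operator \<Rightarrow> real \<Rightarrow> bool" where
  "eigenvalue A z \<longleftrightarrow> (\<exists>f \<in> eigenspace A z. f \<noteq> 0)"

(* The library's dim is 0 for infinite-dimensional spaces, hence the case distinction. *)
definition multiplicity_of :: "('d::finite) operator \<Rightarrow> real \<Rightarrow> enat" where
  "multiplicity_of A z =
     (if \<exists>B. finite B \<and> eigenspace A z \<subseteq> cfun.span B
      then enat (cfun.dim (eigenspace A z)) else \<infinity>)"

(* Number of eigenvalues in (-\<infinity>, z), counted with multiplicities. *)
definition eigenvalue_count_below :: "('d::finite) operator \<Rightarrow> real \<Rightarrow> enat" where
  "eigenvalue_count_below A z =
     (SUP S \<in> {S. finite S \<and> S \<subseteq> {z'. eigenvalue A z' \<and> z' < z}}. \<Sum>z' \<in> S. multiplicity_of A z')"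

(* Re only selects the type real: the forms of the self-adjoint operators considered are real. *)
definition bounded_below_by :: "('d::finite) operator \<Rightarrow> real \<Rightarrow> bool" where
  "bounded_below_by A z \<longleftrightarrow>
     (\<forall>f \<in> ell2e. Re (ell2_inner (A f) f) \<ge> z * (ell2_norm f)\<^sup>2)"


section \<open>The two-particle dispersion and the operators\<close>

definition fourier :: "(int ^ 'd \<Rightarrow> complex) \<Rightarrow> real ^ 'd \<Rightarrow> complex" where
  "fourier f p = (\<Sum>\<^sub>\<infinity>x. cis (pair p x) * f x)"

(* eh and vh stand for the Fourier-side data, \<epsilon> hat and v hat.  For even summable eh the series is
   real, see of_real_disp below. *)
definition disp :: "(int ^ 'd \<Rightarrow> real) \<Rightarrow> real ^ 'd \<Rightarrow> real" where
  "disp eh p = Re (fourier (\<lambda>x. of_real (eh x)) p)"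

definition Ek :: "(int ^ 'd \<Rightarrow> real) \<Rightarrow> real ^ 'd \<Rightarrow> real ^ 'd \<Rightarrow> real" where
  "Ek eh k p = disp eh ((1/2) *\<^sub>R k + p) + disp eh ((1/2) *\<^sub>R k - p)"

definition Emin :: "(int ^ 'd \<Rightarrow> real) \<Rightarrow> real ^ 'd \<Rightarrow> real" where
  "Emin eh k = (INF q \<in> cell. Ek eh k q)"

definition Ek_hat :: "(int ^ 'd \<Rightarrow> real) \<Rightarrow> real ^ 'd \<Rightarrow> int ^ 'd \<Rightarrow> complex" where
  "Ek_hat eh k x = (LINT p|haar. cis (- pair p x) * of_real (Ek eh k p))"

definition H0 :: "(int ^ 'd \<Rightarrow> real) \<Rightarrow> real ^ 'd \<Rightarrow> ('d::finite) operator" where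
  "H0 eh k f x = (\<Sum>\<^sub>\<infinity>s. Ek_hat eh k (x - s) * f s)"

definition V_op :: "(int ^ 'd \<Rightarrow> real) \<Rightarrow> ('d::finite) operator" where
  "V_op vh f x = of_real (vh x) * f x"

definition V_abs_sqrt :: "(int ^ 'd \<Rightarrow> real) \<Rightarrow> ('d::finite) operator" where
  "V_abs_sqrt vh f x = of_real (sqrt \<bar>vh x\<bar>) * f x"

definition H_op :: "(int ^ 'd \<Rightarrow> real) \<Rightarrow> (int ^ 'd \<Rightarrow> real) \<Rightarrow> real \<Rightarrow> real ^ 'd \<Rightarrow> ('d::finite) operator" where
  "H_op eh vh \<mu> k f x = H0 eh k f x + of_real \<mu> * V_op vh f x"

definition G_nbhd :: "(int ^ 'd \<Rightarrow> real) \<Rightarrow> (real ^ 'd) set" where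
  "G_nbhd eh = \<Union>{U. torus_open U \<and> 0 \<in> U \<and>
     (\<forall>k \<in> U. C_class 3 (Ek eh k) \<and> morse (Ek eh k) \<and> Ek eh k 0 = Emin eh k)}"

definition B1_kernel ::
  "(int ^ 'd \<Rightarrow> real) \<Rightarrow> (int ^ 'd \<Rightarrow> real) \<Rightarrow> real ^ 'd \<Rightarrow> int ^ 'd \<Rightarrow> int ^ 'd \<Rightarrow> complex" where
  "B1_kernel eh vh k x y =
     of_real (sqrt \<bar>vh x\<bar>) *
     (LINT q|haar. cis (pair q (x - y)) / of_real (Ek eh k q - Emin eh k)) *
     of_real (sqrt \<bar>vh y\<bar>)"

definition B1 :: "(int ^ 'd \<Rightarrow> real) \<Rightarrow> (int ^ 'd \<Rightarrow> real) \<Rightarrow> real ^ 'd \<Rightarrow> ('d::finite) operator" where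
  "B1 eh vh k f x = (\<Sum>\<^sub>\<infinity>y. B1_kernel eh vh k x y * f y)"

definition singular_point ::
  "(int ^ 'd \<Rightarrow> real) \<Rightarrow> (int ^ 'd \<Rightarrow> real) \<Rightarrow> real ^ 'd \<Rightarrow> nat \<Rightarrow> bool" where
  "singular_point eh vh k n \<longleftrightarrow>
     eigenvalue (B1 eh vh k) 1 \<and> multiplicity_of (B1 eh vh k) 1 = enat n"


section \<open>The functional L and the sets of quasi-momenta\<close>

definition C_integrand ::
  "(int ^ 'd \<Rightarrow> real) \<Rightarrow> (int ^ 'd \<Rightarrow> real) \<Rightarrow> int ^ 'd \<Rightarrow> real ^ 'd \<Rightarrow> real ^ 'd \<Rightarrow>
   (int ^ 'd \<Rightarrow> complex) \<Rightarrow> real ^ 'd \<Rightarrow> real" where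
  "C_integrand eh vh s k k0 \<psi> p =
     (1 - cos (pair p s)) * (cmod (fourier (V_abs_sqrt vh \<psi>) p))\<^sup>2 /
     ((Ek eh k p - Emin eh k) * (Ek eh k0 p - Emin eh k0))"

definition C_coeff ::
  "(int ^ 'd \<Rightarrow> real) \<Rightarrow> (int ^ 'd \<Rightarrow> real) \<Rightarrow> int ^ 'd \<Rightarrow> real ^ 'd \<Rightarrow> real ^ 'd \<Rightarrow>
   (int ^ 'd \<Rightarrow> complex) \<Rightarrow> real" where
  "C_coeff eh vh s k k0 \<psi> = (LINT p|haar. C_integrand eh vh s k k0 \<psi> p)"

definition L_weight :: "(int ^ 'd \<Rightarrow> real) \<Rightarrow> real ^ 'd \<Rightarrow> real ^ 'd \<Rightarrow> int ^ 'd \<Rightarrow> real" where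
  "L_weight eh k k0 s = eh s * (cos (pair ((1/2) *\<^sub>R k) s) - cos (pair ((1/2) *\<^sub>R k0) s))"

definition L_fun ::
  "(int ^ 'd \<Rightarrow> real) \<Rightarrow> (int ^ 'd \<Rightarrow> real) \<Rightarrow> real ^ 'd \<Rightarrow> real ^ 'd \<Rightarrow>
   (int ^ 'd \<Rightarrow> complex) \<Rightarrow> real" where
  "L_fun eh vh k k0 \<psi> = 2 * (\<Sum>\<^sub>\<infinity>s \<in> {s. s \<noteq> 0}. L_weight eh k k0 s * C_coeff eh vh s k k0 \<psi>)"

(* Divergent integrals and sums have the value 0 in the library, so L_fun = 0 and L_fun > 0 only say
   what they should where L_fun is given by convergent expressions.  In dimension at least 3 this is
   automatic when 0 is the only minimum point of Ek k and of Ek k0; if they share a further minimum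
   point, an integral C_s can be infinite.  A factor L_weight = 0 cancels an infinite integral. *)
definition L_defined ::
  "(int ^ 'd \<Rightarrow> real) \<Rightarrow> (int ^ 'd \<Rightarrow> real) \<Rightarrow> real ^ 'd \<Rightarrow> real ^ 'd \<Rightarrow>
   (int ^ 'd \<Rightarrow> complex) \<Rightarrow> bool" where
  "L_defined eh vh k k0 \<psi> \<longleftrightarrow>
     (\<forall>s. s \<noteq> 0 \<longrightarrow> L_weight eh k k0 s \<noteq> 0 \<longrightarrow> integrable haar (C_integrand eh vh s k k0 \<psi>)) \<and>
     (\<lambda>s. L_weight eh k k0 s * C_coeff eh vh s k k0 \<psi>) summable_on {s. s \<noteq> 0}"

definition M_gt ::
  "(int ^ 'd \<Rightarrow> real) \<Rightarrow> (int ^ 'd \<Rightarrow> real) \<Rightarrow> real ^ 'd \<Rightarrow> (int ^ 'd \<Rightarrow> complex) \<Rightarrow> (real ^ 'd) set"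
  where
  "M_gt eh vh k0 \<psi> = {k \<in> G_nbhd eh. L_defined eh vh k k0 \<psi> \<and> L_fun eh vh k k0 \<psi> > 0}"

definition M_eq ::
  "(int ^ 'd \<Rightarrow> real) \<Rightarrow> (int ^ 'd \<Rightarrow> real) \<Rightarrow> real ^ 'd \<Rightarrow> (int ^ 'd \<Rightarrow> complex) \<Rightarrow> (real ^ 'd) set"
  where
  "M_eq eh vh k0 \<psi> = {k \<in> G_nbhd eh. L_defined eh vh k k0 \<psi> \<and> L_fun eh vh k k0 \<psi> = 0}"

definition M_eq_some ::
  "(int ^ 'd \<Rightarrow> real) \<Rightarrow> (int ^ 'd \<Rightarrow> real) \<Rightarrow> real ^ 'd \<Rightarrow> (int ^ 'd \<Rightarrow> complex) set \<Rightarrow> (real ^ 'd) set"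
  where
  "M_eq_some eh vh k0 \<H> = (\<Union>\<psi> \<in> {\<psi> \<in> \<H>. ell2_norm \<psi> = 1}. M_eq eh vh k0 \<psi>)"

definition M_gt_all ::
  "(int ^ 'd \<Rightarrow> real) \<Rightarrow> (int ^ 'd \<Rightarrow> real) \<Rightarrow> real ^ 'd \<Rightarrow> (int ^ 'd \<Rightarrow> complex) set \<Rightarrow> (real ^ 'd) set"
  where
  "M_gt_all eh vh k0 \<H> = (\<Inter>\<psi> \<in> {\<psi> \<in> \<H>. ell2_norm \<psi> = 1}. M_gt eh vh k0 \<psi>)"

definition M_eq_all ::
  "(int ^ 'd \<Rightarrow> real) \<Rightarrow> (int ^ 'd \<Rightarrow> real) \<Rightarrow> real ^ 'd \<Rightarrow> (int ^ 'd \<Rightarrow> complex) set \<Rightarrow> (real ^ 'd) set"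
  where
  "M_eq_all eh vh k0 \<H> = (\<Inter>\<psi> \<in> {\<psi> \<in> \<H>. ell2_norm \<psi> = 1}. M_eq eh vh k0 \<psi>)"


section \<open>Consistency checks\<close>

lemma pair_minus_right: "pair p (- x) = - pair p x"
  by (simp add: pair_def sum_negf)

lemma pair_minus_left: "pair (- p) x = - pair p x"
  by (simp add: pair_def sum_negf)

lemma infsum_uminus:
  fixes f :: "int ^ 'd \<Rightarrow> complex"
  shows "(\<Sum>\<^sub>\<infinity>x. f (- x)) = (\<Sum>\<^sub>\<infinity>x. f x)"
proof -
  have "bij (uminus :: int ^ 'd \<Rightarrow> int ^ 'd)"
    by (rule o_bij[of uminus]) auto
  from infsum_reindex_bij_betw[OF this, of f] show ?thesis by simp
qed

lemma fourier_even:
  assumes "\<And>x. eh (- x) = eh x"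
  shows "fourier (\<lambda>x. of_real (eh x)) (- p) = fourier (\<lambda>x. of_real (eh x)) p"
  using infsum_uminus[of "\<lambda>x. cis (pair p x) * of_real (eh x)"] assms
  by (simp add: fourier_def pair_minus_left pair_minus_right)

lemma disp_even:
  assumes "\<And>x. eh (- x) = eh x"
  shows "disp eh (- p) = disp eh p"
  using fourier_even[of eh, OF assms] by (simp add: disp_def)

lemma of_real_disp:
  assumes "\<And>x. eh (- x) = eh x"
  shows "complex_of_real (disp eh p) = fourier (\<lambda>x. of_real (eh x)) p"
proof -
  let ?f = "\<lambda>x. of_real (eh x) :: complex"
  have "cnj (fourier ?f p) = fourier ?f (- p)"
    by (simp add: fourier_def infsum_cnj [symmetric] cis_cnj pair_minus_left)
  then have "cnj (fourier ?f p) = fourier ?f p"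
    using fourier_even[of eh, OF assms] by simp
  then show ?thesis
    unfolding disp_def by (metis Reals_cnj_iff of_real_Re)
qed

lemma cell_in_borel: "cell \<in> sets (borel :: (real ^ 'd) measure)"
proof -
  have "cell = (\<Inter>j\<in>UNIV. {p :: real ^ 'd. - pi \<le> p $ j \<and> p $ j < pi})"
    by (auto simp: cell_def)
  also have "\<dots> \<in> sets borel"
    by measurable
  finally show ?thesis .
qed

lemma emeasure_cell: "emeasure lborel (cell :: (real ^ 'd) set) = ennreal ((2 * pi) ^ CARD('d))"
proof -
  let ?a = "(\<chi> j. - pi) :: real ^ 'd" and ?b = "(\<chi> j. pi) :: real ^ 'd"
  have prod: "(\<Prod>i\<in>(Basis :: (real ^ 'd) set). (?b - ?a) \<bullet> i) = (2 * pi) ^ CARD('d)"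
    by (simp add: Basis_vec_def inner_axis prod.reindex axis_eq_axis UNION_singleton_eq_range
        card_image inj_on_def)
  have le: "\<And>i. i \<in> Basis \<Longrightarrow> ?a \<bullet> i \<le> ?b \<bullet> i"
    by (auto simp: Basis_vec_def inner_axis)
  have "box ?a ?b \<subseteq> cell" "cell \<subseteq> cbox ?a ?b"
    by (auto simp: cell_def mem_box_cart less_imp_le)
  then have "emeasure lborel (box ?a ?b) \<le> emeasure lborel (cell :: (real ^ 'd) set)"
    "emeasure lborel (cell :: (real ^ 'd) set) \<le> emeasure lborel (cbox ?a ?b)"
    using cell_in_borel by (auto intro!: emeasure_mono)
  moreover have "emeasure lborel (box ?a ?b) = ennreal ((2 * pi) ^ CARD('d))"
    using le prod by (simp add: emeasure_lborel_box)
  moreover have "emeasure lborel (cbox ?a ?b) = ennreal ((2 * pi) ^ CARD('d))"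
    using le prod by (simp add: emeasure_lborel_cbox)
  ultimately show ?thesis by (metis antisym)
qed

lemma emeasure_haar_UNIV: "emeasure (haar :: (real ^ 'd) measure) UNIV = 1"
proof -
  have [measurable]: "cell \<in> sets (borel :: (real ^ 'd) measure)"
    by (rule cell_in_borel)
  have "emeasure (haar :: (real ^ 'd) measure) UNIV =
      (\<integral>\<^sup>+p. ennreal (1 / (2 * pi) ^ CARD('d)) * indicator (cell :: (real ^ 'd) set) p \<partial>lborel)"
    unfolding haar_def by (subst emeasure_density) (auto intro!: nn_integral_cong split: split_indicator)
  also have "\<dots> = ennreal (1 / (2 * pi) ^ CARD('d)) * ennreal ((2 * pi) ^ CARD('d))"
    by (subst nn_integral_cmult_indicator) (auto simp: emeasure_cell)
  also have "\<dots> = 1"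
    by (simp flip: ennreal_mult)
  finally show ?thesis .
qed

end

theory Submission
  imports Defs "HOL-Complex_Analysis.Great_Picard"
begin

text \<open>Write \<open>w\<^sub>k = Ek k - Emin k\<close> and let \<open>g\<close> be the Fourier transform of \<open>|V|^(1/2) \<psi>\<close>.  For an
  eigenvector \<open>\<psi>\<close> of the Birman--Schwinger operator at \<open>k0\<close> with eigenvalue 1, the integral of
  \<open>|g|^2 / w\<^sub>k\<^sub>0\<close> is \<open>\<parallel>\<psi>\<parallel>^2\<close>, and expanding \<open>w\<^sub>k\<^sub>0 - w\<^sub>k\<close> into its cosine series shows that
  \<open>L(k, k0; \<psi>)\<close> is the integral of \<open>|g|^2 / w\<^sub>k\<close> minus that of \<open>|g|^2 / w\<^sub>k\<^sub>0\<close>.  Hence \<open>L \<ge> 0\<close> makes the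
  former integral at least 1 for unit vectors \<open>\<psi>\<close>.

  For \<open>\<mu> > 1\<close> and small \<open>\<delta> > 0\<close> let \<open>b\<close> be the integral of \<open>|g|^2 / (w\<^sub>k + \<delta>)\<close>, so that \<open>b > 1 / \<mu>\<close>.  On
  the function with Fourier transform \<open>g / (w\<^sub>k + \<delta>)\<close> the form of \<open>H\<^sub>\<mu>(k) - Emin k\<close> is at most
  \<open>b - \<mu> b^2 < 0\<close>.  These trial functions depend linearly on \<open>\<psi>\<close>, so fewer than
  \<open>n\<close> orthogonality conditions are met by one of them.  Minimizing the form on the orthogonal
  complement of the eigenvectors already found then yields \<open>n\<close> eigenvectors below the threshold.\<close>


section \<open>Square summable functions and convolutions\<close>

text \<open>The quotient g / w_k need not be square integrable near the minimum, so the trial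
  functions use w_k + \<delta>, whose reciprocal is bounded. Linearity in \<psi> then demands one
  \<delta> for the whole unit sphere of the eigenspace; the distance 1 - 1/\<mu> between 1 and
  1/\<mu> is the loss that may be incurred in choosing it.

  Minimization succeeds below the threshold because the form of H0(k) - Emin k is nonnegative and
  the potential is summable: a negative infimum cannot be lost in a weak limit.

  The operators are handled on the lattice, where H0(k) - Emin k is convolution by an absolutely
  summable sequence. The torus enters through absolutely convergent Fourier series, paired with
  functions that are only integrable. Since a divergent integral has the value 0, convergence has to
  be earned: for 1 / w_k0 it is read off from the eigenvalue 1, and for |g|^2 / w_k it comes out of
  the identity for L. Quotients by w_k make sense almost everywhere because a Morse function attains
  its minimum on a countable set only.\<close>

definition sqsum :: "(int ^ 'd \<Rightarrow> complex) \<Rightarrow> bool" where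
  "sqsum f \<longleftrightarrow> (\<lambda>x. (cmod (f x))\<^sup>2) summable_on UNIV"

lemma ell2e_iff: "f \<in> ell2e \<longleftrightarrow> sqsum f \<and> (\<forall>x. f (- x) = f x)"
  by (simp add: ell2e_def sqsum_def)

lemma sqsum_add:
  assumes "sqsum f" "sqsum g"
  shows "sqsum (\<lambda>x. f x + g x)"
  unfolding sqsum_def
proof (rule summable_on_comparison_test)
  show "(\<lambda>x. 2 * (cmod (f x))\<^sup>2 + 2 * (cmod (g x))\<^sup>2) summable_on UNIV"
    using assms unfolding sqsum_def by (intro summable_on_add summable_on_cmult_right)
  fix x
  have "(cmod (f x + g x))\<^sup>2 \<le> (cmod (f x) + cmod (g x))\<^sup>2"
    by (simp add: norm_triangle_ineq)
  also have "\<dots> \<le> 2 * (cmod (f x))\<^sup>2 + 2 * (cmod (g x))\<^sup>2"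
    using sum_squares_bound[of "cmod (f x)" "cmod (g x)"] by (simp add: power2_sum)
  finally show "(cmod (f x + g x))\<^sup>2 \<le> 2 * (cmod (f x))\<^sup>2 + 2 * (cmod (g x))\<^sup>2" .
qed auto

lemma sqsum_cmult: "sqsum f \<Longrightarrow> sqsum (\<lambda>x. c * f x)"
  unfolding sqsum_def by (simp add: norm_mult power_mult_distrib summable_on_cmult_right)

lemma sqsum_diff: "sqsum f \<Longrightarrow> sqsum g \<Longrightarrow> sqsum (\<lambda>x. f x - g x)"
  using sqsum_add[of f "\<lambda>x. (-1) * g x"] sqsum_cmult[of g "-1"] by simp

lemma sqsum_zero: "sqsum (\<lambda>x. 0)"
  by (simp add: sqsum_def)

lemma sqsum_sum: "(\<And>i. i \<in> I \<Longrightarrow> sqsum (f i)) \<Longrightarrow> sqsum (\<lambda>x. \<Sum>i\<in>I. f i x)"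
  by (induction I rule: infinite_finite_induct) (auto intro: sqsum_zero sqsum_add)

lemma sqsum_finite_support:
  assumes "finite F"
  shows "sqsum (\<lambda>x. if x \<in> F then f x else 0)"
proof -
  have "(\<lambda>x. (cmod (if x \<in> F then f x else 0))\<^sup>2) summable_on UNIV \<longleftrightarrow>
        (\<lambda>x. (cmod (f x))\<^sup>2) summable_on F"
    by (rule summable_on_cong_neutral) auto
  then show ?thesis using assms by (simp add: sqsum_def)
qed

lemma sqsum_bounded_mult:
  assumes "sqsum f" and "\<And>x. cmod (u x) \<le> C"
  shows "sqsum (\<lambda>x. u x * f x)"
  unfolding sqsum_def
proof (rule summable_on_comparison_test)
  show "(\<lambda>x. C\<^sup>2 * (cmod (f x))\<^sup>2) summable_on UNIV"
    using assms(1) unfolding sqsum_def by (rule summable_on_cmult_right)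
  fix x
  show "(cmod (u x * f x))\<^sup>2 \<le> C\<^sup>2 * (cmod (f x))\<^sup>2"
    using assms(2)[of x] by (auto simp: norm_mult power_mult_distrib intro!: mult_right_mono power_mono)
qed auto

lemma prod_abs_summable:
  assumes "sqsum f" "sqsum g"
  shows "(\<lambda>x. cmod (f x) * cmod (g x)) summable_on UNIV"
proof (rule summable_on_comparison_test)
  show "(\<lambda>x. (cmod (f x))\<^sup>2 + (cmod (g x))\<^sup>2) summable_on UNIV"
    using assms unfolding sqsum_def by (intro summable_on_add)
  fix x
  show "cmod (f x) * cmod (g x) \<le> (cmod (f x))\<^sup>2 + (cmod (g x))\<^sup>2"
    using sum_squares_bound[of "cmod (f x)" "cmod (g x)"]
      mult_nonneg_nonneg[OF norm_ge_zero[of "f x"] norm_ge_zero[of "g x"]] by linarith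
qed auto

lemma prod_summable:
  assumes "sqsum f" "sqsum g"
  shows "(\<lambda>x. f x * cnj (g x)) summable_on UNIV"
  by (rule abs_summable_summable) (simp add: norm_mult prod_abs_summable[OF assms])

lemma inner_add_left:
  "sqsum f \<Longrightarrow> sqsum g \<Longrightarrow> sqsum h \<Longrightarrow>
   ell2_inner (\<lambda>x. f x + g x) h = ell2_inner f h + ell2_inner g h"
  unfolding ell2_inner_def by (simp add: distrib_right infsum_add prod_summable)

lemma inner_cmult_left: "ell2_inner (\<lambda>x. c * f x) h = c * ell2_inner f h"
  unfolding ell2_inner_def by (simp add: infsum_cmult_right' mult.assoc)

lemma inner_diff_left:
  "sqsum f \<Longrightarrow> sqsum g \<Longrightarrow> sqsum h \<Longrightarrow>
   ell2_inner (\<lambda>x. f x - g x) h = ell2_inner f h - ell2_inner g h"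
  using inner_add_left[of f "\<lambda>x. (-1) * g x" h] inner_cmult_left[of "-1" g h] sqsum_cmult[of g "-1"]
  by simp

lemma inner_sum_left:
  "(\<And>i. i \<in> I \<Longrightarrow> sqsum (f i)) \<Longrightarrow> sqsum h \<Longrightarrow>
   ell2_inner (\<lambda>x. \<Sum>i\<in>I. c i * f i x) h = (\<Sum>i\<in>I. c i * ell2_inner (f i) h)"
proof (induction I rule: infinite_finite_induct)
  case (insert i I)
  then show ?case
    by (simp add: inner_add_left sqsum_cmult sqsum_sum inner_cmult_left)
qed (auto simp: ell2_inner_def)

lemma ell2_inner_commute: "ell2_inner g f = cnj (ell2_inner f g)"
  unfolding ell2_inner_def by (simp add: mult.commute flip: infsum_cnj)

lemma inner_add_right:
  "sqsum f \<Longrightarrow> sqsum g \<Longrightarrow> sqsum h \<Longrightarrow>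
   ell2_inner h (\<lambda>x. f x + g x) = ell2_inner h f + ell2_inner h g"
  unfolding ell2_inner_commute[of h] by (simp add: inner_add_left)

lemma inner_cmult_right: "ell2_inner h (\<lambda>x. c * f x) = cnj c * ell2_inner h f"
  unfolding ell2_inner_commute[of h] by (simp add: inner_cmult_left)

lemma inner_diff_right:
  "sqsum f \<Longrightarrow> sqsum g \<Longrightarrow> sqsum h \<Longrightarrow>
   ell2_inner h (\<lambda>x. f x - g x) = ell2_inner h f - ell2_inner h g"
  unfolding ell2_inner_commute[of h] by (simp add: inner_diff_left)

lemma inner_sum_right:
  "(\<And>i. i \<in> I \<Longrightarrow> sqsum (f i)) \<Longrightarrow> sqsum h \<Longrightarrow>
   ell2_inner h (\<lambda>x. \<Sum>i\<in>I. c i * f i x) = (\<Sum>i\<in>I. cnj (c i) * ell2_inner h (f i))"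
  unfolding ell2_inner_commute[of h] by (subst inner_sum_left) auto

lemma ell2_norm_sq: "(ell2_norm f)\<^sup>2 = (\<Sum>\<^sub>\<infinity>x. (cmod (f x))\<^sup>2)"
  by (simp add: ell2_norm_def infsum_nonneg)

lemma ell2_norm_nonneg: "ell2_norm f \<ge> 0"
  by (simp add: ell2_norm_def infsum_nonneg)

lemma inner_self: "sqsum f \<Longrightarrow> ell2_inner f f = of_real ((ell2_norm f)\<^sup>2)"
proof -
  assume "sqsum f"
  then have "((\<lambda>x. of_real ((cmod (f x))\<^sup>2)) has_sum complex_of_real ((ell2_norm f)\<^sup>2)) UNIV"
    unfolding ell2_norm_sq by (intro has_sum_of_real) (simp add: sqsum_def)
  then show ?thesis
    unfolding ell2_inner_def by (simp add: complex_norm_square[symmetric] infsumI)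
qed

lemma ell2_norm_cmult: "ell2_norm (\<lambda>x. c * f x) = cmod c * ell2_norm f"
  by (simp add: ell2_norm_def norm_mult power_mult_distrib infsum_cmult_right' real_sqrt_mult)

lemma ell2_norm_eq_0D:
  assumes "sqsum f" "ell2_norm f = 0"
  shows "f = (\<lambda>x. 0)"
proof
  fix x
  have "(\<Sum>\<^sub>\<infinity>x. (cmod (f x))\<^sup>2) = 0" using ell2_norm_sq[of f] assms by simp
  then have "(cmod (f x))\<^sup>2 = 0"
    using nonneg_infsum_le_0D[of "\<lambda>x. (cmod (f x))\<^sup>2" UNIV x] assms by (simp add: sqsum_def)
  then show "f x = 0" by simp
qed

lemma sum_le_norm_sq:
  assumes "sqsum f" "finite F"
  shows "(\<Sum>x\<in>F. (cmod (f x))\<^sup>2) \<le> (ell2_norm f)\<^sup>2"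
  unfolding ell2_norm_sq by (rule finite_sum_le_infsum) (use assms in \<open>auto simp: sqsum_def\<close>)

lemma cmod_le_norm:
  assumes "sqsum f" shows "cmod (f x) \<le> ell2_norm f"
  using sum_le_norm_sq[OF assms, of "{x}"] by (simp add: ell2_norm_nonneg power2_le_iff_abs_le)

text \<open>Bounds on finite partial sums survive pointwise limits, and Bessel's inequality delivers
  them in this form.\<close>

lemma bounded_sums_imp_sqsum:
  assumes "\<And>F. finite F \<Longrightarrow> (\<Sum>x\<in>F. (cmod (f x))\<^sup>2) \<le> B"
  shows "sqsum f" and "(ell2_norm f)\<^sup>2 \<le> B"
proof -
  show s: "sqsum f"
    unfolding sqsum_def
    by (rule nonneg_bdd_above_summable_on) (use assms in \<open>auto intro!: bdd_aboveI2\<close>)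
  show "(ell2_norm f)\<^sup>2 \<le> B"
    unfolding ell2_norm_sq by (rule infsum_le_finite_sums) (use s assms in \<open>auto simp: sqsum_def\<close>)
qed

lemma Cauchy_Schwarz_abs:
  assumes "sqsum f" "sqsum g"
  shows "(\<Sum>\<^sub>\<infinity>x. cmod (f x) * cmod (g x)) \<le> ell2_norm f * ell2_norm g"
proof (rule infsum_le_finite_sums)
  show "(\<lambda>x. cmod (f x) * cmod (g x)) summable_on UNIV" by (rule prod_abs_summable[OF assms])
  fix F :: "(int ^ 'a) set" assume F: "finite F"
  have *: "L2_set (\<lambda>x. cmod (h x)) F \<le> ell2_norm h" if "sqsum h" for h :: "int ^ 'a \<Rightarrow> complex"
    unfolding L2_set_def using sum_le_norm_sq[OF that F] by (simp add: ell2_norm_nonneg real_le_lsqrt)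
  have "(\<Sum>x\<in>F. cmod (f x) * cmod (g x)) \<le> L2_set (\<lambda>x. cmod (f x)) F * L2_set (\<lambda>x. cmod (g x)) F"
    using L2_set_mult_ineq[of "\<lambda>x. cmod (f x)" "\<lambda>x. cmod (g x)" F] by simp
  also have "\<dots> \<le> ell2_norm f * ell2_norm g"
    using * assms by (intro mult_mono) (auto simp: L2_set_nonneg ell2_norm_nonneg)
  finally show "(\<Sum>x\<in>F. cmod (f x) * cmod (g x)) \<le> ell2_norm f * ell2_norm g" .
qed

lemma Cauchy_Schwarz_inner:
  assumes "sqsum f" "sqsum g"
  shows "cmod (ell2_inner f g) \<le> ell2_norm f * ell2_norm g"
proof -
  have "cmod (ell2_inner f g) \<le> (\<Sum>\<^sub>\<infinity>x. cmod (f x * cnj (g x)))"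
    unfolding ell2_inner_def
    by (rule norm_infsum_bound) (use prod_abs_summable[OF assms] in \<open>simp add: norm_mult\<close>)
  also have "\<dots> \<le> ell2_norm f * ell2_norm g"
    using Cauchy_Schwarz_abs[OF assms] by (simp add: norm_mult)
  finally show ?thesis .
qed

section \<open>Convolution by absolutely summable kernels\<close>

definition conv :: "(int ^ 'd \<Rightarrow> complex) \<Rightarrow> (int ^ 'd \<Rightarrow> complex) \<Rightarrow> int ^ 'd \<Rightarrow> complex" where
  "conv a f x = (\<Sum>\<^sub>\<infinity>s. a (x - s) * f s)"

lemma summable_on_shift_left:
  fixes g :: "int ^ 'd \<Rightarrow> 'b::{comm_monoid_add,topological_space}"
  shows "(\<lambda>s. g (x - s)) summable_on UNIV \<longleftrightarrow> g summable_on UNIV"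
  by (rule summable_on_reindex_bij_witness[of _ "\<lambda>s. x - s" "\<lambda>s. x - s"]) auto

lemma infsum_shift_left:
  fixes g :: "int ^ 'd \<Rightarrow> 'b::{comm_monoid_add,t2_space}"
  shows "(\<Sum>\<^sub>\<infinity>s. g (x - s)) = (\<Sum>\<^sub>\<infinity>s. g s)"
  by (rule infsum_reindex_bij_witness[of _ "\<lambda>s. x - s" "\<lambda>s. x - s"]) auto

text \<open>The shear (x, s) \<mapsto> (s, x - s), respectively (x, s) \<mapsto> (x, x - s), turns
  the kernel into a product of summable functions of separate variables.\<close>

lemma summable_kernel_product:
  fixes a b :: "int ^ 'd \<Rightarrow> real"
  assumes "a summable_on UNIV" "b summable_on UNIV" "\<And>x. a x \<ge> 0" "\<And>x. b x \<ge> 0"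
  shows "(\<lambda>(x, s). a (x - s) * b s) summable_on UNIV" "(\<lambda>(x, s). a (x - s) * b x) summable_on UNIV"
proof -
  have *: "(\<lambda>(s, t). b s * a t) summable_on (UNIV \<times> UNIV)"
  proof (rule summable_on_SigmaI[where g = "\<lambda>s. b s * infsum a UNIV"])
    show "((\<lambda>t. case (s, t) of (s, t) \<Rightarrow> b s * a t) has_sum b s * infsum a UNIV) UNIV" for s
      using has_sum_cmult_right[OF has_sum_infsum[OF assms(1)]] by simp
    show "(\<lambda>s. b s * infsum a UNIV) summable_on UNIV"
      using assms by (intro summable_on_cmult_left)
  qed (use assms in auto)
  have "(\<lambda>(x, s). a (x - s) * b s) summable_on UNIV \<longleftrightarrow> (\<lambda>(s, t). b s * a t) summable_on UNIV"
    by (rule summable_on_reindex_bij_witness[of _ "\<lambda>(s,t). (t + s, s)" "\<lambda>(x,s). (s, x - s)"]) auto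
  then show "(\<lambda>(x, s). a (x - s) * b s) summable_on UNIV" using * by simp
  have "(\<lambda>(x, s). a (x - s) * b x) summable_on UNIV \<longleftrightarrow> (\<lambda>(s, t). b s * a t) summable_on UNIV"
    by (rule summable_on_reindex_bij_witness[of _ "\<lambda>(x,t). (x, x - t)" "\<lambda>(x,s). (x, x - s)"]) auto
  then show "(\<lambda>(x, s). a (x - s) * b x) summable_on UNIV" using * by simp
qed

text \<open>Bounding |f s| |g x| by |f s|^2 + |g x|^2 reduces the claim to the two product kernels.
  Summability over pairs is what Fubini and the approximation by finite squares rest on.\<close>

lemma kernel_form_summable:
  assumes "(\<lambda>x. cmod (a x)) summable_on UNIV" "sqsum f" "sqsum g"
  shows "(\<lambda>(x, s). a (x - s) * f s * cnj (g x)) summable_on UNIV"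
proof (rule abs_summable_summable, rule summable_on_comparison_test)
  show "(\<lambda>p. (\<lambda>(x, s). cmod (a (x - s)) * (cmod (f s))\<^sup>2) p + (\<lambda>(x, s). cmod (a (x - s)) * (cmod (g x))\<^sup>2) p)
      summable_on UNIV"
    using assms unfolding sqsum_def
    by (intro summable_on_add summable_kernel_product) auto
  fix p :: "(int ^ 'a) \<times> (int ^ 'a)"
  obtain x s where p: "p = (x, s)" by (cases p)
  have "cmod (f s) * cmod (g x) \<le> (cmod (f s))\<^sup>2 + (cmod (g x))\<^sup>2"
    using sum_squares_bound[of "cmod (f s)" "cmod (g x)"]
      mult_nonneg_nonneg[OF norm_ge_zero[of "f s"] norm_ge_zero[of "g x"]] by linarith
  from mult_left_mono[OF this, of "cmod (a (x - s))"]
  show "cmod (case p of (x, s) \<Rightarrow> a (x - s) * f s * cnj (g x)) \<le>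
     (\<lambda>(x, s). cmod (a (x - s)) * (cmod (f s))\<^sup>2) p + (\<lambda>(x, s). cmod (a (x - s)) * (cmod (g x))\<^sup>2) p"
    by (simp add: p norm_mult algebra_simps)
qed auto

lemma conv_summable:
  fixes a :: "int ^ 'd \<Rightarrow> complex"
  assumes "(\<lambda>x. cmod (a x)) summable_on UNIV" "\<And>x. cmod (f x) \<le> C"
  shows "(\<lambda>s. a (x - s) * f s) summable_on UNIV"
proof (rule abs_summable_summable, rule summable_on_comparison_test)
  show "(\<lambda>s. C * cmod (a (x - s))) summable_on UNIV"
    using assms(1) summable_on_shift_left[of "\<lambda>x. cmod (a x)" x] by (intro summable_on_cmult_right) simp
  show "cmod (a (x - s) * f s) \<le> C * cmod (a (x - s))" for s
    using mult_right_mono[OF assms(2)[of s] norm_ge_zero[of "a (x - s)"]] by (simp add: norm_mult mult.commute)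
qed auto

lemma conv_summable_sqsum:
  fixes a :: "int ^ 'd \<Rightarrow> complex"
  assumes "(\<lambda>x. cmod (a x)) summable_on UNIV" "sqsum f"
  shows "(\<lambda>s. a (x - s) * f s) summable_on UNIV"
  using conv_summable[OF assms(1) cmod_le_norm[OF assms(2)]] .

lemma conv_add:
  assumes "(\<lambda>x. cmod (a x)) summable_on UNIV" "sqsum f" "sqsum g"
  shows "conv a (\<lambda>x. f x + g x) x = conv a f x + conv a g x"
  unfolding conv_def using assms by (simp add: distrib_left infsum_add conv_summable_sqsum)

lemma conv_cmult: "conv a (\<lambda>x. c * f x) x = c * conv a f x"
  unfolding conv_def by (simp add: mult.left_commute infsum_cmult_right')

lemma conv_diff:
  assumes "(\<lambda>x. cmod (a x)) summable_on UNIV" "sqsum f" "sqsum g"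
  shows "conv a (\<lambda>x. f x - g x) x = conv a f x - conv a g x"
  using conv_add[OF assms(1,2) sqsum_cmult[OF assms(3), of "-1"], of x] conv_cmult[of a "-1" g x] by simp

text \<open>Schur's test: Cauchy--Schwarz with respect to the weight \<open>s \<mapsto> |a (x - s)|\<close>.\<close>

lemma sqsum_conv:
  fixes a :: "int ^ 'd \<Rightarrow> complex"
  assumes a: "(\<lambda>x. cmod (a x)) summable_on UNIV" and f: "sqsum f"
  shows "sqsum (conv a f)"
proof -
  define A where "A = (\<Sum>\<^sub>\<infinity>x. cmod (a x))"
  define S where "S x = (\<Sum>\<^sub>\<infinity>s. cmod (a (x - s)) * (cmod (f s))\<^sup>2)" for x
  have prod: "(\<lambda>(x, s). cmod (a (x - s)) * (cmod (f s))\<^sup>2) summable_on UNIV \<times> UNIV"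
    using summable_kernel_product(1)[OF a, of "\<lambda>s. (cmod (f s))\<^sup>2"] f by (simp add: sqsum_def)
  have S1: "(\<lambda>s. cmod (a (x - s)) * (cmod (f s))\<^sup>2) summable_on UNIV" for x
    using summable_on_SigmaD1[OF prod, of x] by simp
  have S2: "S summable_on UNIV"
    unfolding S_def using summable_on_SigmaD[OF prod] S1 by simp
  have le: "(cmod (conv a f x))\<^sup>2 \<le> A * S x" for x
  proof -
    define u v where "u s = complex_of_real (sqrt (cmod (a (x - s))))"
      and "v s = complex_of_real (sqrt (cmod (a (x - s))) * cmod (f s))" for s
    have u: "sqsum u"
      using a summable_on_shift_left[of "\<lambda>x. cmod (a x)" x] by (simp add: sqsum_def u_def)
    have v: "sqsum v" using S1[of x] by (simp add: sqsum_def v_def power_mult_distrib norm_mult)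
    have uv: "cmod (u s) * cmod (v s) = cmod (a (x - s) * f s)" for s
      by (simp add: u_def v_def norm_mult mult.assoc[symmetric])
    have "(ell2_norm u)\<^sup>2 = A" "(ell2_norm v)\<^sup>2 = S x"
      using infsum_shift_left[of "\<lambda>x. cmod (a x)" x]
      by (simp_all add: ell2_norm_sq u_def v_def S_def A_def power_mult_distrib norm_mult)
    moreover have "cmod (conv a f x) \<le> ell2_norm u * ell2_norm v"
    proof -
      have "(\<lambda>s. cmod (a (x - s) * f s)) summable_on UNIV"
        using prod_abs_summable[OF u v] by (simp add: uv)
      then have "cmod (conv a f x) \<le> (\<Sum>\<^sub>\<infinity>s. cmod (a (x - s) * f s))"
        unfolding conv_def by (rule norm_infsum_bound)
      also have "\<dots> \<le> ell2_norm u * ell2_norm v"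
        using Cauchy_Schwarz_abs[OF u v] by (simp add: uv)
      finally show ?thesis .
    qed
    ultimately show ?thesis
      using power_mono[of "cmod (conv a f x)" "ell2_norm u * ell2_norm v" 2] by (simp add: power_mult_distrib)
  qed
  show ?thesis
    unfolding sqsum_def
    by (rule summable_on_comparison_test[OF summable_on_cmult_right[OF S2, of A]]) (use le in auto)
qed

lemma conv_inner_eq_form:
  assumes a: "(\<lambda>x. cmod (a x)) summable_on UNIV" and "sqsum f" "sqsum g"
  shows "ell2_inner (conv a f) g = (\<Sum>\<^sub>\<infinity>(x, s). a (x - s) * f s * cnj (g x))"
proof -
  have "(\<lambda>(x, s). a (x - s) * f s * cnj (g x)) summable_on (UNIV \<times> UNIV)"
    using kernel_form_summable[OF assms] by simp
  from infsum_Sigma_banach[OF this] show ?thesis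
    by (simp add: ell2_inner_def conv_def infsum_cmult_left')
qed

lemma conv_symmetric:
  assumes a: "(\<lambda>x. cmod (a x)) summable_on UNIV" and "sqsum f" "sqsum g"
    and herm: "\<And>x. a (- x) = cnj (a x)"
  shows "ell2_inner (conv a f) g = ell2_inner f (conv a g)"
proof -
  have h: "cnj (a (x - s)) = a (s - x)" for x s using herm[of "x - s"] by simp
  have "ell2_inner f (conv a g) = cnj (\<Sum>\<^sub>\<infinity>(x, s). a (x - s) * g s * cnj (f x))"
    unfolding ell2_inner_commute[of f] conv_inner_eq_form[OF a assms(3,2)] ..
  also have "\<dots> = (\<Sum>\<^sub>\<infinity>(x, s). cnj (a (x - s) * g s * cnj (f x)))"
    unfolding infsum_cnj[symmetric] by (intro infsum_cong) auto
  also have "\<dots> = (\<Sum>\<^sub>\<infinity>(x, s). a (x - s) * f s * cnj (g x))"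
    by (rule infsum_reindex_bij_witness[of _ prod.swap prod.swap]) (auto simp: h)
  finally show ?thesis by (simp add: conv_inner_eq_form[OF assms(1-3)])
qed

lemma conv_even:
  assumes "\<And>x. a (- x) = a x" "\<And>x. f (- x) = f x"
  shows "conv a f (- x) = conv a f x"
proof -
  have "a (- x - s) = a (x - (- s))" for s using assms(1)[of "x + s"] by simp
  then show ?thesis
    unfolding conv_def
    by (intro infsum_reindex_bij_witness[of _ uminus uminus]) (use assms in auto)
qed

text \<open>An unordered double sum can be approximated along squares \<open>F \<times> F\<close>,
  because every finite set of pairs lies in one. Positivity therefore has to be checked only on
  finite sets.\<close>

lemma conv_nonneg:
  fixes a :: "int ^ 'd \<Rightarrow> complex"
  assumes a: "(\<lambda>x. cmod (a x)) summable_on UNIV" and f: "sqsum f"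
    and pos: "\<And>F. finite F \<Longrightarrow> Re (\<Sum>x\<in>F. \<Sum>s\<in>F. a (x - s) * f s * cnj (f x)) \<ge> 0"
  shows "Re (ell2_inner (conv a f) f) \<ge> 0"
proof (rule ccontr)
  define K where "K = (\<lambda>(x, s). a (x - s) * f s * cnj (f x))"
  define I where "I = ell2_inner (conv a f) f"
  assume "\<not> Re (ell2_inner (conv a f) f) \<ge> 0"
  then have neg: "Re I < 0" by (simp add: I_def)
  have Ksum: "(K has_sum I) UNIV"
    using kernel_form_summable[OF a f f] conv_inner_eq_form[OF a f f] by (simp add: K_def I_def)
  then have "\<forall>\<^sub>F S in finite_subsets_at_top UNIV. dist (sum K S) I < - Re I"
    unfolding has_sum_def using neg by (intro tendstoD) auto
  then obtain S0 where S0: "finite S0" "\<And>S. finite S \<Longrightarrow> S \<supseteq> S0 \<Longrightarrow> dist (sum K S) I < - Re I"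
    unfolding eventually_finite_subsets_at_top by auto
  define F where "F = fst ` S0 \<union> snd ` S0"
  have F: "finite F" "S0 \<subseteq> F \<times> F" using S0(1) unfolding F_def by force+
  then have d: "dist (sum K (F \<times> F)) I < - Re I" by (intro S0(2)) auto
  have "sum K (F \<times> F) = (\<Sum>x\<in>F. \<Sum>s\<in>F. a (x - s) * f s * cnj (f x))"
    by (simp add: K_def sum.cartesian_product)
  then have "Re (sum K (F \<times> F)) \<ge> 0" using pos[OF F(1)] by simp
  moreover have "\<bar>Re (sum K (F \<times> F)) - Re I\<bar> \<le> dist (sum K (F \<times> F)) I"
    using abs_Re_le_cmod[of "sum K (F \<times> F) - I"] by (simp add: dist_norm)
  ultimately show False using d by linarith
qed


section \<open>Minimization of the form\<close>

lemma infsum_dominated_convergence: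
  fixes F :: "nat \<Rightarrow> 'a \<Rightarrow> real"
  assumes h: "h summable_on UNIV" and le: "\<And>j x. \<bar>F j x\<bar> \<le> h x"
    and lim: "\<And>x. (\<lambda>j. F j x) \<longlonglongrightarrow> G x"
  shows "(\<lambda>j. \<Sum>\<^sub>\<infinity>x. F j x) \<longlonglongrightarrow> (\<Sum>\<^sub>\<infinity>x. G x)"
proof -
  have h0: "h x \<ge> 0" for x using le[of 0 x] by linarith
  have leG: "\<bar>G x\<bar> \<le> h x" for x
    by (rule LIMSEQ_le_const2[OF tendsto_rabs[OF lim]]) (use le in auto)
  \<comment> \<open>Unordered sums with a summable majorant are integrals over the counting measure,
    where the dominated convergence theorem applies.\<close>
  have s: "Infinite_Set_Sum.abs_summable_on H UNIV \<and> infsetsum H UNIV = infsum H UNIV"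
    if "\<And>x. \<bar>H x\<bar> \<le> h x" for H :: "'a \<Rightarrow> real"
  proof -
    have "(\<lambda>x. norm (H x)) summable_on UNIV"
      by (rule summable_on_comparison_test[OF h]) (use that in auto)
    then show ?thesis
      using abs_summable_equivalent infsetsum_infsum by blast
  qed
  have "integrable (count_space UNIV) h"
    using s[of h] h0 by (simp add: abs_summable_on_def)
  then have "(\<lambda>j. infsetsum (F j) UNIV) \<longlonglongrightarrow> infsetsum G UNIV"
    unfolding infsetsum_def
    by (rule integral_dominated_convergence[rotated 2]) (use lim le in auto)
  then show ?thesis using s le leG by simp
qed

lemma ell2_tail_small:
  assumes g: "sqsum g" and "\<epsilon> > 0"
  obtains F where "finite F" "ell2_norm (\<lambda>x. g x - (if x \<in> F then g x else 0)) < \<epsilon>"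
proof -
  have gs: "(\<lambda>x. (cmod (g x))\<^sup>2) summable_on UNIV" using g by (simp add: sqsum_def)
  obtain F where F: "finite F"
    "dist (\<Sum>x\<in>F. (cmod (g x))\<^sup>2) (\<Sum>\<^sub>\<infinity>x. (cmod (g x))\<^sup>2) \<le> (\<epsilon>/2)\<^sup>2"
    using infsum_finite_approximation[OF gs, of "(\<epsilon>/2)\<^sup>2"] \<open>\<epsilon> > 0\<close> by auto
  let ?r = "\<lambda>x. g x - (if x \<in> F then g x else 0)"
  have "(ell2_norm ?r)\<^sup>2 = (\<Sum>\<^sub>\<infinity>x\<in>UNIV - F. (cmod (g x))\<^sup>2)"
    unfolding ell2_norm_sq by (rule infsum_cong_neutral) auto
  also have "\<dots> = (\<Sum>\<^sub>\<infinity>x. (cmod (g x))\<^sup>2) - (\<Sum>x\<in>F. (cmod (g x))\<^sup>2)"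
    using F(1) by (subst infsum_Diff[OF gs]) auto
  also have "\<dots> \<le> (\<epsilon>/2)\<^sup>2" using F(2) by (simp add: dist_real_def)
  finally have "ell2_norm ?r \<le> \<epsilon>/2" using \<open>\<epsilon> > 0\<close> by (simp add: power2_le_iff_abs_le)
  then show ?thesis using that F(1) \<open>\<epsilon> > 0\<close> by force
qed

lemma inner_finite_support_right:
  assumes "finite F"
  shows "ell2_inner f (\<lambda>x. if x \<in> F then g x else 0) = (\<Sum>x\<in>F. f x * cnj (g x))"
proof -
  have "ell2_inner f (\<lambda>x. if x \<in> F then g x else 0) = (\<Sum>\<^sub>\<infinity>x\<in>F. f x * cnj (g x))"
    unfolding ell2_inner_def by (rule infsum_cong_neutral) auto
  then show ?thesis using assms by simp
qed

lemma pointwise_limit_in_unit_ball: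
  assumes f: "\<And>j. sqsum (f j)" "\<And>j. ell2_norm (f j) \<le> 1" and lim: "\<And>x. (\<lambda>j. f j x) \<longlonglongrightarrow> l x"
  shows "sqsum l" "ell2_norm l \<le> 1"
proof -
  have le: "(\<Sum>x\<in>F. (cmod (l x))\<^sup>2) \<le> 1" if "finite F" for F
  proof (rule LIMSEQ_le_const2)
    show "(\<lambda>j. \<Sum>x\<in>F. (cmod (f j x))\<^sup>2) \<longlonglongrightarrow> (\<Sum>x\<in>F. (cmod (l x))\<^sup>2)"
      by (intro tendsto_intros lim)
    have "(\<Sum>x\<in>F. (cmod (f j x))\<^sup>2) \<le> 1" for j
      using sum_le_norm_sq[OF f(1) that, of j] power_mono[OF f(2)[of j] ell2_norm_nonneg, of 2] by simp
    then show "\<exists>N. \<forall>n\<ge>N. (\<Sum>x\<in>F. (cmod (f n x))\<^sup>2) \<le> 1" by blast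
  qed
  show "sqsum l" by (rule bounded_sums_imp_sqsum(1)[OF le])
  show "ell2_norm l \<le> 1"
    using bounded_sums_imp_sqsum(2)[OF le] ell2_norm_nonneg[of l] by (simp add: abs_square_le_1)
qed

text \<open>Testing against a finitely supported vector involves finitely many coordinates; by
  Cauchy--Schwarz the remaining tail of \<open>g\<close> contributes little, uniformly on the unit
  ball.\<close>

lemma pointwise_limit_weak:
  assumes f: "\<And>j. sqsum (f j)" "\<And>j. ell2_norm (f j) \<le> 1" and lim: "\<And>x. (\<lambda>j. f j x) \<longlonglongrightarrow> l x"
    and g: "sqsum g"
  shows "(\<lambda>j. ell2_inner (f j) g) \<longlonglongrightarrow> ell2_inner l g"
proof (rule LIMSEQ_I)
  fix r :: real assume "r > 0"
  note l = pointwise_limit_in_unit_ball[OF f lim]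
  obtain F where F: "finite F" "ell2_norm (\<lambda>x. g x - (if x \<in> F then g x else 0)) < r / 4"
    using ell2_tail_small[OF g, of "r/4"] \<open>r > 0\<close> by auto
  define gF where "gF = (\<lambda>x. if x \<in> F then g x else 0)"
  have gF: "sqsum gF" unfolding gF_def by (rule sqsum_finite_support[OF F(1)])
  note gd = sqsum_diff[OF g gF]
  have small: "cmod (ell2_inner h g - ell2_inner h gF) \<le> r / 4" if "sqsum h" "ell2_norm h \<le> 1" for h
  proof -
    have "cmod (ell2_inner h g - ell2_inner h gF) \<le> ell2_norm h * ell2_norm (\<lambda>x. g x - gF x)"
      using Cauchy_Schwarz_inner[OF that(1) gd] inner_diff_right[OF g gF that(1)] by simp
    also have "\<dots> \<le> 1 * (r / 4)"
      using that(2) F(2) by (intro mult_mono) (auto simp: gF_def ell2_norm_nonneg)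
    finally show ?thesis by simp
  qed
  have "(\<lambda>j. ell2_inner (f j) gF) \<longlonglongrightarrow> ell2_inner l gF"
    unfolding gF_def inner_finite_support_right[OF F(1)] by (intro tendsto_intros lim)
  then obtain N where N: "\<And>j. j \<ge> N \<Longrightarrow> cmod (ell2_inner (f j) gF - ell2_inner l gF) < r / 4"
    using LIMSEQ_D[of _ _ "r/4"] \<open>r > 0\<close> by (metis divide_pos_pos zero_less_numeral)
  have "cmod (ell2_inner (f j) g - ell2_inner l g) < r" if "j \<ge> N" for j
  proof -
    have eq: "ell2_inner (f j) g - ell2_inner l g = (ell2_inner (f j) g - ell2_inner (f j) gF)
       + (ell2_inner (f j) gF - ell2_inner l gF) - (ell2_inner l g - ell2_inner l gF)" by simp
    have "cmod (ell2_inner (f j) g - ell2_inner l g) \<le> cmod (ell2_inner (f j) g - ell2_inner (f j) gF)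
       + cmod (ell2_inner (f j) gF - ell2_inner l gF) + cmod (ell2_inner l g - ell2_inner l gF)"
      unfolding eq by (meson norm_triangle_ineq norm_triangle_ineq4 add_right_mono order_trans)
    also have "\<dots> < r"
      using small[OF f(1)[of j] f(2)[of j]] small[OF l] N[OF that] \<open>r > 0\<close> by linarith
    finally show ?thesis .
  qed
  then show "\<exists>N. \<forall>n\<ge>N. cmod (ell2_inner (f n) g - ell2_inner l g) < r" by blast
qed

text \<open>The first-order condition at a minimum: \<open>b\<close> is the first variation and
  \<open>c\<close> the second.\<close>

lemma linear_coeff_zero:
  fixes b c :: real
  assumes "\<And>t. 2 * t * b + t\<^sup>2 * c \<ge> 0"
  shows "b = 0"
proof (rule ccontr)
  assume "b \<noteq> 0"
  \<comment> \<open>With |c| + 1 in the denominator, t^2 c is at most -t b, so the whole expression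
    is at most t b < 0.\<close>
  define t where "t = - b / (\<bar>c\<bar> + 1)"
  have p: "\<bar>c\<bar> + 1 > 0" by simp
  have tb: "t * (\<bar>c\<bar> + 1) = - b" using p by (simp add: t_def)
  have "t\<^sup>2 * c \<le> t\<^sup>2 * (\<bar>c\<bar> + 1)" by (intro mult_left_mono) auto
  also have "\<dots> = - t * b" using tb by (simp add: power2_eq_square mult.assoc)
  finally have "2 * t * b + t\<^sup>2 * c \<le> t * b" by (simp add: algebra_simps)
  moreover have "t * b < 0"
    using \<open>b \<noteq> 0\<close> p by (auto intro!: divide_pos_pos simp: t_def zero_less_mult_iff)
  ultimately show False using assms[of t] by linarith
qed

section \<open>The model operator: a nonnegative convolution plus a summable potential\<close>

locale lattice_operator =
  fixes a :: "int ^ 'd \<Rightarrow> complex" and u :: "int ^ 'd \<Rightarrow> real"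
  assumes a_summable: "(\<lambda>x. cmod (a x)) summable_on UNIV"
    and a_herm: "\<And>x. a (- x) = cnj (a x)" and a_even: "\<And>x. a (- x) = a x"
    and a_nonneg: "\<And>f. sqsum f \<Longrightarrow> Re (ell2_inner (conv a f) f) \<ge> 0"
    and u_summable: "(\<lambda>x. \<bar>u x\<bar>) summable_on UNIV" and u_even: "\<And>x. u (- x) = u x"
begin

definition Op :: "(int ^ 'd \<Rightarrow> complex) \<Rightarrow> int ^ 'd \<Rightarrow> complex" where
  "Op f x = conv a f x + of_real (u x) * f x"

definition form :: "(int ^ 'd \<Rightarrow> complex) \<Rightarrow> real" where
  "form f = Re (ell2_inner (Op f) f)"

definition U :: real where "U = (\<Sum>\<^sub>\<infinity>x. \<bar>u x\<bar>)"

lemma u_le_U: "\<bar>u x\<bar> \<le> U"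
  using finite_sum_le_infsum[OF u_summable, of "{x}"] by (simp add: U_def)

lemma sqsum_u: "sqsum f \<Longrightarrow> sqsum (\<lambda>x. of_real (u x) * f x)"
  by (rule sqsum_bounded_mult[where C = U]) (auto simp: u_le_U)

lemma sqsum_Op: "sqsum f \<Longrightarrow> sqsum (Op f)"
  unfolding Op_def using sqsum_add[OF sqsum_conv[OF a_summable] sqsum_u] by simp

lemma Op_ell2e: "f \<in> ell2e \<Longrightarrow> Op f \<in> ell2e"
  by (auto simp: ell2e_iff sqsum_Op) (simp add: Op_def conv_even[where a = a] a_even u_even)

lemma Op_add: "sqsum f \<Longrightarrow> sqsum g \<Longrightarrow> Op (\<lambda>x. f x + g x) x = Op f x + Op g x"
  by (simp add: Op_def conv_add[OF a_summable] algebra_simps)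

lemma Op_cmult: "Op (\<lambda>x. c * f x) = (\<lambda>x. c * Op f x)"
  by (simp add: fun_eq_iff Op_def conv_cmult algebra_simps)

lemma Op_symmetric:
  assumes "sqsum f" "sqsum g"
  shows "ell2_inner (Op f) g = ell2_inner f (Op g)"
proof -
  have "ell2_inner (\<lambda>x. of_real (u x) * f x) g = ell2_inner f (\<lambda>x. of_real (u x) * g x)"
    by (simp add: ell2_inner_def mult_ac)
  then show ?thesis
    unfolding Op_def using assms conv_symmetric[OF a_summable assms a_herm]
    by (simp add: inner_add_left inner_add_right sqsum_conv[OF a_summable] sqsum_u)
qed

lemma form_eq:
  assumes "sqsum f"
  shows "form f = Re (ell2_inner (conv a f) f) + (\<Sum>\<^sub>\<infinity>x. u x * (cmod (f x))\<^sup>2)"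
proof -
  have eq: "of_real (u x) * f x * cnj (f x) = of_real (u x * (cmod (f x))\<^sup>2)" for x
    by (simp only: mult.assoc complex_norm_square[symmetric] of_real_mult)
  have "(\<lambda>x. u x * (cmod (f x))\<^sup>2) summable_on UNIV"
  proof -
    have "(\<lambda>x. of_real (u x) * f x * cnj (f x)) summable_on UNIV"
      by (rule prod_summable[OF sqsum_u[OF assms] assms])
    from summable_on_Re[OF this] show ?thesis
      unfolding eq by (simp del: of_real_mult of_real_power)
  qed
  then have "(\<Sum>\<^sub>\<infinity>x. complex_of_real (u x * (cmod (f x))\<^sup>2)) = of_real (\<Sum>\<^sub>\<infinity>x. u x * (cmod (f x))\<^sup>2)"
    by (intro infsumI has_sum_of_real has_sum_infsum)
  then have "ell2_inner (\<lambda>x. of_real (u x) * f x) f = of_real (\<Sum>\<^sub>\<infinity>x. u x * (cmod (f x))\<^sup>2)"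
    unfolding ell2_inner_def eq .
  then show ?thesis
    unfolding form_def Op_def
    using assms by (simp add: inner_add_left sqsum_conv[OF a_summable] sqsum_u)
qed

lemma form_cmult: "form (\<lambda>x. c * f x) = (cmod c)\<^sup>2 * form f"
proof -
  have "ell2_inner (Op (\<lambda>x. c * f x)) (\<lambda>x. c * f x) = of_real ((cmod c)\<^sup>2) * ell2_inner (Op f) f"
    by (simp add: Op_cmult inner_cmult_left inner_cmult_right complex_norm_square[of c] mult_ac del: of_real_power)
  then show ?thesis by (simp add: form_def del: of_real_power)
qed

lemma form_lower_bound:
  assumes "sqsum f" "ell2_norm f \<le> 1"
  shows "form f \<ge> - U"
proof -
  have le: "\<bar>u x * (cmod (f x))\<^sup>2\<bar> \<le> \<bar>u x\<bar>" for x
  proof -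
    have "(cmod (f x))\<^sup>2 \<le> 1"
      using cmod_le_norm[OF assms(1), of x] assms(2) by (simp add: power_le_one)
    then show ?thesis by (simp add: abs_mult mult_left_le)
  qed
  have "\<bar>\<Sum>\<^sub>\<infinity>x. u x * (cmod (f x))\<^sup>2\<bar> \<le> (\<Sum>\<^sub>\<infinity>x. \<bar>u x * (cmod (f x))\<^sup>2\<bar>)"
    using norm_infsum_bound[of "\<lambda>x. u x * (cmod (f x))\<^sup>2" UNIV]
      summable_on_comparison_test[OF u_summable, of "\<lambda>x. \<bar>u x * (cmod (f x))\<^sup>2\<bar>"] le by simp
  also have "\<dots> \<le> U"
    unfolding U_def using le
    by (intro infsum_mono u_summable summable_on_comparison_test[OF u_summable]) auto
  finally show ?thesis
    using form_eq[OF assms(1)] a_nonneg[OF assms(1)] by linarith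
qed

text \<open>A nonnegative quadratic form lies above its tangent at \<open>l\<close>: expanding the
  kinetic part at \<open>f j - l\<close> bounds it below by an expression affine in
  \<open>f j\<close>, and such expressions are weakly continuous. The potential part converges by
  dominated convergence with majorant \<open>\<bar>u x\<bar>\<close>.\<close>

lemma form_lower_semicontinuous:
  assumes f: "\<And>j. sqsum (f j)" "\<And>j. ell2_norm (f j) \<le> 1" and lim: "\<And>x. (\<lambda>j. f j x) \<longlonglongrightarrow> l x"
    and L: "(\<lambda>j. form (f j)) \<longlonglongrightarrow> L"
  shows "form l \<le> L"
proof -
  note l = pointwise_limit_in_unit_ball[OF f lim]
  have Wl: "sqsum (conv a l)" by (rule sqsum_conv[OF a_summable l(1)])
  let ?V = "\<lambda>g. \<Sum>\<^sub>\<infinity>x. u x * (cmod (g x))\<^sup>2"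
  let ?W = "\<lambda>g h. Re (ell2_inner (conv a g) h)"
  let ?X = "\<lambda>j. 2 * Re (ell2_inner (f j) (conv a l)) - ?W l l + ?V (f j)"
  have ge: "?X j \<le> form (f j)" for j
  proof -
    let ?d = "\<lambda>x. f j x - l x"
    have Wf: "sqsum (conv a (f j))" by (rule sqsum_conv[OF a_summable f(1)])
    have d: "sqsum ?d" by (rule sqsum_diff[OF f(1) l(1)])
    have "conv a ?d = (\<lambda>x. conv a (f j) x - conv a l x)"
      using conv_diff[OF a_summable f(1) l(1)] by auto
    then have "ell2_inner (conv a ?d) ?d =
        ell2_inner (conv a (f j)) (f j) - ell2_inner (conv a (f j)) l
      - (ell2_inner (conv a l) (f j) - ell2_inner (conv a l) l)"
      using d f(1) l(1) Wf Wl by (simp add: inner_diff_left inner_diff_right)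
    moreover have "ell2_inner (conv a (f j)) l = ell2_inner (f j) (conv a l)"
      by (rule conv_symmetric[OF a_summable f(1) l(1) a_herm])
    moreover have "Re (ell2_inner (conv a l) (f j)) = Re (ell2_inner (f j) (conv a l))"
      unfolding ell2_inner_commute[of "conv a l"] by simp
    ultimately show ?thesis
      using a_nonneg[OF d] form_eq[OF f(1), of j] by simp
  qed
  have "(\<lambda>j. ?V (f j)) \<longlonglongrightarrow> ?V l"
  proof (rule infsum_dominated_convergence[OF u_summable])
    fix j x
    have "(cmod (f j x))\<^sup>2 \<le> 1"
      using cmod_le_norm[OF f(1), of j x] f(2)[of j] by (simp add: power_le_one)
    then show "\<bar>u x * (cmod (f j x))\<^sup>2\<bar> \<le> \<bar>u x\<bar>" by (simp add: abs_mult mult_left_le)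
  qed (intro tendsto_intros lim)
  then have "?X \<longlonglongrightarrow> 2 * Re (ell2_inner l (conv a l)) - ?W l l + ?V l"
    by (intro tendsto_intros pointwise_limit_weak[OF f lim Wl])
  then have "2 * Re (ell2_inner l (conv a l)) - ?W l l + ?V l \<le> L"
    by (rule LIMSEQ_le[OF _ L]) (use ge in blast)
  moreover have "Re (ell2_inner l (conv a l)) = ?W l l"
    using conv_symmetric[OF a_summable l(1) l(1) a_herm] by simp
  ultimately show ?thesis by (simp add: form_eq[OF l(1)])
qed

text \<open>The form is minimized over the part of the unit ball orthogonal to the given eigenvectors.  A
  minimizing sequence has a pointwise convergent subsequence; the summable potential is continuous
  and the nonnegative kinetic part lower semicontinuous along it.\<close>

lemma exists_orthogonal_eigenvector:
  assumes e: "\<And>i. i < m \<Longrightarrow> e i \<in> ell2e" "\<And>i x. i < m \<Longrightarrow> Op (e i) x = of_real (z i) * e i x"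
    and f0: "f0 \<in> ell2e" "\<And>i. i < m \<Longrightarrow> ell2_inner f0 (e i) = 0" "form f0 < 0"
  obtains f \<nu> where "f \<in> ell2e" "ell2_norm f = 1" "\<nu> < 0"
    "\<And>i. i < m \<Longrightarrow> ell2_inner f (e i) = 0" "\<And>x. Op f x = of_real \<nu> * f x"
proof -
  define P where "P = {f \<in> ell2e. \<forall>i<m. ell2_inner f (e i) = 0}"
  define K where "K = {f \<in> P. ell2_norm f \<le> 1}"
  define \<nu> where "\<nu> = Inf (form ` K)"
  have P_sq: "sqsum f" if "f \<in> P" for f using that by (simp add: P_def ell2e_iff)
  have P_cmult: "(\<lambda>x. c * f x) \<in> P" if "f \<in> P" for c f
    using that by (auto simp: P_def ell2e_iff sqsum_cmult inner_cmult_left)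
  have e_sq: "sqsum (e i)" if "i < m" for i using e(1)[OF that] by (simp add: ell2e_iff)
  have P_add: "(\<lambda>x. f x + g x) \<in> P" if "f \<in> P" "g \<in> P" for f g
    using that e_sq by (auto simp: P_def ell2e_iff sqsum_add inner_add_left)
  have bdd: "bdd_below (form ` K)"
    using form_lower_bound P_sq by (intro bdd_belowI2[where m = "- U"]) (auto simp: K_def)
  have \<nu>_le: "\<nu> \<le> form f" if "f \<in> K" for f
    unfolding \<nu>_def using that bdd by (intro cInf_lower) auto
  have norm_pos: "ell2_norm f > 0" if "sqsum f" "form f < 0" for f
  proof (rule ccontr)
    assume "\<not> ell2_norm f > 0"
    then have "ell2_norm f = 0" using ell2_norm_nonneg[of f] by linarith
    then have "f = (\<lambda>x. 0)" using ell2_norm_eq_0D that by blast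
    then show False using that by (simp add: form_def ell2_inner_def)
  qed
  \<comment> \<open>Scaling to the unit sphere turns the infimum over the ball into a homogeneous
    inequality on \<open>P\<close>.\<close>
  have normalize: "form f \<ge> \<nu> * (ell2_norm f)\<^sup>2" if "f \<in> P" "ell2_norm f > 0" for f
  proof -
    let ?c = "complex_of_real (1 / ell2_norm f)"
    have "(\<lambda>x. ?c * f x) \<in> K"
      using P_cmult[OF that(1), of ?c] that(2) ell2_norm_cmult[of ?c f] by (simp add: K_def norm_divide)
    from \<nu>_le[OF this] have "\<nu> \<le> (1 / ell2_norm f)\<^sup>2 * form f"
      unfolding form_cmult using that(2) by (simp add: norm_divide)
    then show ?thesis using that(2) by (simp add: field_simps)
  qed
  have f0P: "f0 \<in> P" using f0 by (simp add: P_def)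
  have \<nu>_neg: "\<nu> < 0"
  proof (rule ccontr)
    assume "\<not> \<nu> < 0"
    then have "\<nu> * (ell2_norm f0)\<^sup>2 \<ge> 0" by simp
    then show False using normalize[OF f0P norm_pos[OF P_sq[OF f0P] f0(3)]] f0(3) by linarith
  qed
  have "\<exists>f\<in>K. form f < \<nu> + 1 / Suc j" for j
  proof -
    have "(\<lambda>x. 0) \<in> K"
      by (auto simp: K_def P_def ell2e_iff sqsum_zero ell2_inner_def ell2_norm_def)
    then have "\<exists>y\<in>form ` K. y < \<nu> + 1 / Suc j"
      unfolding \<nu>_def by (intro cInf_lessD) auto
    then show ?thesis by blast
  qed
  then obtain g where g: "\<And>j. g j \<in> K" "\<And>j. form (g j) < \<nu> + 1 / Suc j" by metis
  have g_sq: "sqsum (g j)" "ell2_norm (g j) \<le> 1" "g j \<in> P" for j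
    using g(1)[of j] P_sq by (auto simp: K_def)
  have "cmod (g j x) \<le> 1" for j x using cmod_le_norm[OF g_sq(1), of j x] g_sq(2)[of j] by linarith
  then obtain k :: "nat \<Rightarrow> nat" where k: "strict_mono k" "\<And>x. \<exists>l. (\<lambda>n. g (k n) x) \<longlonglongrightarrow> l"
    using function_convergent_subsequence[of "UNIV :: (int ^ 'd) set" g 1] by (metis UNIV_I countableI_type)
  then obtain f where lim: "\<And>x. (\<lambda>n. g (k n) x) \<longlonglongrightarrow> f x" by metis
  note f = pointwise_limit_in_unit_ball[OF g_sq(1,2) lim]
  have "(\<lambda>j. form (g j)) \<longlonglongrightarrow> \<nu>"
  proof (rule tendsto_sandwich[where f = "\<lambda>j. \<nu>" and h = "\<lambda>j. \<nu> + 1 / Suc j"])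
    show "(\<lambda>j. \<nu> + 1 / Suc j) \<longlonglongrightarrow> \<nu>"
      using tendsto_add[OF tendsto_const[of \<nu>] LIMSEQ_inverse_real_of_nat] by (simp add: inverse_eq_divide)
    show "\<forall>\<^sub>F j in sequentially. \<nu> \<le> form (g j)" using \<nu>_le[OF g(1)] by simp
    show "\<forall>\<^sub>F j in sequentially. form (g j) \<le> \<nu> + 1 / Suc j"
      using g(2) by (intro always_eventually) (simp add: less_imp_le)
  qed auto
  then have "(\<lambda>j. form (g (k j))) \<longlonglongrightarrow> \<nu>"
    using LIMSEQ_subseq_LIMSEQ[OF _ k(1)] by (auto simp: o_def)
  then have f_le: "form f \<le> \<nu>"
    by (rule form_lower_semicontinuous[OF g_sq(1,2) lim])
  have fP: "f \<in> P"
  proof -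
    have "f (- x) = f x" for x
    proof (rule LIMSEQ_unique[OF lim])
      have "g (k j) (- x) = g (k j) x" for j using g_sq(3) by (simp add: P_def ell2e_iff)
      then show "(\<lambda>n. g (k n) (- x)) \<longlonglongrightarrow> f x" using lim by simp
    qed
    moreover have "ell2_inner f (e i) = 0" if "i < m" for i
    proof (rule LIMSEQ_unique[OF pointwise_limit_weak[OF g_sq(1,2) lim e_sq[OF that]]])
      have "ell2_inner (g (k j)) (e i) = 0" for j using g_sq(3) that by (simp add: P_def)
      then show "(\<lambda>j. ell2_inner (g (k j)) (e i)) \<longlonglongrightarrow> 0" by simp
    qed
    ultimately show ?thesis using f by (simp add: P_def ell2e_iff)
  qed
  have f_eq: "form f = \<nu>" using f_le \<nu>_le[of f] fP f by (simp add: K_def)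
  have f_pos: "ell2_norm f > 0" using norm_pos[OF f(1)] f_eq \<nu>_neg by simp
  \<comment> \<open>Strictly inside the ball, scaling up to norm 1 would push the negative value
    \<nu> still lower. So no mass is lost in the weak limit.\<close>
  have norm1: "ell2_norm f = 1"
  proof (rule ccontr)
    assume "ell2_norm f \<noteq> 1"
    then have "(ell2_norm f)\<^sup>2 < 1" using f(2) f_pos by (simp add: power_less_one_iff)
    then have "\<nu> * (ell2_norm f)\<^sup>2 > \<nu>" using \<nu>_neg mult_strict_left_mono_neg[of "(ell2_norm f)\<^sup>2" 1 \<nu>] by simp
    then show False using normalize[OF fP f_pos] f_eq by linarith
  qed
  \<comment> \<open>\<open>R\<close> is \<open>Op\<close> shifted by \<nu>. Its form is nonnegative
    on \<open>P\<close> and vanishes at \<open>f\<close>, so varying \<open>f\<close> in the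
    direction \<open>R f\<close> itself will force \<open>R f = 0\<close>.\<close>
  define R where "R h x = Op h x - of_real \<nu> * h x" for h x
  have R_sq: "sqsum (R h)" if "sqsum h" for h
    unfolding R_def by (intro sqsum_diff sqsum_Op sqsum_cmult that)
  have R_sym: "ell2_inner (R g) h = ell2_inner g (R h)" if "sqsum g" "sqsum h" for g h
    unfolding R_def using that
    by (simp add: inner_diff_left inner_diff_right sqsum_Op sqsum_cmult Op_symmetric
        inner_cmult_left inner_cmult_right)
  have R_form: "Re (ell2_inner (R h) h) = form h - \<nu> * (ell2_norm h)\<^sup>2" if "sqsum h" for h
    unfolding R_def form_def using that
    by (simp add: inner_diff_left sqsum_Op sqsum_cmult inner_cmult_left inner_self)
  have R_nonneg: "Re (ell2_inner (R h) h) \<ge> 0" if "h \<in> P" for h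
  proof (cases "ell2_norm h = 0")
    case True
    then have "h = (\<lambda>x. 0)" using ell2_norm_eq_0D P_sq[OF that] by blast
    then show ?thesis by (simp add: ell2_inner_def)
  next
    case False
    then have "ell2_norm h > 0" using ell2_norm_nonneg[of h] by linarith
    then show ?thesis using normalize[OF that] R_form[OF P_sq[OF that]] by simp
  qed
  \<comment> \<open>The direction is admissible: \<open>R\<close> is symmetric and maps each
    \<open>e i\<close> to a multiple of itself, so \<open>R f\<close> inherits orthogonality to
    \<open>e i\<close> from \<open>f\<close>.\<close>
  have hP: "R f \<in> P"
  proof -
    have "Op f \<in> ell2e" using fP Op_ell2e by (simp add: P_def)
    then have "R f \<in> ell2e"
      using fP R_sq[OF f(1)] by (auto simp: ell2e_iff R_def P_def)
    moreover have "ell2_inner (R f) (e i) = 0" if "i < m" for i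
    proof -
      have "R (e i) = (\<lambda>x. of_real (z i - \<nu>) * e i x)"
        using e(2)[OF that] by (auto simp: R_def algebra_simps)
      then show ?thesis
        using R_sym[OF f(1) e_sq[OF that]] fP that by (simp add: inner_cmult_right P_def)
    qed
    ultimately show ?thesis by (simp add: P_def)
  qed
  define h where "h = R f"
  have h_sq: "sqsum h" unfolding h_def by (rule R_sq[OF f(1)])
  have "2 * t * (ell2_norm h)\<^sup>2 + t\<^sup>2 * Re (ell2_inner (R h) h) \<ge> 0" for t :: real
  proof -
    let ?th = "\<lambda>x. of_real t * h x"
    have th: "?th \<in> P" "sqsum ?th" using P_cmult[OF hP] P_sq unfolding h_def by blast+
    have "R (\<lambda>x. f x + ?th x) = (\<lambda>x. R f x + of_real t * R h x)"
      using Op_add[OF f(1) th(2)] by (auto simp: R_def Op_cmult algebra_simps)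
    then have "ell2_inner (R (\<lambda>x. f x + ?th x)) (\<lambda>x. f x + ?th x) =
       ell2_inner (R f) f + of_real t * ell2_inner (R f) h
       + of_real t * (ell2_inner (R h) f + of_real t * ell2_inner (R h) h)"
      using R_sq[OF f(1)] R_sq[OF h_sq] f(1) h_sq th(2)
      by (simp add: inner_add_left inner_add_right sqsum_add sqsum_cmult inner_cmult_left
          inner_cmult_right distrib_left)
    moreover have "ell2_inner (R f) h = of_real ((ell2_norm h)\<^sup>2)"
      using inner_self[OF h_sq] by (simp add: h_def)
    moreover have "ell2_inner (R h) f = of_real ((ell2_norm h)\<^sup>2)"
      using R_sym[OF h_sq f(1)] inner_self[OF h_sq] by (simp add: h_def)
    ultimately have "Re (ell2_inner (R (\<lambda>x. f x + ?th x)) (\<lambda>x. f x + ?th x)) =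
       Re (ell2_inner (R f) f) + 2 * t * (ell2_norm h)\<^sup>2 + t\<^sup>2 * Re (ell2_inner (R h) h)"
      by (simp add: power2_eq_square algebra_simps)
    moreover have "Re (ell2_inner (R f) f) = 0"
      using R_form[OF f(1)] f_eq norm1 by simp
    ultimately show ?thesis using R_nonneg[OF P_add[OF fP th(1)]] by simp
  qed
  then have "(ell2_norm h)\<^sup>2 = 0" by (rule linear_coeff_zero)
  then have "h = (\<lambda>x. 0)" using ell2_norm_eq_0D[OF h_sq] by simp
  then have "Op f x = of_real \<nu> * f x" for x
    unfolding h_def R_def by (metis eq_iff_diff_eq_0)
  then show ?thesis
    using that[of f \<nu>] fP norm1 \<nu>_neg by (simp add: P_def)
qed

end


section \<open>Orthonormal systems and the eigenvalue count\<close>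

text \<open>Gaussian elimination: an unknown with nonzero coefficient in the last equation is solved
  for, leaving one equation and one unknown fewer. The equations will be orthogonality
  conditions.\<close>

lemma exists_nontrivial_solution:
  fixes M :: "nat \<Rightarrow> 'i \<Rightarrow> complex"
  assumes "finite I" "m < card I"
  shows "\<exists>c. (\<exists>i\<in>I. c i \<noteq> 0) \<and> (\<forall>j<m. (\<Sum>i\<in>I. c i * M j i) = 0)"
  using assms
proof (induction m arbitrary: I M)
  case 0
  then have "I \<noteq> {}" by auto
  then show ?case by (intro exI[of _ "\<lambda>i. 1"]) auto
next
  case (Suc m)
  show ?case
  proof (cases "\<forall>i\<in>I. M m i = 0")
    case True
    obtain c where "\<exists>i\<in>I. c i \<noteq> 0" "\<forall>j<m. (\<Sum>i\<in>I. c i * M j i) = 0"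
      using Suc.IH[of I M] Suc.prems by auto
    moreover have "(\<Sum>i\<in>I. c i * M m i) = 0" using True by simp
    ultimately show ?thesis by (intro exI[of _ c]) (auto simp: less_Suc_eq)
  next
    case False
    then obtain p where p: "p \<in> I" "M m p \<noteq> 0" by auto
    define J where "J = I - {p}"
    have J: "finite J" "m < card J" "p \<notin> J" "I = insert p J" using Suc.prems p(1) by (auto simp: J_def)
    obtain c where c: "\<exists>i\<in>J. c i \<noteq> 0"
      "\<forall>j<m. (\<Sum>i\<in>J. c i * (M j i - M j p * M m i / M m p)) = 0"
      using Suc.IH[of J "\<lambda>j i. M j i - M j p * M m i / M m p"] J by auto
    define s where "s = (\<Sum>i\<in>J. c i * M m i)"
    \<comment> \<open>The value at the pivot solves equation \<open>m\<close>; the modified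
      coefficients of the smaller system are those that remain after substituting it.\<close>
    define c' where "c' = c(p := - s / M m p)"
    have sum: "(\<Sum>i\<in>I. c' i * M j i) = (\<Sum>i\<in>J. c i * M j i) - s / M m p * M j p" for j
    proof -
      have "(\<Sum>i\<in>J. c' i * M j i) = (\<Sum>i\<in>J. c i * M j i)"
        using J(3) by (intro sum.cong) (auto simp: c'_def)
      then show ?thesis using J by (simp add: c'_def)
    qed
    have "(\<Sum>i\<in>I. c' i * M j i) = 0" if "j < m" for j
    proof -
      have "(\<Sum>i\<in>J. c i * (M j i - M j p * M m i / M m p)) =
          (\<Sum>i\<in>J. c i * M j i) - s / M m p * M j p"
        by (simp add: s_def right_diff_distrib sum_subtractf sum_divide_distrib sum_distrib_left sum_distrib_right mult_ac)
      then show ?thesis using c(2) that sum by simp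
    qed
    moreover have "(\<Sum>i\<in>I. c' i * M m i) = 0" using p(2) by (simp add: sum s_def)
    moreover have "\<exists>i\<in>I. c' i \<noteq> 0" using c(1) J by (auto simp: c'_def)
    ultimately show ?thesis by (intro exI[of _ c']) (auto simp: less_Suc_eq)
  qed
qed

definition orthonormal :: "nat \<Rightarrow> (nat \<Rightarrow> int ^ 'd \<Rightarrow> complex) \<Rightarrow> bool" where
  "orthonormal n e \<longleftrightarrow> (\<forall>i<n. \<forall>j<n. ell2_inner (e i) (e j) = (if i = j then 1 else 0))"

text \<open>Greedy construction, abstract in \<open>R\<close> because it serves twice: for a basis
  of the eigenspace of \<open>B1\<close> and for the eigenvectors below the threshold.\<close>

lemma orthonormal_extend:
  assumes sq: "\<And>f. R f \<Longrightarrow> sqsum f"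
    and step: "\<And>m e. m < n \<Longrightarrow> (\<And>i. i < m \<Longrightarrow> R (e i)) \<Longrightarrow>
      \<exists>f. R f \<and> ell2_norm f = 1 \<and> (\<forall>i<m. ell2_inner f (e i) = 0)"
  obtains e where "orthonormal n e" "\<And>i. i < n \<Longrightarrow> R (e i)"
proof -
  have "m \<le> n \<Longrightarrow> \<exists>e. orthonormal m e \<and> (\<forall>i<m. R (e i))" for m
  proof (induction m)
    case (Suc m)
    then obtain e where e: "orthonormal m e" "\<And>i. i < m \<Longrightarrow> R (e i)" by auto
    obtain f where f: "R f" "ell2_norm f = 1" "\<And>i. i < m \<Longrightarrow> ell2_inner f (e i) = 0"
      using step[of m e] e Suc.prems by auto
    have "ell2_inner (e i) f = 0" if "i < m" for i
      unfolding ell2_inner_commute[of "e i"] using f(3)[OF that] by simp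
    moreover have "ell2_inner f f = 1" using inner_self[OF sq[OF f(1)]] f(2) by simp
    ultimately have "orthonormal (Suc m) (e(m := f))"
      using e(1) f(3) by (auto simp: orthonormal_def less_Suc_eq)
    moreover have "\<forall>i<Suc m. R ((e(m := f)) i)" using e(2) f(1) by (auto simp: less_Suc_eq)
    ultimately show ?case by blast
  qed (simp add: orthonormal_def)
  then show ?thesis using that by blast
qed

lemma inner_orthonormal_sum:
  assumes "orthonormal n e" "\<And>i. i < n \<Longrightarrow> sqsum (e i)" "j < n"
  shows "ell2_inner (\<lambda>x. \<Sum>i<n. c i * e i x) (e j) = c j"
proof -
  have "ell2_inner (\<lambda>x. \<Sum>i<n. c i * e i x) (e j) = (\<Sum>i<n. c i * ell2_inner (e i) (e j))"
    using assms by (intro inner_sum_left) auto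
  also have "\<dots> = (\<Sum>i<n. if i = j then c i else 0)"
    using assms by (intro sum.cong) (auto simp: orthonormal_def)
  finally show ?thesis using assms(3) by simp
qed

lemma ell2_norm_orthonormal_sum:
  assumes "orthonormal n e" "\<And>i. i < n \<Longrightarrow> sqsum (e i)"
  shows "(ell2_norm (\<lambda>x. \<Sum>i<n. c i * e i x))\<^sup>2 = (\<Sum>i<n. (cmod (c i))\<^sup>2)"
proof -
  let ?f = "\<lambda>x. \<Sum>i<n. c i * e i x"
  have f: "sqsum ?f" using assms(2) by (intro sqsum_sum sqsum_cmult) auto
  have "ell2_inner ?f ?f = (\<Sum>i<n. cnj (c i) * ell2_inner ?f (e i))"
    using assms(2) f by (intro inner_sum_right) auto
  also have "\<dots> = (\<Sum>i<n. of_real ((cmod (c i))\<^sup>2))"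
    using inner_orthonormal_sum[OF assms] by (intro sum.cong) (auto simp: complex_norm_square mult.commute simp del: of_real_power)
  finally have "complex_of_real ((ell2_norm ?f)\<^sup>2) = of_real (\<Sum>i<n. (cmod (c i))\<^sup>2)"
    using inner_self[OF f] by simp
  then show ?thesis unfolding of_real_eq_iff .
qed

lemma sum_cscale_apply: "(\<Sum>v\<in>S. cscale (c v) (g v)) x = (\<Sum>v\<in>S. c v * g v x)"
  by (induction S rule: infinite_finite_induct) (auto simp: cscale_def)

lemma orthonormal_independent:
  assumes "orthonormal n e" "\<And>i. i < n \<Longrightarrow> sqsum (e i)" "J \<subseteq> {..<n}"
  shows "inj_on e J" "cfun.independent (e ` J)"
proof -
  show inj: "inj_on e J"
  proof (rule inj_onI)
    fix i j assume ij: "i \<in> J" "j \<in> J" "e i = e j"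
    then have "ell2_inner (e i) (e j) = 1" "i < n" "j < n"
      using assms(1,3) by (auto simp: orthonormal_def subset_iff)
    then show "i = j" using assms(1) by (auto simp: orthonormal_def split: if_splits)
  qed
  have fin: "finite J" using assms(3) finite_subset by blast
  show "cfun.independent (e ` J)"
  proof
    assume "cfun.dependent (e ` J)"
    then obtain u v where u: "v \<in> e ` J" "u v \<noteq> 0" "(\<Sum>v\<in>e ` J. cscale (u v) v) = 0"
      using cfun.dependent_finite[of "e ` J"] fin by auto
    then obtain j where j: "j \<in> J" "v = e j" by auto
    have "(\<Sum>i\<in>J. u (e i) * e i x) = 0" for x
      using fun_cong[OF u(3), of x] sum.reindex[OF inj, of "\<lambda>v. u v * v x"]
      by (simp add: sum_cscale_apply[where g = "\<lambda>v. v"])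
    then have "ell2_inner (\<lambda>x. \<Sum>i\<in>J. u (e i) * e i x) (e j) = 0"
      by (simp add: ell2_inner_def)
    also have "ell2_inner (\<lambda>x. \<Sum>i\<in>J. u (e i) * e i x) (e j) = (\<Sum>i\<in>J. u (e i) * ell2_inner (e i) (e j))"
      using assms j by (intro inner_sum_left) auto
    also have "\<dots> = (\<Sum>i\<in>J. if i = j then u (e i) else 0)"
      using assms(1,3) j by (intro sum.cong) (auto simp: orthonormal_def subset_iff)
    also have "\<dots> = u v" using j fin by simp
    finally show False using u(2) by simp
  qed
qed

lemma card_le_multiplicity_of:
  assumes "finite E" "cfun.independent E" "E \<subseteq> eigenspace A z"
  shows "enat (card E) \<le> multiplicity_of A z"
proof (cases "\<exists>B. finite B \<and> eigenspace A z \<subseteq> cfun.span B")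
  case True
  then obtain B0 where B0: "finite B0" "eigenspace A z \<subseteq> cfun.span B0" by blast
  obtain B where B: "B \<subseteq> eigenspace A z" "cfun.independent B" "eigenspace A z \<subseteq> cfun.span B"
    "card B = cfun.dim (eigenspace A z)" using cfun.basis_exists by blast
  have "finite B" using cfun.independent_span_bound[OF B0(1) B(2)] B(1) B0(2) by auto
  then have "card E \<le> card B"
    using cfun.independent_span_bound[OF _ assms(2), of B] assms(3) B(3) by auto
  then show ?thesis using True B(4) by (simp add: multiplicity_of_def)
next
  case False
  then show ?thesis unfolding multiplicity_of_def by (simp only: if_False enat_ord_simps)
qed

text \<open>Group the vectors by eigenvalue. Each group is independent inside one eigenspace, so its
  size is at most the multiplicity, and the group sizes add up to \<open>n\<close>. The values
  \<open>z i\<close> may repeat.\<close>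

lemma eigenvalue_count_below_ge:
  assumes e: "orthonormal n e" "\<And>i. i < n \<Longrightarrow> e i \<in> eigenspace A (z i)" "\<And>i. i < n \<Longrightarrow> z i < t"
  shows "enat n \<le> eigenvalue_count_below A t"
proof -
  define S where "S = z ` {..<n}"
  have sq: "sqsum (e i)" if "i < n" for i
    using e(2)[OF that] by (simp add: eigenspace_def ell2e_iff)
  have "e i \<noteq> 0" if "i < n" for i
  proof
    assume "e i = 0"
    then have "ell2_inner (e i) (e i) = 0" by (simp add: ell2_inner_def)
    then show False using e(1) that by (auto simp: orthonormal_def)
  qed
  then have S: "finite S" "S \<subseteq> {z'. eigenvalue A z' \<and> z' < t}"
    using e by (auto simp: S_def eigenvalue_def)
  have "enat (card {i \<in> {..<n}. z i = z'}) \<le> multiplicity_of A z'" for z'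
  proof -
    let ?J = "{i \<in> {..<n}. z i = z'}"
    have "card (e ` ?J) = card ?J" by (rule card_image, rule orthonormal_independent[OF e(1) sq]) auto
    moreover have "enat (card (e ` ?J)) \<le> multiplicity_of A z'"
      by (rule card_le_multiplicity_of[OF _ orthonormal_independent(2)[OF e(1) sq]]) (use e(2) in auto)
    ultimately show ?thesis by simp
  qed
  then have "(\<Sum>z'\<in>S. enat (card {i \<in> {..<n}. z i = z'})) \<le> (\<Sum>z'\<in>S. multiplicity_of A z')"
    by (intro sum_mono)
  moreover have "(\<Sum>z'\<in>S. enat (card {i \<in> {..<n}. z i = z'})) = enat (\<Sum>z'\<in>S. card {i \<in> {..<n}. z i = z'})"
    by (induction rule: finite_induct[OF S(1)]) (auto simp: zero_enat_def)
  moreover have "(\<Sum>z'\<in>S. card {i \<in> {..<n}. z i = z'}) = n"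
  proof -
    have "(\<Sum>z'\<in>S. \<Sum>i\<in>{i \<in> {..<n}. z i = z'}. 1 :: nat) = (\<Sum>i\<in>{..<n}. 1)"
      by (rule sum.group) (auto simp: S_def)
    then show ?thesis by simp
  qed
  ultimately have "enat n \<le> (\<Sum>z'\<in>S. multiplicity_of A z')" by simp
  also have "\<dots> \<le> eigenvalue_count_below A t"
    unfolding eigenvalue_count_below_def by (rule SUP_upper) (use S in auto)
  finally show ?thesis .
qed

text \<open>Linearity is assumed only for the combinations at hand: \<open>B1\<close> is built from
  unordered sums and integrals, which are additive only where they converge.\<close>

lemma eigenspace_sum:
  assumes lin: "\<And>c x. A (\<lambda>x. \<Sum>i\<in>I. c i * e i x) x = (\<Sum>i\<in>I. c i * A (e i) x)"
    and e: "\<And>i. i \<in> I \<Longrightarrow> e i \<in> eigenspace A z"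
  shows "(\<lambda>x. \<Sum>i\<in>I. c i * e i x) \<in> eigenspace A z"
proof -
  have "sqsum (\<lambda>x. \<Sum>i\<in>I. c i * e i x)"
    using e by (intro sqsum_sum sqsum_cmult) (auto simp: eigenspace_def ell2e_iff)
  then show ?thesis
    using e by (auto simp: eigenspace_def ell2e_iff lin sum_distrib_left mult.left_commute
        intro!: sum.cong)
qed

text \<open>The vectors are found one at a time: with m < n of them chosen, some nonzero combination
  of n independent eigenvectors meets the m orthogonality conditions.\<close>

lemma orthonormal_basis_eigenspace:
  assumes lin: "\<And>(n :: nat) e c x. (\<And>i. i < n \<Longrightarrow> e i \<in> eigenspace A z) \<Longrightarrow>
      A (\<lambda>x. \<Sum>i<n. c i * e i x) x = (\<Sum>i<n. c i * A (e i) x)"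
    and mult: "multiplicity_of A z = enat n"
  obtains e where "orthonormal n e" "\<And>i. i < n \<Longrightarrow> e i \<in> eigenspace A z"
proof (rule orthonormal_extend[where n = n and R = "\<lambda>f. f \<in> eigenspace A z"])
  have fd: "\<exists>B. finite B \<and> eigenspace A z \<subseteq> cfun.span B" and n: "cfun.dim (eigenspace A z) = n"
    using mult by (auto simp: multiplicity_of_def split: if_splits)
  obtain B where B: "B \<subseteq> eigenspace A z" "cfun.independent B" "eigenspace A z \<subseteq> cfun.span B"
    "card B = cfun.dim (eigenspace A z)" using cfun.basis_exists by blast
  have finB: "finite B" using cfun.independent_span_bound[OF _ B(2)] fd B(1) by blast
  then obtain b where b: "bij_betw b {..<n} B"
    using ex_bij_betw_nat_finite B(4) n by (metis atLeast0LessThan)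
  have bH: "b i \<in> eigenspace A z" if "i < n" for i using b that B(1) by (auto simp: bij_betw_def)
  fix m :: nat and e assume m: "m < n" and e: "\<And>i. i < m \<Longrightarrow> e i \<in> eigenspace A z"
  obtain c where c: "\<exists>i<n. c i \<noteq> 0" "\<And>j. j < m \<Longrightarrow> (\<Sum>i<n. c i * ell2_inner (b i) (e j)) = 0"
    using exists_nontrivial_solution[of "{..<n}" m "\<lambda>j i. ell2_inner (b i) (e j)"] m by auto
  define f where "f = (\<lambda>x. \<Sum>i<n. c i * b i x)"
  have "A (\<lambda>x. \<Sum>i<n. c i * b i x) x = (\<Sum>i<n. c i * A (b i) x)" for c x
    by (rule lin) (rule bH)
  then have fH: "f \<in> eigenspace A z"
    unfolding f_def by (rule eigenspace_sum) (use bH in auto)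
  have f_sq: "sqsum f" using fH by (simp add: eigenspace_def ell2e_iff)
  have f_orth: "ell2_inner f (e j) = 0" if "j < m" for j
    unfolding f_def using c(2)[OF that] bH e[OF that]
    by (subst inner_sum_left) (auto simp: eigenspace_def ell2e_iff)
  have "f \<noteq> (\<lambda>x. 0)"
  proof
    assume f0: "f = (\<lambda>x. 0)"
    define w where "w v = c (inv_into {..<n} b v)" for v
    have inj: "inj_on b {..<n}" and im: "b ` {..<n} = B" using b by (auto simp: bij_betw_def)
    have "(\<Sum>v\<in>B. cscale (w v) v) x = f x" for x
    proof -
      have "(\<Sum>v\<in>B. cscale (w v) v) x = (\<Sum>v\<in>b ` {..<n}. w v * v x)"
        by (simp add: sum_cscale_apply[where g = "\<lambda>v. v"] im)
      also have "\<dots> = (\<Sum>i<n. w (b i) * b i x)" by (simp add: sum.reindex[OF inj])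
      also have "\<dots> = f x"
        unfolding f_def by (intro sum.cong) (auto simp: w_def inv_into_f_f[OF inj])
      finally show ?thesis .
    qed
    then have "(\<Sum>v\<in>B. cscale (w v) v) = 0" using f0 by (auto simp: fun_eq_iff)
    moreover obtain i where "i < n" "c i \<noteq> 0" using c(1) by blast
    then have "b i \<in> B" "w (b i) \<noteq> 0" using im by (auto simp: w_def inv_into_f_f[OF inj])
    ultimately show False using B(2) cfun.dependent_finite[OF finB] by blast
  qed
  then have "ell2_norm f \<noteq> 0" using ell2_norm_eq_0D[OF f_sq] by blast
  then have pos: "ell2_norm f > 0" using ell2_norm_nonneg[of f] by linarith
  let ?k = "complex_of_real (1 / ell2_norm f)"
  have "(\<lambda>x. ?k * f x) \<in> eigenspace A z"
    using eigenspace_sum[where A = A and z = z and I = "{..<Suc 0}" and e = "\<lambda>_. f" and c = "\<lambda>_. ?k"]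
      lin[of "Suc 0" "\<lambda>_. f"] fH by simp
  moreover have "ell2_norm (\<lambda>x. ?k * f x) = 1"
    unfolding ell2_norm_cmult using pos by (simp add: norm_divide)
  moreover have "ell2_inner (\<lambda>x. ?k * f x) (e i) = 0" if "i < m" for i
    unfolding inner_cmult_left using f_orth[OF that] by simp
  ultimately show "\<exists>f. f \<in> eigenspace A z \<and> ell2_norm f = 1 \<and> (\<forall>i<m. ell2_inner f (e i) = 0)"
    by blast
qed (auto simp: eigenspace_def ell2e_iff)


section \<open>Fourier series on the torus\<close>

lemma sets_haar [measurable_cong]: "sets (haar :: (real ^ 'd) measure) = sets borel"
  and space_haar [simp]: "space (haar :: (real ^ 'd) measure) = UNIV"
  by (simp_all add: haar_def)

lemma finite_measure_haar: "finite_measure (haar :: (real ^ 'd) measure)"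
  by (rule finite_measureI) (simp add: emeasure_haar_UNIV)

lemma integrable_haar_bounded:
  fixes f :: "real ^ 'd \<Rightarrow> 'b::{banach,second_countable_topology}"
  assumes "f \<in> borel_measurable borel" "\<And>p. norm (f p) \<le> C"
  shows "integrable haar f"
proof -
  interpret finite_measure "haar :: (real ^ 'd) measure" by (rule finite_measure_haar)
  show ?thesis
    by (rule integrable_const_bound[where B = C]) (use assms in auto)
qed

lemma integrable_haar_mult_bounded:
  fixes f g :: "real ^ 'd \<Rightarrow> complex"
  assumes "integrable haar f" "g \<in> borel_measurable borel" "\<And>p. norm (g p) \<le> C"
  shows "integrable haar (\<lambda>p. g p * f p)"
proof (rule Bochner_Integration.integrable_bound)
  show "integrable haar (\<lambda>p. C * norm (f p))" using assms(1) by simp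
  show "(\<lambda>p. g p * f p) \<in> borel_measurable haar"
    using assms(1,2) by measurable
  show "AE p in haar. norm (g p * f p) \<le> norm (C * norm (f p))"
  proof (rule AE_I2)
    fix p
    have "norm (g p) * norm (f p) \<le> C * norm (f p)" using assms(3) by (intro mult_right_mono) auto
    then show "norm (g p * f p) \<le> norm (C * norm (f p))" by (simp add: norm_mult)
  qed
qed

lemma AE_haar:
  assumes "AE p in lborel. P p"
  shows "AE p in (haar :: (real ^ 'd) measure). P p"
proof -
  have [measurable]: "cell \<in> sets (borel :: (real ^ 'd) measure)" by (rule cell_in_borel)
  have "(\<lambda>p :: real ^ 'd. ennreal (indicator cell p / (2 * pi) ^ CARD('d))) \<in> borel_measurable lborel"
    by measurable
  then show ?thesis
    unfolding haar_def using assms by (auto simp: AE_density)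
qed

lemma integral_haar:
  fixes f :: "real ^ 'd \<Rightarrow> 'b::{banach,second_countable_topology}"
  assumes "f \<in> borel_measurable borel"
  shows "integral\<^sup>L haar f = (LINT p|lborel. (indicator cell p / (2 * pi) ^ CARD('d)) *\<^sub>R f p)"
proof -
  have [measurable]: "cell \<in> sets (borel :: (real ^ 'd) measure)" by (rule cell_in_borel)
  show ?thesis
    unfolding haar_def using assms by (subst integral_density) (auto simp: zero_le_divide_iff)
qed

lemma pair_zero_left [simp]: "pair 0 x = 0" and pair_zero_right [simp]: "pair p 0 = 0"
  and pair_add_left: "pair (p + q) x = pair p x + pair q x"
  and pair_add_right: "pair p (x + y) = pair p x + pair p y"
  by (simp_all add: pair_def sum.distrib algebra_simps)

lemma pair_diff_left: "pair (p - q) x = pair p x - pair q x"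
  and pair_diff_right: "pair p (x - y) = pair p x - pair p y"
  by (simp_all add: pair_def sum_subtractf algebra_simps)

lemma continuous_on_pair [continuous_intros]: "continuous_on S (\<lambda>p. pair p x)"
  unfolding pair_def by (intro continuous_intros)

lemma measurable_pair [measurable]: "(\<lambda>p. pair p x) \<in> borel_measurable borel"
  by (intro borel_measurable_continuous_onI continuous_intros)

lemma measurable_cis_pair [measurable]: "(\<lambda>p. cis (pair p x)) \<in> borel_measurable borel"
  and measurable_cis_pair_minus [measurable]: "(\<lambda>p. cis (- pair p x)) \<in> borel_measurable borel"
  by (intro borel_measurable_continuous_onI continuous_intros)+

text \<open>For m \<noteq> 0 the antiderivative takes equal values at -pi and pi. The fundamental
  theorem of calculus lives on the closed interval; the half-open one that makes up
  \<open>cell\<close> differs from it by a null set.\<close>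

lemma integral_cis_period:
  "(LINT t|lborel. (indicator {-pi..<pi} t / (2 * pi)) *\<^sub>R cis (t * of_int m)) = (if m = 0 then 1 else 0)"
  "integrable lborel (\<lambda>t. (indicator {-pi..<pi} t / (2 * pi)) *\<^sub>R cis (t * of_int m))"
proof -
  let ?F = "\<lambda>t. if m = 0 then complex_of_real t else cis (t * of_int m) / (\<i> * of_int m)"
  have deriv: "(?F has_vector_derivative cis (t * of_int m)) (at t within S)" for t S
  proof (cases "m = 0")
    case True
    then show ?thesis by (auto intro!: derivative_eq_intros)
  next
    case False
    have "((\<lambda>z. exp (\<i> * of_int m * z) / (\<i> * of_int m)) has_field_derivative
        exp (\<i> * of_int m * of_real t)) (at (of_real t))"
      using False by (auto intro!: derivative_eq_intros)
    from has_vector_derivative_real_field[OF this, of S] show ?thesis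
      using False by (simp add: cis_conv_exp mult_ac)
  qed
  have "has_bochner_integral lborel (\<lambda>t. indicator {-pi..pi} t *\<^sub>R cis (t * of_int m)) (?F pi - ?F (- pi))"
    by (rule has_bochner_integral_FTC_Icc) (auto intro!: deriv continuous_intros)
  moreover have "?F pi - ?F (- pi) = (if m = 0 then of_real (2 * pi) else 0)"
  proof -
    have "cis (pi * of_int m) = cis (- (pi * of_int m) + 2 * pi * of_int m)" by simp
    also have "\<dots> = cis (- (pi * of_int m))"
      unfolding cis_mult[symmetric] by (simp add: cis_multiple_2pi)
    finally show ?thesis by simp
  qed
  ultimately have "has_bochner_integral lborel (\<lambda>t. (1 / (2 * pi)) *\<^sub>R (indicator {-pi..pi} t *\<^sub>R cis (t * of_int m)))
      ((1 / (2 * pi)) *\<^sub>R (if m = 0 then of_real (2 * pi) else 0))"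
    by (intro has_bochner_integral_scaleR_right) auto
  moreover have "has_bochner_integral lborel
        (\<lambda>t. (1 / (2 * pi)) *\<^sub>R (indicator {-pi..pi} t *\<^sub>R cis (t * of_int m))) c \<longleftrightarrow>
      has_bochner_integral lborel (\<lambda>t. (indicator {-pi..<pi} t / (2 * pi)) *\<^sub>R cis (t * of_int m)) c" for c
  proof (rule has_bochner_integral_cong_AE)
    have [measurable]: "(\<lambda>t. cis (t * of_int m)) \<in> borel_measurable borel"
      by (intro borel_measurable_continuous_onI continuous_intros)
    show "(\<lambda>t. (1 / (2 * pi)) *\<^sub>R (indicator {-pi..pi} t *\<^sub>R cis (t * of_int m))) \<in> borel_measurable lborel"
      "(\<lambda>t. (indicator {-pi..<pi} t / (2 * pi)) *\<^sub>R cis (t * of_int m)) \<in> borel_measurable lborel"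
      by measurable
    show "AE t in lborel. (1 / (2 * pi)) *\<^sub>R (indicator {-pi..pi} t *\<^sub>R cis (t * of_int m)) =
        (indicator {-pi..<pi} t / (2 * pi)) *\<^sub>R cis (t * of_int m)"
      using AE_lborel_singleton[of pi] by eventually_elim (auto simp: indicator_def)
  qed
  ultimately have "has_bochner_integral lborel (\<lambda>t. (indicator {-pi..<pi} t / (2 * pi)) *\<^sub>R cis (t * of_int m))
      (if m = 0 then 1 else 0)"
    by (auto split: if_splits simp: scaleR_conv_of_real)
  then show "(LINT t|lborel. (indicator {-pi..<pi} t / (2 * pi)) *\<^sub>R cis (t * of_int m)) = (if m = 0 then 1 else 0)"
    "integrable lborel (\<lambda>t. (indicator {-pi..<pi} t / (2 * pi)) *\<^sub>R cis (t * of_int m))"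
    unfolding has_bochner_integral_iff by auto
qed

text \<open>Fubini for product functions: \<open>lborel\<close> on vectors is the image of a product
  measure over \<open>Basis\<close>, whose elements correspond to the coordinates.\<close>

lemma integral_lborel_prod_vec:
  fixes g :: "'d::finite \<Rightarrow> real \<Rightarrow> complex"
  assumes int: "\<And>j. integrable lborel (g j)"
  shows "(LINT p|lborel. (\<Prod>j\<in>UNIV. g j (p $ j))) = (\<Prod>j\<in>UNIV. integral\<^sup>L lborel (g j))"
proof -
  interpret product_sigma_finite "\<lambda>_ :: real ^ 'd. lborel :: real measure" ..
  let ?B = "Basis :: (real ^ 'd) set"
  define G where "G b = g (axis_index b)" for b :: "real ^ 'd"
  have ax: "axis_index (axis j 1 :: real ^ 'd) = j" for j
    by (simp add: axis_index_def axis_eq_axis)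
  have B: "?B = range (\<lambda>j. axis j 1)" by (auto simp: Basis_vec_def)
  have inj: "inj (\<lambda>j. axis j 1 :: real ^ 'd)" by (auto simp: inj_def axis_eq_axis)
  have prodB: "(\<Prod>b\<in>?B. G b (h b)) = (\<Prod>j\<in>UNIV. g j (h (axis j 1)))" for h
    unfolding B prod.reindex[OF inj] by (simp add: G_def ax)
  have [measurable]: "g j \<in> borel_measurable borel" for j using int[of j] by auto
  have "(LINT p|lborel. (\<Prod>j\<in>UNIV. g j (p $ j))) =
      (LINT f|(\<Pi>\<^sub>M b\<in>?B. lborel). (\<Prod>j\<in>UNIV. g j ((\<Sum>b\<in>?B. f b *\<^sub>R b) $ j)))"
    by (subst lborel_eq, subst integral_distr) measurable
  also have "\<dots> = (LINT f|(\<Pi>\<^sub>M b\<in>?B. lborel). (\<Prod>b\<in>?B. G b (f b)))"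
  proof (rule Bochner_Integration.integral_cong)
    fix f :: "real ^ 'd \<Rightarrow> real"
    have "(\<Sum>b\<in>?B. f b *\<^sub>R b) $ j = f (axis j 1)" for j
    proof -
      have "(\<Sum>b\<in>?B. f b *\<^sub>R b) \<bullet> axis j 1 = f (axis j 1)"
        by (rule inner_sum_left_Basis) (auto simp: B)
      then show ?thesis by (simp add: inner_axis)
    qed
    then show "(\<Prod>j\<in>UNIV. g j ((\<Sum>b\<in>?B. f b *\<^sub>R b) $ j)) = (\<Prod>b\<in>?B. G b (f b))"
      by (simp add: prodB)
  qed simp
  also have "\<dots> = (\<Prod>b\<in>?B. integral\<^sup>L lborel (G b))"
    by (rule product_integral_prod) (auto simp: G_def int)
  also have "\<dots> = (\<Prod>j\<in>UNIV. integral\<^sup>L lborel (g j))"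
    unfolding B prod.reindex[OF inj] by (simp add: G_def ax)
  finally show ?thesis .
qed

lemma integral_haar_cis_pair:
  "(LINT p|haar. cis (pair p x)) = (if x = (0 :: int ^ 'd) then 1 else 0)"
proof -
  have cis_sum: "cis (sum f S) = (\<Prod>j\<in>S. cis (f j))" for f :: "'d \<Rightarrow> real" and S
    by (induction S rule: infinite_finite_induct) (auto simp: cis_mult[symmetric])
  let ?g = "\<lambda>j t. (indicator {-pi..<pi} t / (2 * pi)) *\<^sub>R cis (t * of_int (x $ j))"
  have "(LINT p|haar. cis (pair p x)) =
      (LINT p|lborel. (indicator cell p / (2 * pi) ^ CARD('d)) *\<^sub>R cis (pair p x))"
    by (rule integral_haar) measurable
  also have "\<dots> = (LINT p|lborel. (\<Prod>j\<in>UNIV. ?g j (p $ j)))"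
  proof (rule Bochner_Integration.integral_cong)
    fix p :: "real ^ 'd"
    have "(\<Prod>j\<in>UNIV. ?g j (p $ j)) =
        of_real (\<Prod>j\<in>UNIV. indicator {-pi..<pi} (p $ j) / (2 * pi)) * (\<Prod>j\<in>UNIV. cis (p $ j * of_int (x $ j)))"
      by (simp add: scaleR_conv_of_real flip: prod.distrib)
    also have "(\<Prod>j\<in>UNIV. indicator {-pi..<pi} (p $ j) / (2 * pi)) = indicator cell p / (2 * pi) ^ CARD('d)"
      by (auto simp: prod_dividef indicator_def cell_def intro: prod.neutral) 
    finally show "(indicator cell p / (2 * pi) ^ CARD('d)) *\<^sub>R cis (pair p x) = (\<Prod>j\<in>UNIV. ?g j (p $ j))"
      by (simp add: pair_def cis_sum scaleR_conv_of_real)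
  qed simp
  also have "\<dots> = (\<Prod>j\<in>UNIV. integral\<^sup>L lborel (?g j))"
    by (rule integral_lborel_prod_vec) (rule integral_cis_period)
  also have "\<dots> = (\<Prod>j\<in>UNIV. if x $ j = 0 then 1 else 0)"
    unfolding integral_cis_period ..
  also have "\<dots> = (if x = 0 then 1 else 0)"
    by (auto simp: vec_eq_iff intro: prod.neutral)
  finally show ?thesis .
qed

section \<open>Interchanging unordered sums and integrals\<close>

lemma abs_summable_suminf:
  fixes f :: "nat \<Rightarrow> 'b::banach"
  assumes "(\<lambda>n. norm (f n)) summable_on UNIV"
  shows "summable (\<lambda>n. norm (f n))" "suminf f = infsum f UNIV"
proof -
  show s: "summable (\<lambda>n. norm (f n))" by (rule summable_on_imp_summable[OF assms])
  have "f sums suminf f" by (rule summable_sums[OF summable_norm_cancel[OF s]])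
  from infsumI[OF norm_summable_imp_has_sum[OF s this]] show "suminf f = infsum f UNIV" ..
qed

lemma nat_extension:
  fixes g :: "'i::countable \<Rightarrow> 'c::{comm_monoid_add,t2_space}"
  defines "E \<equiv> \<lambda>n. if n \<in> range (to_nat :: 'i \<Rightarrow> nat) then g (from_nat n) else 0"
  shows "E summable_on UNIV \<longleftrightarrow> g summable_on UNIV" "infsum E UNIV = infsum g UNIV"
proof -
  let ?R = "range (to_nat :: 'i \<Rightarrow> nat)"
  have inj: "inj (to_nat :: 'i \<Rightarrow> nat)" by simp
  have E: "E \<circ> to_nat = g" by (auto simp: E_def)
  have "E summable_on UNIV \<longleftrightarrow> E summable_on ?R"
    by (rule summable_on_cong_neutral) (auto simp: E_def)
  then show "E summable_on UNIV \<longleftrightarrow> g summable_on UNIV" by (simp add: summable_on_reindex[OF inj] E)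
  have "infsum E UNIV = infsum E ?R"
    by (rule infsum_cong_neutral) (auto simp: E_def)
  then show "infsum E UNIV = infsum g UNIV" by (simp add: infsum_reindex[OF inj] E)
qed

text \<open>Extending the family by zero along \<open>to_nat\<close> reduces this to the theorem on
  series over the natural numbers.\<close>

lemma integral_infsum:
  fixes f :: "'i::countable \<Rightarrow> 'a \<Rightarrow> 'b::{banach,second_countable_topology}"
  assumes int: "\<And>i. integrable M (f i)"
    and pw: "\<And>p. (\<lambda>i. norm (f i p)) summable_on UNIV"
    and sum: "(\<lambda>i. LINT p|M. norm (f i p)) summable_on UNIV"
  shows "integrable M (\<lambda>p. \<Sum>\<^sub>\<infinity>i. f i p)"
    and "(LINT p|M. (\<Sum>\<^sub>\<infinity>i. f i p)) = (\<Sum>\<^sub>\<infinity>i. integral\<^sup>L M (f i))"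
proof -
  let ?R = "range (to_nat :: 'i \<Rightarrow> nat)"
  define F where "F n p = (if n \<in> ?R then f (from_nat n) p else 0)" for n p
  have F_int: "integrable M (F n)" for n
    unfolding F_def using int by (cases "n \<in> ?R") auto
  have F_norm: "norm (F n p) = (if n \<in> ?R then norm (f (from_nat n) p) else 0)" for n p by (simp add: F_def)
  have pwF: "(\<lambda>n. norm (F n p)) summable_on UNIV" for p
    unfolding F_norm nat_extension(1)[where g = "\<lambda>i. norm (f i p)"] by (rule pw)
  have Fn: "F n = (if n \<in> ?R then f (from_nat n) else (\<lambda>p. 0))" for n by (auto simp: F_def)
  have intF: "integral\<^sup>L M (F n) = (if n \<in> ?R then integral\<^sup>L M (f (from_nat n)) else 0)" for n
    by (simp add: Fn)
  have intnF: "(LINT p|M. norm (F n p)) = (if n \<in> ?R then LINT p|M. norm (f (from_nat n) p) else 0)" for n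
    by (simp add: F_norm)
  have pt: "(\<Sum>n. F n p) = (\<Sum>\<^sub>\<infinity>i. f i p)" for p
    using abs_summable_suminf(2)[OF pwF[of p]] nat_extension(2)[where g = "\<lambda>i. f i p"] by (simp add: F_def)
  have s: "summable (\<lambda>n. LINT p|M. norm (F n p))"
  proof -
    have "(\<lambda>n. LINT p|M. norm (F n p)) summable_on UNIV"
      unfolding intnF nat_extension(1)[where g = "\<lambda>i. LINT p|M. norm (f i p)"] by (rule sum)
    then show ?thesis by (rule summable_on_imp_summable)
  qed
  have ae: "AE p in M. summable (\<lambda>n. norm (F n p))"
    using abs_summable_suminf(1)[OF pwF] by simp
  show "integrable M (\<lambda>p. \<Sum>\<^sub>\<infinity>i. f i p)"
    using integrable_suminf[OF F_int ae s] by (simp add: pt)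
  have abs: "(\<lambda>n. norm (integral\<^sup>L M (F n))) summable_on UNIV"
  proof (rule summable_on_comparison_test)
    show "(\<lambda>n. LINT p|M. norm (F n p)) summable_on UNIV" unfolding intnF nat_extension(1)[where g = "\<lambda>i. LINT p|M. norm (f i p)"] by (rule sum)
  qed (auto intro: integral_norm_bound)
  have "(LINT p|M. (\<Sum>\<^sub>\<infinity>i. f i p)) = (\<Sum>n. integral\<^sup>L M (F n))"
    using integral_suminf[OF F_int ae s] by (simp add: pt)
  also have "\<dots> = (\<Sum>\<^sub>\<infinity>n. integral\<^sup>L M (F n))" by (rule abs_summable_suminf(2)[OF abs])
  also have "\<dots> = (\<Sum>\<^sub>\<infinity>i. integral\<^sup>L M (f i))" unfolding intF nat_extension(2)[where g = "\<lambda>i. integral\<^sup>L M (f i)"] ..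
  finally show "(LINT p|M. (\<Sum>\<^sub>\<infinity>i. f i p)) = (\<Sum>\<^sub>\<infinity>i. integral\<^sup>L M (f i))" .
qed

section \<open>Absolutely convergent Fourier series\<close>

lemma continuous_on_fourier:
  fixes h :: "int ^ 'd \<Rightarrow> complex"
  assumes "(\<lambda>x. cmod (h x)) summable_on UNIV"
  shows "continuous_on UNIV (fourier h)"
proof -
  have "uniform_limit UNIV (\<lambda>X p. \<Sum>x\<in>X. cis (pair p x) * h x) (\<lambda>p. \<Sum>\<^sub>\<infinity>x. cis (pair p x) * h x)
      (finite_subsets_at_top UNIV)"
    by (rule Weierstrass_m_test_general[OF _ assms]) (simp add: norm_mult)
  then have "continuous_on UNIV (\<lambda>p. \<Sum>\<^sub>\<infinity>x. cis (pair p x) * h x)"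
    by (rule uniform_limit_theorem[rotated])
       (auto intro!: always_eventually continuous_intros)
  then show ?thesis by (simp add: fourier_def[abs_def])
qed

lemma measurable_fourier:
  "(\<lambda>x. cmod (h x)) summable_on UNIV \<Longrightarrow> fourier h \<in> borel_measurable borel"
  by (intro borel_measurable_continuous_onI continuous_on_fourier)

lemma fourier_summable:
  assumes "(\<lambda>x. cmod (h x)) summable_on UNIV"
  shows "(\<lambda>x. cis (pair p x) * h x) summable_on UNIV"
  by (rule abs_summable_summable) (use assms in \<open>simp add: norm_mult\<close>)

lemma cmod_fourier_le:
  assumes "(\<lambda>x. cmod (h x)) summable_on UNIV"
  shows "cmod (fourier h p) \<le> (\<Sum>\<^sub>\<infinity>x. cmod (h x))"
  using norm_infsum_bound[of "\<lambda>x. cis (pair p x) * h x" UNIV] assms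
  by (simp add: fourier_def norm_mult)

text \<open>The substitute for Parseval's identity: one factor has an absolutely convergent Fourier
  series, so the other may be merely integrable, as quotients by the gap are.\<close>

lemma integral_fourier_mult:
  fixes h :: "int ^ 'd \<Rightarrow> complex" and r :: "real ^ 'd \<Rightarrow> complex"
  assumes h: "(\<lambda>x. cmod (h x)) summable_on UNIV" and r: "integrable haar r"
  shows "integrable haar (\<lambda>p. fourier h p * r p)"
    and "(LINT p|haar. fourier h p * r p) = (\<Sum>\<^sub>\<infinity>x. h x * (LINT p|haar. cis (pair p x) * r p))"
    and "(\<lambda>x. h x * (LINT p|haar. cis (pair p x) * r p)) summable_on UNIV"
proof -
  let ?f = "\<lambda>x p. h x * (cis (pair p x) * r p)"
  have int: "integrable haar (?f x)" for x
    by (intro integrable_mult_right integrable_haar_mult_bounded[OF r, where C = 1]) auto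
  have pw: "(\<lambda>x. norm (?f x p)) summable_on UNIV" for p
    using h by (simp add: norm_mult summable_on_cmult_left)
  have sum: "(\<lambda>x. LINT p|haar. norm (?f x p)) summable_on UNIV"
    using h by (simp add: norm_mult summable_on_cmult_left)
  have eq: "(\<Sum>\<^sub>\<infinity>x. ?f x p) = fourier h p * r p" for p
    unfolding fourier_def infsum_cmult_left'[symmetric] by (simp add: mult_ac)
  show "integrable haar (\<lambda>p. fourier h p * r p)"
    using integral_infsum(1)[of haar ?f, OF int pw sum] by (simp only: eq)
  show "(LINT p|haar. fourier h p * r p) = (\<Sum>\<^sub>\<infinity>x. h x * (LINT p|haar. cis (pair p x) * r p))"
    using integral_infsum(2)[of haar ?f, OF int pw sum] by (simp add: eq)
  show "(\<lambda>x. h x * (LINT p|haar. cis (pair p x) * r p)) summable_on UNIV"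
  proof (rule abs_summable_summable, rule summable_on_comparison_test[OF sum])
    show "norm (h x * (LINT p|haar. cis (pair p x) * r p)) \<le> (LINT p|haar. norm (?f x p))" for x
      using integral_norm_bound[of haar "?f x"] by simp
  qed auto
qed

lemma integral_cis_fourier:
  fixes h :: "int ^ 'd \<Rightarrow> complex"
  assumes "(\<lambda>x. cmod (h x)) summable_on UNIV"
  shows "(LINT p|haar. cis (- pair p x) * fourier h p) = h x"
proof -
  have int: "integrable haar (\<lambda>p :: real ^ 'd. cis (- pair p x))"
    by (rule integrable_haar_bounded[where C = 1]) auto
  have "(LINT p|haar. cis (- pair p x) * fourier h p) = (\<Sum>\<^sub>\<infinity>y. h y * (LINT p|haar. cis (pair p y) * cis (- pair p x)))"
    using integral_fourier_mult(2)[OF assms int] by (simp add: mult.commute)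
  also have "\<dots> = (\<Sum>\<^sub>\<infinity>y. if y = x then h y else 0)"
    by (intro infsum_cong) (simp add: cis_mult integral_haar_cis_pair flip: pair_diff_right)
  also have "\<dots> = (\<Sum>\<^sub>\<infinity>y\<in>{x}. h y)"
    by (rule infsum_cong_neutral) auto
  finally show ?thesis by simp
qed


section \<open>The dispersion relation\<close>

lemma has_derivative_injective_isolated:
  fixes G :: "'a::euclidean_space \<Rightarrow> 'b::euclidean_space"
  assumes G: "(G has_derivative D) (at y)" and inj: "inj D"
  shows "\<forall>\<^sub>F z in at y. G z \<noteq> G y"
proof -
  have lin: "linear D" using G by (rule has_derivative_linear)
  obtain B where B: "B > 0" "\<And>x. B * norm x \<le> norm (D x)"
    using linear_inj_bounded_below_pos[OF lin inj] by auto
  obtain d where d: "d > 0"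
    "\<And>z. norm (z - y) < d \<Longrightarrow> norm (G z - G y - D (z - y)) \<le> B / 2 * norm (z - y)"
    using G B(1) unfolding has_derivative_at_alt by (meson half_gt_zero)
  \<comment> \<open>\<open>D\<close> stretches every vector by a factor of at least
    \<open>B\<close>; a remainder of at most B/2 times the distance cannot cancel that.\<close>
  have "G z \<noteq> G y" if "z \<noteq> y" "dist z y < d" for z
  proof
    assume "G z = G y"
    then have "norm (D (z - y)) \<le> B / 2 * norm (z - y)" using d(2)[of z] that(2) by (simp add: dist_norm)
    then have "B * norm (z - y) \<le> B / 2 * norm (z - y)" using B(2)[of "z - y"] by linarith
    then show False using B(1) that(1) by simp
  qed
  then show ?thesis using d(1) unfolding eventually_at by blast
qed

lemma morse_critical_isolated:
  fixes F :: "real ^ 'd \<Rightarrow> real"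
  assumes F: "morse F" and crit: "\<And>j. partial j F y = 0"
  shows "\<forall>\<^sub>F z in at y. \<exists>j. partial j F z \<noteq> 0"
proof -
  let ?H = "hessian F y"
  define G where "G z = (\<chi> j. partial j F z)" for z
  \<comment> \<open>The rows of \<open>hessian\<close> belong to the outer derivative, so the
    derivative of the gradient is the transposed Hessian.\<close>
  define D where "D h = transpose ?H *v h" for h :: "real ^ 'd"
  have "C_class (Suc (Suc 0)) F" using F by (simp add: morse_def numeral_2_eq_2)
  then have diff: "partial j F differentiable (at y)" for j
    by (auto simp: differentiable_on_eq_differentiable_at)
  have D: "frechet_derivative (partial j F) (at y) h = D h $ j" for j h
  proof -
    have lin: "linear (frechet_derivative (partial j F) (at y))"
      by (rule linear_frechet_derivative[OF diff])
    have "frechet_derivative (partial j F) (at y) h =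
        frechet_derivative (partial j F) (at y) (\<Sum>i\<in>UNIV. h $ i *\<^sub>R axis i 1)"
      using basis_expansion[of h] by (simp add: scalar_mult_eq_scaleR)
    also have "\<dots> = (\<Sum>i\<in>UNIV. h $ i * ?H $ i $ j)"
      by (simp add: linear_sum[OF lin] linear_scale[OF lin] hessian_def partial_def[of _ "partial j F"])
    finally show ?thesis by (simp add: D_def matrix_vector_mult_def transpose_def mult.commute)
  qed
  have "((\<lambda>z. G z $ j) has_derivative (\<lambda>h. D h $ j)) (at y)" for j
    using frechet_derivative_works[THEN iffD1, OF diff[of j]] unfolding D by (simp add: G_def)
  then have deriv: "(G has_derivative D) (at y)"
    by (simp add: has_derivative_componentwise_within[of G] Basis_vec_def inner_axis)
  have "invertible (transpose ?H)"
    using F crit by (simp add: morse_def invertible_det_nz)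
  moreover have "D = (*v) (transpose ?H)" by (rule ext) (simp only: D_def)
  ultimately have "inj D"
    by (simp only: invertible_left_inverse matrix_left_invertible_injective)
  from has_derivative_injective_isolated[OF deriv this] show ?thesis
    by eventually_elim (auto simp: G_def crit vec_eq_iff)
qed

text \<open>Minimum points are critical and hence isolated. As they form a closed set, there are no
  limit points at all, and such a set is countable.\<close>

lemma morse_minimum_set_countable:
  fixes F :: "real ^ 'd \<Rightarrow> real"
  assumes F: "morse F" and min: "\<And>p. c \<le> F p"
  shows "countable {p. F p = c}"
proof -
  let ?Z = "{p. F p = c}"
  have "C_class (Suc (Suc 0)) F" using F by (simp add: morse_def numeral_2_eq_2)
  then have diff: "F differentiable (at p)" for p
    by (auto simp: differentiable_on_eq_differentiable_at)
  then have cont: "continuous_on UNIV F"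
    by (intro differentiable_imp_continuous_on) (auto simp: differentiable_on_eq_differentiable_at)
  have crit: "partial j F z = 0" if "z \<in> ?Z" for j z
  proof -
    have "frechet_derivative F (at z) = (\<lambda>v. 0)"
      using diff[of z] min that
      by (intro differential_zero_maxmin[of z UNIV F]) (auto simp: frechet_derivative_works)
    then show ?thesis by (simp add: partial_def)
  qed
  have "\<not> y islimpt ?Z" for y
  proof
    assume lim: "y islimpt ?Z"
    have "closed ?Z" using continuous_closed_vimage[of "{c}" F] cont
      by (auto simp: continuous_on_eq_continuous_at vimage_def)
    then have y: "y \<in> ?Z" using lim closed_limpt by blast
    have "\<forall>\<^sub>F z in at y. z \<notin> ?Z"
      using morse_critical_isolated[OF F crit[OF y]] by (rule eventually_mono) (use crit in blast)
    then show False using lim by (simp add: islimpt_iff_eventually)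
  qed
  then have "?Z sparse_in UNIV" unfolding sparse_in_def by blast
  from sparse_imp_countable[OF _ this] show ?thesis by simp
qed

section \<open>Fourier coefficients of the two-particle dispersion and of its gap\<close>

definition Ek_coeff :: "(int ^ 'd \<Rightarrow> real) \<Rightarrow> real ^ 'd \<Rightarrow> int ^ 'd \<Rightarrow> real" where
  "Ek_coeff eh k s = 2 * eh s * cos (pair ((1/2) *\<^sub>R k) s)"

definition gap :: "(int ^ 'd \<Rightarrow> real) \<Rightarrow> real ^ 'd \<Rightarrow> real ^ 'd \<Rightarrow> real" where
  "gap eh k p = Ek eh k p - Emin eh k"

text \<open>Subtracting \<open>Emin\<close> at the origin shifts the symbol by a constant, so
  convolution with this kernel is \<open>H0\<close> measured from the threshold.\<close>

definition gap_hat :: "(int ^ 'd \<Rightarrow> real) \<Rightarrow> real ^ 'd \<Rightarrow> int ^ 'd \<Rightarrow> complex" where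
  "gap_hat eh k x = of_real (Ek_coeff eh k x) - (if x = 0 then of_real (Emin eh k) else 0)"

text \<open>\<open>Emin\<close> is an infimum over \<open>cell\<close> only; translation by periods
  makes it a lower bound everywhere.\<close>

lemma cell_shift: "\<exists>m :: int ^ 'd. p + (\<chi> j. 2 * pi * of_int (m $ j)) \<in> cell"
proof
  let ?m = "\<chi> j. - \<lfloor>(p $ j + pi) / (2 * pi)\<rfloor> :: int ^ 'd"
  show "p + (\<chi> j. 2 * pi * of_int (?m $ j)) \<in> cell"
    unfolding cell_def
  proof (intro CollectI allI)
    fix j
    define t where "t = (p $ j + pi) / (2 * pi)"
    have t: "p $ j = 2 * pi * t - pi" by (simp add: t_def)
    have "2 * pi * of_int \<lfloor>t\<rfloor> \<le> 2 * pi * t" "2 * pi * t < 2 * pi * (of_int \<lfloor>t\<rfloor> + 1)"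
      by (intro mult_left_mono mult_strict_left_mono; linarith | simp)+
    then show "- pi \<le> (p + (\<chi> j. 2 * pi * of_int (?m $ j))) $ j \<and>
        (p + (\<chi> j. 2 * pi * of_int (?m $ j))) $ j < pi"
      unfolding t_def[symmetric] by (simp add: t algebra_simps flip: t_def)
  qed
qed

lemma fourier_periodic:
  fixes m x :: "int ^ 'd"
  shows "fourier h (p + (\<chi> j. 2 * pi * of_int (m $ j))) = fourier h p"
proof -
  have "cis (pair (\<chi> j. 2 * pi * of_int (m $ j)) x) = 1" for x :: "int ^ 'd"
  proof -
    have "pair (\<chi> j. 2 * pi * of_int (m $ j)) x = 2 * pi * of_int (\<Sum>j\<in>UNIV. m $ j * x $ j)"
      by (simp add: pair_def sum_distrib_left mult.assoc)
    also have "cis \<dots> = 1" by (rule cis_multiple_2pi) (rule Ints_of_int)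
    finally show ?thesis .
  qed
  then show ?thesis by (simp add: fourier_def pair_add_left cis_mult[symmetric])
qed

locale lattice_dispersion =
  fixes eh :: "int ^ 'd \<Rightarrow> real"
  assumes eh_summable: "(\<lambda>x. \<bar>eh x\<bar>) summable_on UNIV" and eh_even: "\<And>x. eh (- x) = eh x"
begin

lemma Ek_coeff_summable: "(\<lambda>s. \<bar>Ek_coeff eh k s\<bar>) summable_on UNIV"
proof (rule summable_on_comparison_test)
  show "(\<lambda>s. 2 * \<bar>eh s\<bar>) summable_on UNIV" using eh_summable by (rule summable_on_cmult_right)
  show "\<bar>Ek_coeff eh k s\<bar> \<le> 2 * \<bar>eh s\<bar>" for s
    using mult_left_mono[OF abs_cos_le_one, of "2 * \<bar>eh s\<bar>"] by (simp add: Ek_coeff_def abs_mult)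
qed auto

text \<open>Evenness turns the dispersion at k/2 - p into that at p - k/2. Both terms are then
  series in the same characters of p, and the factors from k/2 and -k/2 add up to twice a
  cosine.\<close>

lemma of_real_Ek: "complex_of_real (Ek eh k p) = fourier (\<lambda>s. of_real (Ek_coeff eh k s)) p"
proof -
  let ?c = "(1/2) *\<^sub>R k"
  have s: "(\<lambda>x. cis (pair q x) * complex_of_real (eh x)) summable_on UNIV" for q
    using fourier_summable[of "\<lambda>x. complex_of_real (eh x)"] eh_summable by simp
  have "fourier (\<lambda>x. complex_of_real (eh x)) (?c - p) = fourier (\<lambda>x. complex_of_real (eh x)) (p - ?c)"
    using fourier_even[of eh "p - ?c"] eh_even by simp
  then have "complex_of_real (Ek eh k p) =
      (\<Sum>\<^sub>\<infinity>x. cis (pair (?c + p) x) * of_real (eh x)) + (\<Sum>\<^sub>\<infinity>x. cis (pair (p - ?c) x) * of_real (eh x))"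
    by (simp add: Ek_def of_real_disp[of eh, OF eh_even] fourier_def)
  also have "\<dots> = (\<Sum>\<^sub>\<infinity>x. cis (pair (?c + p) x) * of_real (eh x) + cis (pair (p - ?c) x) * of_real (eh x))"
    by (rule infsum_add[symmetric]) (rule s)+
  also have "\<dots> = (\<Sum>\<^sub>\<infinity>x. cis (pair p x) * of_real (Ek_coeff eh k x))"
  proof (rule infsum_cong)
    fix x
    have "cis (a + b) + cis (b - a) = cis b * of_real (2 * cos a)" for a b
      by (rule complex_eqI) (auto simp: cos_add cos_diff sin_add sin_diff algebra_simps)
    from this[of "pair ?c x" "pair p x"]
    show "cis (pair (?c + p) x) * of_real (eh x) + cis (pair (p - ?c) x) * of_real (eh x) =
        cis (pair p x) * of_real (Ek_coeff eh k x)"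
      unfolding pair_add_left pair_diff_left distrib_right[symmetric] by (simp add: Ek_coeff_def)
  qed
  finally show ?thesis by (simp add: fourier_def)
qed

lemma Ek_hat_eq: "Ek_hat eh k x = of_real (Ek_coeff eh k x)"
  unfolding Ek_hat_def of_real_Ek
  by (rule integral_cis_fourier) (simp add: Ek_coeff_summable)

lemma Ek_eq_cos_series:
  "Ek eh k p = (\<Sum>\<^sub>\<infinity>s. Ek_coeff eh k s * cos (pair p s))"
  "(\<lambda>s. Ek_coeff eh k s * cos (pair p s)) summable_on UNIV"
proof -
  have s: "(\<lambda>s. cis (pair p s) * complex_of_real (Ek_coeff eh k s)) summable_on UNIV"
    by (rule fourier_summable) (simp add: Ek_coeff_summable)
  have "Ek eh k p = Re (fourier (\<lambda>s. of_real (Ek_coeff eh k s)) p)"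
    using of_real_Ek[of k p] by (metis Re_complex_of_real)
  then show "Ek eh k p = (\<Sum>\<^sub>\<infinity>s. Ek_coeff eh k s * cos (pair p s))"
    unfolding fourier_def infsum_Re[OF s, symmetric] by (simp add: mult.commute)
  show "(\<lambda>s. Ek_coeff eh k s * cos (pair p s)) summable_on UNIV"
    using summable_on_Re[OF s] by (simp add: mult.commute)
qed

lemma gap_hat_summable: "(\<lambda>x. cmod (gap_hat eh k x)) summable_on UNIV"
proof (rule summable_on_comparison_test)
  have "(\<lambda>x :: int ^ 'd. if x = 0 then \<bar>Emin eh k\<bar> else 0) summable_on UNIV \<longleftrightarrow>
      (\<lambda>x :: int ^ 'd. \<bar>Emin eh k\<bar>) summable_on {0}"
    by (rule summable_on_cong_neutral) auto
  then show "(\<lambda>x. \<bar>Ek_coeff eh k x\<bar> + (if x = 0 then \<bar>Emin eh k\<bar> else 0)) summable_on UNIV"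
    by (intro summable_on_add Ek_coeff_summable) simp
  show "cmod (gap_hat eh k x) \<le> \<bar>Ek_coeff eh k x\<bar> + (if x = 0 then \<bar>Emin eh k\<bar> else 0)" for x
    using norm_triangle_ineq4[of "complex_of_real (Ek_coeff eh k x)" "complex_of_real (Emin eh k)"]
    by (auto simp: gap_hat_def)
qed auto

lemma gap_hat_even: "gap_hat eh k (- x) = gap_hat eh k x"
  by (simp add: gap_hat_def Ek_coeff_def eh_even pair_minus_right)

lemma cnj_gap_hat: "cnj (gap_hat eh k x) = gap_hat eh k x"
  by (simp add: gap_hat_def)

lemma conv_gap_hat:
  assumes "sqsum f"
  shows "conv (gap_hat eh k) f x = H0 eh k f x - of_real (Emin eh k) * f x"
proof -
  have "(\<lambda>s. cmod (complex_of_real (Ek_coeff eh k s))) summable_on UNIV"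
    by (simp add: Ek_coeff_summable)
  from conv_summable_sqsum[OF this assms]
  have s: "(\<lambda>s. of_real (Ek_coeff eh k (x - s)) * f s) summable_on UNIV" .
  have eq: "(\<Sum>\<^sub>\<infinity>s. (if x = s then of_real (Emin eh k) else 0) * f s) =
      (\<Sum>\<^sub>\<infinity>s\<in>{x}. of_real (Emin eh k) * f s)"
    "(\<lambda>s. (if x = s then of_real (Emin eh k) else 0) * f s) summable_on UNIV \<longleftrightarrow>
      (\<lambda>s. of_real (Emin eh k) * f s) summable_on {x}"
    by (rule infsum_cong_neutral summable_on_cong_neutral; auto)+
  have "conv (gap_hat eh k) f x = (\<Sum>\<^sub>\<infinity>s. of_real (Ek_coeff eh k (x - s)) * f s +
      (- 1) * ((if x = s then of_real (Emin eh k) else 0) * f s))"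
    unfolding conv_def gap_hat_def by (intro infsum_cong) (auto simp: algebra_simps)
  also have "\<dots> = (\<Sum>\<^sub>\<infinity>s. of_real (Ek_coeff eh k (x - s)) * f s) +
      (\<Sum>\<^sub>\<infinity>s. (- 1) * ((if x = s then of_real (Emin eh k) else 0) * f s))"
    using s eq(2) by (intro infsum_add summable_on_cmult_right) auto
  also have "\<dots> = H0 eh k f x - of_real (Emin eh k) * f x"
    unfolding infsum_cmult_right' eq(1) by (simp add: H0_def Ek_hat_eq)
  finally show ?thesis .
qed

lemma fourier_gap_hat: "fourier (gap_hat eh k) p = of_real (gap eh k p)"
proof -
  let ?d = "\<lambda>x :: int ^ 'd. if x = 0 then complex_of_real (Emin eh k) else 0"
  have s: "(\<lambda>s. cis (pair p s) * complex_of_real (Ek_coeff eh k s)) summable_on UNIV"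
    by (rule fourier_summable) (simp add: Ek_coeff_summable)
  have eq: "(\<Sum>\<^sub>\<infinity>x. cis (pair p x) * ?d x) = (\<Sum>\<^sub>\<infinity>x\<in>{0}. cis (pair p x) * of_real (Emin eh k))"
    "(\<lambda>x. cis (pair p x) * ?d x) summable_on UNIV \<longleftrightarrow>
      (\<lambda>x. cis (pair p x) * complex_of_real (Emin eh k)) summable_on {0}"
    by (rule infsum_cong_neutral summable_on_cong_neutral; auto)+
  have "fourier (gap_hat eh k) p = (\<Sum>\<^sub>\<infinity>x. cis (pair p x) * of_real (Ek_coeff eh k x) +
      (- 1) * (cis (pair p x) * ?d x))"
    unfolding fourier_def gap_hat_def by (intro infsum_cong) (auto simp: algebra_simps)
  also have "\<dots> = (\<Sum>\<^sub>\<infinity>x. cis (pair p x) * of_real (Ek_coeff eh k x)) +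
      (\<Sum>\<^sub>\<infinity>x. (- 1) * (cis (pair p x) * ?d x))"
    using s eq(2) by (intro infsum_add summable_on_cmult_right) auto
  also have "\<dots> = of_real (gap eh k p)"
    unfolding infsum_cmult_right' eq(1) by (simp add: gap_def of_real_Ek fourier_def)
  finally show ?thesis .
qed

lemma gap_bounded: "\<bar>gap eh k p\<bar> \<le> (\<Sum>\<^sub>\<infinity>x. cmod (gap_hat eh k x))"
  using cmod_fourier_le[OF gap_hat_summable, of k p] by (simp add: fourier_gap_hat)

lemma continuous_on_gap: "continuous_on UNIV (gap eh k)"
proof -
  have "continuous_on UNIV (\<lambda>p. Re (fourier (gap_hat eh k) p))"
    by (intro continuous_intros continuous_on_fourier gap_hat_summable)
  then show ?thesis by (simp add: fourier_gap_hat)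
qed

lemma measurable_gap [measurable]: "gap eh k \<in> borel_measurable borel"
  by (rule borel_measurable_continuous_onI[OF continuous_on_gap])

lemma gap_nonneg: "gap eh k p \<ge> 0"
proof -
  obtain m :: "int ^ 'd" where m: "p + (\<chi> j. 2 * pi * of_int (m $ j)) \<in> cell" (is "?q \<in> _")
    using cell_shift by blast
  have "complex_of_real (Ek eh k ?q) = of_real (Ek eh k p)"
    unfolding of_real_Ek by (rule fourier_periodic)
  then have eq: "Ek eh k ?q = Ek eh k p" by (rule of_real_eq_iff[THEN iffD1])
  \<comment> \<open>\<open>INF\<close> is a lower bound only of a set that is bounded below.\<close>
  have "bdd_below (Ek eh k ` cell)"
    using gap_bounded[of k] by (intro bdd_belowI2[where m = "Emin eh k - (\<Sum>\<^sub>\<infinity>x. cmod (gap_hat eh k x))"])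
      (smt (verit) gap_def)
  then have "Emin eh k \<le> Ek eh k ?q" unfolding Emin_def using m by (intro cINF_lower) auto
  then show ?thesis by (simp add: gap_def eq)
qed

text \<open>The Morse property enters here: the zeros of the gap are countable and so form a null
  set. They may include points of the torus other than 0.\<close>

lemma AE_gap_pos:
  assumes "k \<in> G_nbhd eh"
  shows "AE p in haar. gap eh k p > 0"
proof (rule AE_haar)
  have "morse (Ek eh k)" using assms by (auto simp: G_nbhd_def)
  then have "countable {p. Ek eh k p = Emin eh k}"
    by (rule morse_minimum_set_countable) (use gap_nonneg[of k] in \<open>simp add: gap_def\<close>)
  then have "{p. Ek eh k p = Emin eh k} \<in> null_sets lborel" by (rule countable_imp_null_set_lborel)
  from AE_not_in[OF this] show "AE p in lborel. gap eh k p > 0"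
    by eventually_elim (use gap_nonneg[of k] in \<open>auto simp: gap_def less_le\<close>)
qed

lemma integral_cis_gap: "(LINT p|haar. cis (- pair p x) * of_real (gap eh k p)) = gap_hat eh k x"
  unfolding fourier_gap_hat[symmetric] by (rule integral_cis_fourier[OF gap_hat_summable])

text \<open>The kernel consists of the Fourier coefficients of the nonnegative gap, so on a finite
  set the form is the integral of the gap times the squared modulus of a trigonometric
  polynomial.\<close>

lemma gap_form_nonneg:
  assumes "sqsum f"
  shows "Re (ell2_inner (conv (gap_hat eh k) f) f) \<ge> 0"
proof (rule conv_nonneg[OF gap_hat_summable assms])
  fix F :: "(int ^ 'd) set" assume F: "finite F"
  let ?T = "\<lambda>p. \<Sum>s\<in>F. cis (pair p s) * f s"
  have int: "integrable haar (\<lambda>p :: real ^ 'd. cis (- pair p x) * complex_of_real (gap eh k p))" for x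
    using gap_bounded[of k]
    by (intro integrable_haar_bounded[where C = "\<Sum>\<^sub>\<infinity>x. cmod (gap_hat eh k x)"]) (auto simp: norm_mult)
  have eq: "gap_hat eh k (x - s) * f s * cnj (f x) =
      (LINT p|haar. (cis (- pair p (x - s)) * of_real (gap eh k p)) * (f s * cnj (f x)))" for x s
    unfolding integral_mult_left_zero integral_cis_gap by (simp add: mult.assoc)
  have "(\<Sum>x\<in>F. \<Sum>s\<in>F. gap_hat eh k (x - s) * f s * cnj (f x)) =
      (LINT p|haar. (\<Sum>x\<in>F. \<Sum>s\<in>F. (cis (- pair p (x - s)) * of_real (gap eh k p)) * (f s * cnj (f x))))"
    using int by (simp add: eq)
  also have "\<dots> = (LINT p|haar. complex_of_real (gap eh k p * (cmod (?T p))\<^sup>2))"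
  proof (rule Bochner_Integration.integral_cong)
    fix p :: "real ^ 'd"
    have "(\<Sum>x\<in>F. \<Sum>s\<in>F. (cis (- pair p (x - s)) * of_real (gap eh k p)) * (f s * cnj (f x))) =
        (\<Sum>x\<in>F. \<Sum>s\<in>F. of_real (gap eh k p) * (cis (pair p s) * f s) * cnj (cis (pair p x) * f x))"
    proof (intro sum.cong refl)
      fix x s
      have "cis (- pair p (x - s)) = cis (pair p s) * cnj (cis (pair p x))"
        by (simp add: cis_cnj cis_mult pair_diff_right)
      then show "(cis (- pair p (x - s)) * of_real (gap eh k p)) * (f s * cnj (f x)) =
          of_real (gap eh k p) * (cis (pair p s) * f s) * cnj (cis (pair p x) * f x)" by simp
    qed
    also have "\<dots> = of_real (gap eh k p) * (?T p * cnj (?T p))"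
    proof -
      have "?T p * cnj (?T p) = (\<Sum>x\<in>F. \<Sum>s\<in>F. (cis (pair p s) * f s) * cnj (cis (pair p x) * f x))"
        unfolding cnj_sum sum_product by (rule sum.swap)
      then show ?thesis by (simp only: sum_distrib_left mult.assoc)
    qed
    finally show "(\<Sum>x\<in>F. \<Sum>s\<in>F. (cis (- pair p (x - s)) * of_real (gap eh k p)) * (f s * cnj (f x))) =
        complex_of_real (gap eh k p * (cmod (?T p))\<^sup>2)"
      by (simp only: complex_norm_square of_real_mult)
  qed simp
  also have "\<dots> = of_real (LINT p|haar. gap eh k p * (cmod (?T p))\<^sup>2)" by (rule integral_complex_of_real)
  finally have "(\<Sum>x\<in>F. \<Sum>s\<in>F. gap_hat eh k (x - s) * f s * cnj (f x)) =
      of_real (LINT p|haar. gap eh k p * (cmod (?T p))\<^sup>2)" .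
  moreover have "(LINT p|haar. gap eh k p * (cmod (?T p))\<^sup>2) \<ge> 0"
    by (rule integral_nonneg_AE) (simp add: gap_nonneg)
  ultimately show "Re (\<Sum>x\<in>F. \<Sum>s\<in>F. gap_hat eh k (x - s) * f s * cnj (f x)) \<ge> 0" by simp
qed

end


section \<open>Trial functions\<close>

text \<open>Bessel's inequality. The partial Fourier sum \<open>T\<close> has the same pairing
  \<open>N\<close> with \<open>F\<close> and with itself; since 2 Re (T cnj F) \<le> |T|^2 + |F|^2,
  this bounds \<open>N\<close> by the integral of |F|^2, uniformly in the finite set.\<close>

lemma sqsum_fourier_coefficients:
  fixes F :: "real ^ 'd \<Rightarrow> complex"
  assumes meas: "F \<in> borel_measurable borel" and bound: "\<And>p. cmod (F p) \<le> C"
  shows "sqsum (\<lambda>x. LINT p|haar. cis (- pair p x) * F p)"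
proof (rule bounded_sums_imp_sqsum(1))
  let ?c = "\<lambda>x. LINT p|haar. cis (- pair p x) * F p"
  fix S :: "(int ^ 'd) set" assume S: "finite S"
  define d where "d x = (if x \<in> S then ?c x else 0)" for x
  define T where "T = fourier d"
  have d_sum: "(\<lambda>x. cmod (d x)) summable_on UNIV"
  proof -
    have "(\<lambda>x. cmod (d x)) summable_on UNIV \<longleftrightarrow> (\<lambda>x. cmod (d x)) summable_on S"
      by (rule summable_on_cong_neutral) (auto simp: d_def)
    then show ?thesis using S by simp
  qed
  have [measurable]: "T \<in> borel_measurable borel" unfolding T_def by (rule measurable_fourier[OF d_sum])
  note [measurable] = meas
  have T_bound: "cmod (T p) \<le> (\<Sum>\<^sub>\<infinity>x. cmod (d x))" for p unfolding T_def by (rule cmod_fourier_le[OF d_sum])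
  have C0: "C \<ge> 0" using bound[of 0] norm_ge_zero order_trans by blast
  define N where "N = (\<Sum>x\<in>S. (cmod (?c x))\<^sup>2)"
  \<comment> \<open>Only the coefficients on \<open>S\<close> matter, so one computation covers both
    \<open>R = F\<close> and \<open>R = T\<close>.\<close>
  have pairing: "(LINT p|haar. T p * cnj (R p)) = of_real N"
    if int: "integrable haar R" and coef: "\<And>x. x \<in> S \<Longrightarrow> (LINT p|haar. cis (- pair p x) * R p) = ?c x" for R
  proof -
    have "(LINT p|haar. T p * cnj (R p)) = (\<Sum>\<^sub>\<infinity>x. d x * (LINT p|haar. cis (pair p x) * cnj (R p)))"
      unfolding T_def by (rule integral_fourier_mult(2)[OF d_sum]) (use int in simp)
    also have "\<dots> = (\<Sum>\<^sub>\<infinity>x\<in>S. of_real ((cmod (?c x))\<^sup>2))"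
    proof (rule infsum_cong_neutral)
      fix x assume x: "x \<in> UNIV \<inter> S"
      have "(LINT p|haar. cis (pair p x) * cnj (R p)) = cnj (LINT p|haar. cis (- pair p x) * R p)"
        unfolding Bochner_Integration.integral_cnj[symmetric] by (simp add: cis_cnj)
      then show "d x * (LINT p|haar. cis (pair p x) * cnj (R p)) = of_real ((cmod (?c x))\<^sup>2)"
        using coef[of x] x by (simp add: d_def complex_norm_square del: of_real_power)
    qed (auto simp: d_def)
    finally show ?thesis using S by (simp add: N_def)
  qed
  have int_F: "integrable haar F" by (rule integrable_haar_bounded[OF meas bound])
  have int_T: "integrable haar T" by (rule integrable_haar_bounded[OF _ T_bound]) measurable
  have TF: "(LINT p|haar. T p * cnj (F p)) = of_real N" by (rule pairing[OF int_F]) simp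
  have TT: "(LINT p|haar. T p * cnj (T p)) = of_real N"
    by (rule pairing[OF int_T]) (simp add: T_def integral_cis_fourier[OF d_sum] d_def)
  have int_F2: "integrable haar (\<lambda>p. (cmod (F p))\<^sup>2)"
    using bound C0 by (intro integrable_haar_bounded[where C = "C\<^sup>2"]) (auto intro!: power_mono)
  have int_T2: "integrable haar (\<lambda>p. (cmod (T p))\<^sup>2)"
    using T_bound by (intro integrable_haar_bounded[where C = "(\<Sum>\<^sub>\<infinity>x. cmod (d x))\<^sup>2"]) (auto intro!: power_mono)
  have "complex_of_real (LINT p|haar. (cmod (T p))\<^sup>2) = of_real N"
    unfolding TT[symmetric] complex_norm_square[symmetric] by (rule integral_complex_of_real[symmetric])
  then have T2: "(LINT p|haar. (cmod (T p))\<^sup>2) = N" by (rule of_real_eq_iff[THEN iffD1])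
  have int_TF: "integrable haar (\<lambda>p. T p * cnj (F p))"
    by (rule integrable_haar_mult_bounded[OF _ _ T_bound]) (use int_F in auto)
  have "N = Re (LINT p|haar. T p * cnj (F p))" by (simp add: TF)
  also have "\<dots> = (LINT p|haar. Re (T p * cnj (F p)))" by (rule integral_Re[OF int_TF, symmetric])
  also have "\<dots> \<le> (LINT p|haar. ((cmod (T p))\<^sup>2 + (cmod (F p))\<^sup>2) / 2)"
  proof (rule integral_mono)
    show "integrable haar (\<lambda>p. Re (T p * cnj (F p)))" by (rule integrable_Re[OF int_TF])
    show "integrable haar (\<lambda>p. ((cmod (T p))\<^sup>2 + (cmod (F p))\<^sup>2) / 2)" using int_F2 int_T2 by simp
    fix p
    have "Re (T p * cnj (F p)) \<le> cmod (T p) * cmod (F p)"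
      using complex_Re_le_cmod[of "T p * cnj (F p)"] by (simp add: norm_mult)
    then show "Re (T p * cnj (F p)) \<le> ((cmod (T p))\<^sup>2 + (cmod (F p))\<^sup>2) / 2"
      using sum_squares_bound[of "cmod (T p)" "cmod (F p)"] by simp
  qed
  also have "\<dots> = (N + (LINT p|haar. (cmod (F p))\<^sup>2)) / 2"
    using int_F2 int_T2 by (simp add: T2)
  finally show "(\<Sum>x\<in>S. (cmod (?c x))\<^sup>2) \<le> (LINT p|haar. (cmod (F p))\<^sup>2)" by (simp add: N_def)
qed

locale lattice_pair = lattice_dispersion eh for eh :: "int ^ 'd \<Rightarrow> real" +
  fixes vh :: "int ^ 'd \<Rightarrow> real"
  assumes vh_summable: "(\<lambda>x. \<bar>vh x\<bar>) summable_on UNIV" and vh_even: "\<And>x. vh (- x) = vh x"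
    and vh_nonpos: "\<And>x. vh x \<le> 0"
begin

lemma lattice_operator: "lattice_operator (gap_hat eh k) (\<lambda>x. \<mu> * vh x)"
proof
  show "(\<lambda>x. \<bar>\<mu> * vh x\<bar>) summable_on UNIV"
    using summable_on_cmult_right[OF vh_summable, of "\<bar>\<mu>\<bar>"] by (simp add: abs_mult)
qed (simp_all add: gap_hat_summable gap_hat_even cnj_gap_hat gap_form_nonneg vh_even)

abbreviation source :: "(int ^ 'd \<Rightarrow> complex) \<Rightarrow> int ^ 'd \<Rightarrow> complex" where
  "source \<psi> \<equiv> V_abs_sqrt vh \<psi>"

abbreviation amp :: "(int ^ 'd \<Rightarrow> complex) \<Rightarrow> real ^ 'd \<Rightarrow> complex" where
  "amp \<psi> \<equiv> fourier (source \<psi>)"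

lemma sqsum_sqrt_vh: "sqsum (\<lambda>x. complex_of_real (sqrt \<bar>vh x\<bar>))"
  using vh_summable by (simp add: sqsum_def)

text \<open>The square root of a summable potential is square summable, so the source is absolutely
  summable and \<open>amp \<psi>\<close> is a bounded continuous function.\<close>

lemma source_summable: "sqsum \<psi> \<Longrightarrow> (\<lambda>x. cmod (source \<psi> x)) summable_on UNIV"
  using prod_abs_summable[OF sqsum_sqrt_vh, of \<psi>] by (simp add: V_abs_sqrt_def norm_mult)

lemma sqrt_vh_bounded: "cmod (complex_of_real (sqrt \<bar>vh x\<bar>)) \<le> ell2_norm (\<lambda>x. complex_of_real (sqrt \<bar>vh x\<bar>))"
  by (rule cmod_le_norm[OF sqsum_sqrt_vh])

lemma sqsum_source: "sqsum \<psi> \<Longrightarrow> sqsum (source \<psi>)"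
  unfolding V_abs_sqrt_def[abs_def] by (rule sqsum_bounded_mult[OF _ sqrt_vh_bounded])

lemma measurable_amp: "sqsum \<psi> \<Longrightarrow> amp \<psi> \<in> borel_measurable borel"
  by (rule measurable_fourier[OF source_summable])

lemma source_sum: "source (\<lambda>x. \<Sum>i\<in>I. c i * \<psi> i x) = (\<lambda>x. \<Sum>i\<in>I. c i * source (\<psi> i) x)"
  by (simp add: V_abs_sqrt_def fun_eq_iff sum_distrib_left mult.left_commute)

lemma amp_sum:
  assumes "\<And>i. i \<in> I \<Longrightarrow> sqsum (\<psi> i)" "finite I"
  shows "amp (\<lambda>x. \<Sum>i\<in>I. c i * \<psi> i x) p = (\<Sum>i\<in>I. c i * amp (\<psi> i) p)"
proof -
  have *: "((\<lambda>x. c i * (cis (pair p x) * source (\<psi> i) x)) has_sum c i * amp (\<psi> i) p) UNIV" if "i \<in> I" for i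
    unfolding fourier_def
    by (intro has_sum_cmult_right has_sum_infsum fourier_summable source_summable assms(1) that)
  have "((\<lambda>x. \<Sum>i\<in>I. c i * (cis (pair p x) * source (\<psi> i) x)) has_sum (\<Sum>i\<in>I. c i * amp (\<psi> i) p)) UNIV"
    using assms(2) * by (induction I rule: finite_induct) (auto intro: has_sum_add)
  moreover have "amp (\<lambda>x. \<Sum>i\<in>I. c i * \<psi> i x) p = (\<Sum>\<^sub>\<infinity>x. \<Sum>i\<in>I. c i * (cis (pair p x) * source (\<psi> i) x))"
    unfolding source_sum fourier_def by (simp add: sum_distrib_left mult.left_commute)
  ultimately show ?thesis by (simp add: infsumI)
qed

text \<open>The resolvent of \<open>H0\<close> at \<open>Emin - \<delta>\<close>, applied to the
  source.\<close>

definition trial :: "real ^ 'd \<Rightarrow> real \<Rightarrow> (int ^ 'd \<Rightarrow> complex) \<Rightarrow> int ^ 'd \<Rightarrow> complex" where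
  "trial k \<delta> \<psi> x = (LINT p|haar. cis (- pair p x) * (amp \<psi> p / of_real (gap eh k p + \<delta>)))"

context
  fixes k :: "real ^ 'd" and \<delta> :: real
  assumes \<delta>: "\<delta> > 0"
begin

lemma resolvent_measurable:
  "sqsum \<psi> \<Longrightarrow> (\<lambda>p. amp \<psi> p / of_real (gap eh k p + \<delta>)) \<in> borel_measurable borel"
  using measurable_amp[of \<psi>] measurable_gap[of k] by measurable

lemma resolvent_bounded:
  assumes "sqsum \<psi>"
  shows "cmod (amp \<psi> p / of_real (gap eh k p + \<delta>)) \<le> (\<Sum>\<^sub>\<infinity>x. cmod (source \<psi> x)) / \<delta>"
proof -
  have "gap eh k p + \<delta> \<ge> \<delta>" using gap_nonneg[of k p] by simp
  moreover have "cmod (complex_of_real (gap eh k p + \<delta>)) = gap eh k p + \<delta>"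
    using gap_nonneg[of k p] \<delta> by (simp only: norm_of_real abs_of_nonneg)
  ultimately show ?thesis
    using cmod_fourier_le[OF source_summable[OF assms], of p] \<delta>
    by (simp only: norm_divide) (intro frac_le; simp add: order_trans[OF norm_ge_zero])
qed

lemma resolvent_integrable:
  "sqsum \<psi> \<Longrightarrow> integrable haar (\<lambda>p. amp \<psi> p / of_real (gap eh k p + \<delta>))"
  by (rule integrable_haar_bounded[OF resolvent_measurable resolvent_bounded])

lemma sqsum_trial: "sqsum \<psi> \<Longrightarrow> sqsum (trial k \<delta> \<psi>)"
  unfolding trial_def[abs_def]
  by (rule sqsum_fourier_coefficients[OF resolvent_measurable resolvent_bounded])

text \<open>Convolution by the coefficients of the gap multiplies the integrand by the gap; adding
  the term with \<delta> cancels the denominator, and Fourier inversion returns the source.\<close>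

lemma trial_equation:
  assumes \<psi>: "sqsum \<psi>"
  shows "conv (gap_hat eh k) (trial k \<delta> \<psi>) x + of_real \<delta> * trial k \<delta> \<psi> x = source \<psi> x"
proof -
  let ?F = "\<lambda>p. amp \<psi> p / of_real (gap eh k p + \<delta>)"
  let ?c = "\<lambda>p. cis (- pair p x) * ?F p"
  have int: "integrable haar ?c"
    by (rule integrable_haar_mult_bounded[OF resolvent_integrable[OF \<psi>], where C = 1]) auto
  have "conv (gap_hat eh k) (trial k \<delta> \<psi>) x =
      (\<Sum>\<^sub>\<infinity>t. gap_hat eh k t * (LINT p|haar. cis (pair p t) * ?c p))"
    unfolding conv_def
  proof (rule infsum_reindex_bij_witness[of _ "\<lambda>t. x - t" "\<lambda>s. x - s"])
    fix s
    have "cis (pair p (x - s)) * cis (- pair p x) = cis (- pair p s)" for p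
      by (simp add: cis_mult pair_diff_right)
    then show "gap_hat eh k (x - s) * (LINT p|haar. cis (pair p (x - s)) * ?c p) =
        gap_hat eh k (x - s) * trial k \<delta> \<psi> s"
      by (simp add: trial_def mult.assoc[symmetric])
  qed auto
  also have "\<dots> = (LINT p|haar. of_real (gap eh k p) * ?c p)"
    using integral_fourier_mult(2)[OF gap_hat_summable int] by (simp add: fourier_gap_hat)
  finally have "conv (gap_hat eh k) (trial k \<delta> \<psi>) x + of_real \<delta> * trial k \<delta> \<psi> x =
      (LINT p|haar. of_real (gap eh k p) * ?c p) + (LINT p|haar. of_real \<delta> * ?c p)"
    by (simp only: trial_def integral_mult_right_zero)
  also have "\<dots> = (LINT p|haar. of_real (gap eh k p) * ?c p + of_real \<delta> * ?c p)"
  proof (rule Bochner_Integration.integral_add[symmetric])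
    show "integrable haar (\<lambda>p. of_real (gap eh k p) * ?c p)"
      using integral_fourier_mult(1)[OF gap_hat_summable int] by (simp add: fourier_gap_hat)
    show "integrable haar (\<lambda>p. of_real \<delta> * ?c p)"
      by (intro integrable_mult_right int)
  qed
  also have "\<dots> = (LINT p|haar. cis (- pair p x) * amp \<psi> p)"
  proof (rule Bochner_Integration.integral_cong)
    fix p
    have "gap eh k p + \<delta> \<noteq> 0" using gap_nonneg[of k p] \<delta> by linarith
    then have nz: "complex_of_real (gap eh k p) + of_real \<delta> \<noteq> 0" by (simp flip: of_real_add)
    have alg: "u * (c * (g / (u + d))) + d * (c * (g / (u + d))) = c * g" if "u + d \<noteq> 0"
      for u d c g :: complex
      unfolding distrib_right[symmetric] using that by simp
    show "of_real (gap eh k p) * ?c p + of_real \<delta> * ?c p = cis (- pair p x) * amp \<psi> p"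
      unfolding of_real_add by (rule alg[OF nz])
  qed simp
  also have "\<dots> = source \<psi> x" by (rule integral_cis_fourier[OF source_summable[OF \<psi>]])
  finally show ?thesis .
qed

text \<open>The equation has only one square summable solution, so it inherits the symmetry of its data.\<close>

lemma trial_even:
  assumes \<psi>: "\<psi> \<in> ell2e"
  shows "trial k \<delta> \<psi> (- x) = trial k \<delta> \<psi> x"
proof -
  let ?a = "gap_hat eh k"
  let ?t = "trial k \<delta> \<psi>" and ?r = "\<lambda>x. trial k \<delta> \<psi> (- x)"
  have sq: "sqsum \<psi>" and ev: "\<psi> (- x) = \<psi> x" for x using \<psi> by (auto simp: ell2e_iff)
  have t: "sqsum ?t" by (rule sqsum_trial[OF sq])
  have r: "sqsum ?r"
  proof -
    have "(\<lambda>x. (cmod (?r x))\<^sup>2) summable_on UNIV \<longleftrightarrow> (\<lambda>x. (cmod (?t x))\<^sup>2) summable_on UNIV"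
      by (rule summable_on_reindex_bij_witness[of _ uminus uminus]) auto
    then show ?thesis using t by (simp add: sqsum_def)
  qed
  have conv_r: "conv ?a ?r x = conv ?a ?t (- x)" for x
    unfolding conv_def
  proof (rule infsum_reindex_bij_witness[of _ uminus uminus])
    show "?a (- x - - s) * ?t (- s) = ?a (x - s) * ?r s" for s
      using gap_hat_even[of k "x - s"] by simp
  qed auto
  define d where "d x = ?r x - ?t x" for x
  have d: "sqsum d" unfolding d_def[abs_def] by (rule sqsum_diff[OF r t])
  have "conv ?a d x = - of_real \<delta> * d x" for x
  proof -
    have "conv ?a d x = conv ?a ?t (- x) - conv ?a ?t x"
      unfolding d_def[abs_def] conv_diff[OF gap_hat_summable r t] conv_r ..
    moreover have "source \<psi> (- x) = source \<psi> x" by (simp add: V_abs_sqrt_def vh_even ev)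
    moreover have "conv ?a ?t y = source \<psi> y - of_real \<delta> * ?t y" for y
      using trial_equation[OF sq, of y] by (simp add: eq_diff_eq)
    ultimately show ?thesis by (simp add: d_def algebra_simps)
  qed
  then have "conv ?a d = (\<lambda>x. - of_real \<delta> * d x)" by (rule ext)
  then have "Re (ell2_inner (conv ?a d) d) = - \<delta> * (ell2_norm d)\<^sup>2"
    using inner_cmult_left[of "- of_real \<delta>" d d] inner_self[OF d] by simp
  then have "\<delta> * (ell2_norm d)\<^sup>2 \<le> 0" using gap_form_nonneg[OF d, of k] by simp
  then have "ell2_norm d = 0" using \<delta> by (simp add: mult_le_0_iff)
  then have "d = (\<lambda>x. 0)" using ell2_norm_eq_0D[OF d] by simp
  then show ?thesis using d_def[of x] by simp
qed

lemma trial_ell2e: "\<psi> \<in> ell2e \<Longrightarrow> trial k \<delta> \<psi> \<in> ell2e"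
  using sqsum_trial trial_even by (simp add: ell2e_iff)

lemma trial_sum:
  assumes "\<And>i. i \<in> I \<Longrightarrow> sqsum (\<psi> i)" "finite I"
  shows "trial k \<delta> (\<lambda>x. \<Sum>i\<in>I. c i * \<psi> i x) x = (\<Sum>i\<in>I. c i * trial k \<delta> (\<psi> i) x)"
proof -
  let ?r = "\<lambda>i p. cis (- pair p x) * (amp (\<psi> i) p / of_real (gap eh k p + \<delta>))"
  have int: "integrable haar (?r i)" if "i \<in> I" for i
    by (rule integrable_haar_mult_bounded[OF resolvent_integrable[OF assms(1)[OF that]], where C = 1]) auto
  have "cis (- pair p x) * (amp (\<lambda>x. \<Sum>i\<in>I. c i * \<psi> i x) p / of_real (gap eh k p + \<delta>)) =
      (\<Sum>i\<in>I. c i * ?r i p)" for p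
    using amp_sum[OF assms, where c = c and p = p] by (simp add: sum_divide_distrib sum_distrib_left mult_ac)
  then have "trial k \<delta> (\<lambda>x. \<Sum>i\<in>I. c i * \<psi> i x) x = (LINT p|haar. (\<Sum>i\<in>I. c i * ?r i p))"
    unfolding trial_def by (simp only:)
  also have "\<dots> = (\<Sum>i\<in>I. LINT p|haar. c i * ?r i p)"
    by (intro Bochner_Integration.integral_sum integrable_mult_right int)
  finally show ?thesis by (simp only: trial_def integral_mult_right_zero)
qed

lemma inner_source_trial:
  assumes \<psi>: "sqsum \<psi>"
  shows "ell2_inner (source \<psi>) (trial k \<delta> \<psi>) = of_real (LINT p|haar. (cmod (amp \<psi> p))\<^sup>2 / (gap eh k p + \<delta>))"
proof -
  let ?F = "\<lambda>p. amp \<psi> p / of_real (gap eh k p + \<delta>)"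
  have cnj: "cnj (trial k \<delta> \<psi> x) = (LINT p|haar. cis (pair p x) * cnj (?F p))" for x
    unfolding trial_def Bochner_Integration.integral_cnj[symmetric] by (simp add: cis_cnj)
  have "ell2_inner (source \<psi>) (trial k \<delta> \<psi>) = (LINT p|haar. amp \<psi> p * cnj (?F p))"
    unfolding ell2_inner_def cnj
    by (rule integral_fourier_mult(2)[symmetric, OF source_summable[OF \<psi>]])
       (rule integrable_cnj[OF resolvent_integrable[OF \<psi>]])
  also have "\<dots> = (LINT p|haar. complex_of_real ((cmod (amp \<psi> p))\<^sup>2 / (gap eh k p + \<delta>)))"
    by (simp add: complex_norm_square del: of_real_power)
  also have "\<dots> = of_real (LINT p|haar. (cmod (amp \<psi> p))\<^sup>2 / (gap eh k p + \<delta>))"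
    by (rule integral_complex_of_real)
  finally show ?thesis .
qed

text \<open>Write t for the trial function and b for the integral. By the resolvent equation the
  kinetic form is b - \<delta> times the squared norm of t, hence at most b. The potential form is
  -\<mu> times the squared norm of |V|^(1/2) t, and this norm is at least b by Cauchy--Schwarz,
  since the inner product with the unit vector \<psi> equals b.\<close>

lemma form_trial_neg:
  assumes \<psi>: "sqsum \<psi>" "ell2_norm \<psi> = 1" and \<mu>: "\<mu> > 0"
    and b: "(LINT p|haar. (cmod (amp \<psi> p))\<^sup>2 / (gap eh k p + \<delta>)) > 1 / \<mu>"
  shows "lattice_operator.form (gap_hat eh k) (\<lambda>x. \<mu> * vh x) (trial k \<delta> \<psi>) < 0"
proof -
  interpret O: lattice_operator "gap_hat eh k" "\<lambda>x. \<mu> * vh x" by (rule lattice_operator)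
  let ?t = "trial k \<delta> \<psi>" and ?b = "LINT p|haar. (cmod (amp \<psi> p))\<^sup>2 / (gap eh k p + \<delta>)"
  have t: "sqsum ?t" by (rule sqsum_trial[OF \<psi>(1)])
  have h: "sqsum (source \<psi>)" by (rule sqsum_source[OF \<psi>(1)])
  have "conv (gap_hat eh k) ?t = (\<lambda>x. source \<psi> x - of_real \<delta> * ?t x)"
    using trial_equation[OF \<psi>(1)] by (auto simp: algebra_simps)
  then have "ell2_inner (conv (gap_hat eh k) ?t) ?t = of_real ?b - of_real \<delta> * of_real ((ell2_norm ?t)\<^sup>2)"
    using h t by (simp add: inner_diff_left sqsum_cmult inner_cmult_left inner_self
        inner_source_trial[OF \<psi>(1)] del: of_real_power)
  then have kin: "Re (ell2_inner (conv (gap_hat eh k) ?t) ?t) \<le> ?b" using \<delta> by simp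
  have pot: "(\<Sum>\<^sub>\<infinity>x. \<mu> * vh x * (cmod (?t x))\<^sup>2) = - \<mu> * (ell2_norm (source ?t))\<^sup>2"
  proof -
    have "\<mu> * vh x * (cmod (?t x))\<^sup>2 = - \<mu> * (cmod (source ?t x))\<^sup>2" for x
      using vh_nonpos[of x] by (simp add: V_abs_sqrt_def norm_mult power_mult_distrib)
    then show ?thesis unfolding ell2_norm_sq by (simp only: infsum_cmult_right')
  qed
  have "ell2_inner \<psi> (source ?t) = ell2_inner (source \<psi>) ?t"
    by (simp add: ell2_inner_def V_abs_sqrt_def mult_ac)
  also have "\<dots> = of_real ?b" by (rule inner_source_trial[OF \<psi>(1)])
  finally have "\<bar>?b\<bar> \<le> ell2_norm (source ?t)"
    using Cauchy_Schwarz_inner[OF \<psi>(1) sqsum_source[OF t]] \<psi>(2) by (simp only: norm_of_real)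
  moreover have b0: "?b > 0" using b \<mu> by (smt (verit) divide_pos_pos)
  ultimately have "?b\<^sup>2 \<le> (ell2_norm (source ?t))\<^sup>2" by (intro power_mono) auto
  then have "\<mu> * ?b\<^sup>2 \<le> \<mu> * (ell2_norm (source ?t))\<^sup>2" using \<mu> by simp
  moreover have "?b < \<mu> * ?b\<^sup>2"
    using b b0 \<mu> by (simp add: power2_eq_square field_simps)
  ultimately show ?thesis using O.form_eq[OF t] kin pot by simp
qed

end

end


section \<open>The functional L\<close>

context lattice_pair
begin

text \<open>Where the integrals converge and \<psi> is even, this is the quadratic form of the
  Birman--Schwinger operator at \<open>k\<close>.\<close>

definition dispersion_form :: "real ^ 'd \<Rightarrow> (int ^ 'd \<Rightarrow> complex) \<Rightarrow> real" where
  "dispersion_form k \<psi> = (LINT p|haar. (cmod (amp \<psi> p))\<^sup>2 / gap eh k p)"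

lemma source_even: "\<psi> \<in> ell2e \<Longrightarrow> source \<psi> (- x) = source \<psi> x"
  by (simp add: V_abs_sqrt_def vh_even ell2e_iff)

lemma amp_even:
  assumes "\<psi> \<in> ell2e"
  shows "amp \<psi> (- p) = amp \<psi> p"
  unfolding fourier_def
  by (rule infsum_reindex_bij_witness[of _ uminus uminus])
     (auto simp: source_even[OF assms] pair_minus_left pair_minus_right)

text \<open>A divergent kernel integral has the value 0, and the zero operator does not have the eigenvalue 1.\<close>

lemma inverse_gap_integrable:
  assumes "eigenvalue (B1 eh vh k) 1"
  shows "integrable haar (\<lambda>p. 1 / gap eh k p)"
proof (rule ccontr)
  assume n: "\<not> integrable haar (\<lambda>p. 1 / gap eh k p)"
  have "\<not> integrable haar (\<lambda>q. cis (pair q z) / complex_of_real (Ek eh k q - Emin eh k))" for z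
  proof
    assume "integrable haar (\<lambda>q. cis (pair q z) / complex_of_real (Ek eh k q - Emin eh k))"
    from integrable_norm[OF this] have "integrable haar (\<lambda>q. 1 / \<bar>gap eh k q\<bar>)"
      by (simp add: norm_divide gap_def del: of_real_diff)
    then show False using n gap_nonneg[of k] by simp
  qed
  then have "B1_kernel eh vh k x y = 0" for x y
    by (simp add: B1_kernel_def not_integrable_integral_eq)
  then have "B1 eh vh k f x = 0" for f x by (simp add: B1_def)
  then show False using assms by (auto simp: eigenvalue_def eigenspace_def fun_eq_iff)
qed

section \<open>Birman--Schwinger eigenvectors when the inverse gap is integrable\<close>

context
  fixes k0 :: "real ^ 'd"
  assumes inv_int: "integrable haar (\<lambda>p. 1 / gap eh k0 p)"
begin

lemma inverse_gap_integrable_complex: "integrable haar (\<lambda>p. cis (pair p x) / complex_of_real (gap eh k0 p))"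
proof -
  have "integrable haar (\<lambda>p. complex_of_real (1 / gap eh k0 p))"
    by (rule integrable_of_real[OF inv_int])
  from integrable_haar_mult_bounded[OF this, of "\<lambda>p. cis (pair p x)" 1] show ?thesis by simp
qed

lemma B1_eq:
  assumes f: "f \<in> ell2e"
  shows "B1 eh vh k0 f x = of_real (sqrt \<bar>vh x\<bar>) *
    (LINT q|haar. amp f q * (cis (pair q x) / of_real (gap eh k0 q)))"
proof -
  let ?r = "\<lambda>q. cis (pair q x) / complex_of_real (gap eh k0 q)"
  have sq: "sqsum f" using f by (simp add: ell2e_iff)
  have "B1 eh vh k0 f x = (\<Sum>\<^sub>\<infinity>y. of_real (sqrt \<bar>vh x\<bar>) *
      (source f y * (LINT q|haar. cis (pair q (x - y)) / complex_of_real (gap eh k0 q))))"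
    unfolding B1_def B1_kernel_def gap_def by (intro infsum_cong) (simp add: V_abs_sqrt_def)
  also have "\<dots> = of_real (sqrt \<bar>vh x\<bar>) *
      (\<Sum>\<^sub>\<infinity>y. source f y * (LINT q|haar. cis (pair q (x - y)) / complex_of_real (gap eh k0 q)))"
    by (rule infsum_cmult_right')
  also have "(\<Sum>\<^sub>\<infinity>y. source f y * (LINT q|haar. cis (pair q (x - y)) / complex_of_real (gap eh k0 q))) =
      (\<Sum>\<^sub>\<infinity>y. source f y * (LINT q|haar. cis (pair q y) * ?r q))"
  \<comment> \<open>The kernel depends on y through exp(-i(q,y)), while \<open>amp\<close> sums
    exp(i(q,y)); since the source is even, y \<mapsto> -y reconciles the two.\<close>
  proof (rule infsum_reindex_bij_witness[of _ uminus uminus])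
    show "source f (- y) * (LINT q|haar. cis (pair q (- y)) * ?r q) =
        source f y * (LINT q|haar. cis (pair q (x - y)) / complex_of_real (gap eh k0 q))" for y
      unfolding source_even[OF f] times_divide_eq_right cis_mult pair_add_right[symmetric] by simp
  qed auto
  also have "\<dots> = (LINT q|haar. amp f q * ?r q)"
    by (rule integral_fourier_mult(2)[symmetric, OF source_summable[OF sq] inverse_gap_integrable_complex])
  finally show ?thesis .
qed

lemma B1_sum:
  assumes f: "\<And>i. i < n \<Longrightarrow> f i \<in> ell2e"
  shows "B1 eh vh k0 (\<lambda>x. \<Sum>i<n. c i * f i x) x = (\<Sum>i<(n::nat). c i * B1 eh vh k0 (f i) x)"
proof -
  let ?r = "\<lambda>q. cis (pair q x) / complex_of_real (gap eh k0 q)"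
  have sq: "sqsum (f i)" if "i \<in> {..<n}" for i using f that by (simp add: ell2e_iff)
  have "(\<lambda>x. \<Sum>i<n. c i * f i x) \<in> ell2e"
    using sq f by (auto simp: ell2e_iff intro!: sqsum_sum sqsum_cmult sum.cong)
  then have "B1 eh vh k0 (\<lambda>x. \<Sum>i<n. c i * f i x) x = of_real (sqrt \<bar>vh x\<bar>) *
      (LINT q|haar. amp (\<lambda>x. \<Sum>i<n. c i * f i x) q * ?r q)" by (rule B1_eq)
  also have "(\<lambda>q. amp (\<lambda>x. \<Sum>i<n. c i * f i x) q * ?r q) = (\<lambda>q. \<Sum>i<n. c i * (amp (f i) q * ?r q))"
    using amp_sum[where I = "{..<n}" and \<psi> = f and c = c, OF sq] by (simp add: sum_distrib_right sum_divide_distrib mult.assoc)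
  also have "(LINT q|haar. (\<Sum>i<n. c i * (amp (f i) q * ?r q))) = (\<Sum>i<n. LINT q|haar. c i * (amp (f i) q * ?r q))"
  proof (rule Bochner_Integration.integral_sum)
    fix i assume "i \<in> {..<n}"
    then show "integrable haar (\<lambda>q. c i * (amp (f i) q * ?r q))"
      by (intro integrable_mult_right integral_fourier_mult(1) source_summable sq inverse_gap_integrable_complex)
  qed
  also have "\<dots> = (\<Sum>i<n. c i * (LINT q|haar. amp (f i) q * ?r q))"
    by (simp only: integral_mult_right_zero)
  finally show ?thesis
    using B1_eq[OF f] by (simp add: sum_distrib_left mult.left_commute)
qed

text \<open>The eigenvalue equation is paired with \<psi>: one factor |V|^(1/2) moves onto each side
  and the kernel integral becomes the dispersion form.\<close>

lemma dispersion_form_eigenvector: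
  assumes \<psi>: "\<psi> \<in> eigenspace (B1 eh vh k0) 1"
  shows "integrable haar (\<lambda>p. (cmod (amp \<psi> p))\<^sup>2 / gap eh k0 p)"
    and "dispersion_form k0 \<psi> = (ell2_norm \<psi>)\<^sup>2"
proof -
  have e: "\<psi> \<in> ell2e" and B: "B1 eh vh k0 \<psi> x = \<psi> x" for x
    using \<psi> by (auto simp: eigenspace_def)
  have sq: "sqsum \<psi>" using e by (simp add: ell2e_iff)
  let ?r = "\<lambda>p. amp \<psi> p / complex_of_real (gap eh k0 p)"
  let ?h = "\<lambda>x. cnj (source \<psi> x)"
  have h: "(\<lambda>x. cmod (?h x)) summable_on UNIV" using source_summable[OF sq] by simp
  have r: "integrable haar ?r"
    using integral_fourier_mult(1)[OF source_summable[OF sq] inverse_gap_integrable_complex[of 0]] by simp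
  \<comment> \<open>Conjugation reflects p, and evenness of \<open>amp\<close> undoes the
    reflection. So the conjugate of \<open>amp\<close> is itself an absolutely convergent Fourier
    series.\<close>
  have fh: "fourier ?h p = cnj (amp \<psi> p)" for p
  proof -
    have "fourier ?h p = cnj (amp \<psi> (- p))"
      unfolding fourier_def infsum_cnj[symmetric] by (simp add: cis_cnj pair_minus_left)
    then show ?thesis by (simp add: amp_even[OF e])
  qed
  have eq: "cnj (amp \<psi> p) * ?r p = complex_of_real ((cmod (amp \<psi> p))\<^sup>2 / gap eh k0 p)" for p
    by (simp add: complex_norm_square mult.commute del: of_real_power)
  have int: "integrable haar (\<lambda>p. complex_of_real ((cmod (amp \<psi> p))\<^sup>2 / gap eh k0 p))"
    using integral_fourier_mult(1)[OF h r] unfolding fh eq .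
  from integrable_Re[OF int]
  show "integrable haar (\<lambda>p. (cmod (amp \<psi> p))\<^sup>2 / gap eh k0 p)" by (simp only: Re_complex_of_real)
  have "complex_of_real (dispersion_form k0 \<psi>) = (LINT p|haar. cnj (amp \<psi> p) * ?r p)"
    unfolding dispersion_form_def eq by (rule integral_complex_of_real[symmetric])
  also have "\<dots> = (\<Sum>\<^sub>\<infinity>x. ?h x * (LINT p|haar. cis (pair p x) * ?r p))"
    using integral_fourier_mult(2)[OF h r] unfolding fh .
  also have "\<dots> = (\<Sum>\<^sub>\<infinity>x. \<psi> x * cnj (\<psi> x))"
  proof (rule infsum_cong)
    fix x
    have "?h x * (LINT p|haar. cis (pair p x) * ?r p) = cnj (\<psi> x) * B1 eh vh k0 \<psi> x"
      unfolding B1_eq[OF e] by (simp add: V_abs_sqrt_def mult_ac)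
    then show "?h x * (LINT p|haar. cis (pair p x) * ?r p) = \<psi> x * cnj (\<psi> x)"
      by (simp add: B)
  qed
  also have "\<dots> = of_real ((ell2_norm \<psi>)\<^sup>2)" using inner_self[OF sq] by (simp add: ell2_inner_def)
  finally show "dispersion_form k0 \<psi> = (ell2_norm \<psi>)\<^sup>2" by (rule of_real_eq_iff[THEN iffD1])
qed

end

text \<open>On \<open>G_nbhd\<close> the minimum is attained at 0, so the gap is the cosine series
  with 1 subtracted from every cosine. This is the origin of the factor 1 - cos in
  \<open>C_integrand\<close>.\<close>

lemma gap_diff_series:
  assumes "k \<in> G_nbhd eh" "k0 \<in> G_nbhd eh"
  shows "(\<Sum>\<^sub>\<infinity>s. 2 * L_weight eh k k0 s * (1 - cos (pair p s))) = gap eh k0 p - gap eh k p"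
proof -
  have E: "Emin eh k = Ek eh k 0" "Emin eh k0 = Ek eh k0 0" using assms by (auto simp: G_nbhd_def)
  let ?t = "\<lambda>k p s. Ek_coeff eh k s * cos (pair p s)"
  have g: "gap eh k' p = (\<Sum>\<^sub>\<infinity>s. ?t k' p s - ?t k' 0 s)" and
    s: "(\<lambda>s. ?t k' p s - ?t k' 0 s) summable_on UNIV" if "Emin eh k' = Ek eh k' 0" for k'
  proof -
    have sm: "(\<lambda>s. (- 1) * ?t k' 0 s) summable_on UNIV"
      by (intro summable_on_cmult_right Ek_eq_cos_series(2))
    have "(\<Sum>\<^sub>\<infinity>s. ?t k' p s + (- 1) * ?t k' 0 s) = gap eh k' p"
      unfolding infsum_add[OF Ek_eq_cos_series(2) sm] infsum_cmult_right'
      by (simp add: gap_def that Ek_eq_cos_series(1)[of k' p] Ek_eq_cos_series(1)[of k' 0])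
    then show "gap eh k' p = (\<Sum>\<^sub>\<infinity>s. ?t k' p s - ?t k' 0 s)" by simp
    show "(\<lambda>s. ?t k' p s - ?t k' 0 s) summable_on UNIV"
      using summable_on_add[OF Ek_eq_cos_series(2)[of k' p] sm] by simp
  qed
  have sm: "(\<lambda>s. (- 1) * (?t k p s - ?t k 0 s)) summable_on UNIV"
    by (intro summable_on_cmult_right s E(1))
  have "gap eh k0 p - gap eh k p = (\<Sum>\<^sub>\<infinity>s. (?t k0 p s - ?t k0 0 s) + (- 1) * (?t k p s - ?t k 0 s))"
    unfolding infsum_add[OF s[OF E(2)] sm] infsum_cmult_right' using g E by simp
  also have "\<dots> = (\<Sum>\<^sub>\<infinity>s. 2 * L_weight eh k k0 s * (1 - cos (pair p s)))"
    by (intro infsum_cong) (simp add: Ek_coeff_def L_weight_def algebra_simps)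
  finally show ?thesis by simp
qed

text \<open>The functional L is the difference of the two dispersion forms.\<close>

lemma dispersion_form_ge:
  assumes k: "k \<in> G_nbhd eh" and k0: "k0 \<in> G_nbhd eh"
    and inv: "integrable haar (\<lambda>p. 1 / gap eh k0 p)"
    and \<psi>: "\<psi> \<in> eigenspace (B1 eh vh k0) 1"
    and L: "L_defined eh vh k k0 \<psi>" "L_fun eh vh k k0 \<psi> \<ge> 0"
  shows "integrable haar (\<lambda>p. (cmod (amp \<psi> p))\<^sup>2 / gap eh k p)"
    and "dispersion_form k \<psi> \<ge> (ell2_norm \<psi>)\<^sup>2"
proof -
  let ?w = "L_weight eh k k0" and ?C = "\<lambda>s. C_integrand eh vh s k k0 \<psi>"
  let ?A = "\<lambda>p. (cmod (amp \<psi> p))\<^sup>2"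
  let ?D = "\<lambda>p. (gap eh k0 p - gap eh k p) * ?A p / (gap eh k p * gap eh k0 p)"
  have C: "?C s p = (1 - cos (pair p s)) * ?A p / (gap eh k p * gap eh k0 p)" for s p
    by (simp add: C_integrand_def gap_def)
  have C0: "?C s p \<ge> 0" for s p
    unfolding C using gap_nonneg[of k p] gap_nonneg[of k0 p] by simp
  have w0: "?w 0 = 0" by (simp add: L_weight_def)
  define f where "f s p = 2 * ?w s * ?C s p" for s p
  \<comment> \<open>If the weight vanishes, \<open>f s\<close> is identically 0 even when the
    integral of \<open>?C s\<close> diverges.\<close>
  have int: "integrable haar (f s)" for s
  proof (cases "?w s = 0")
    case False
    then have "s \<noteq> 0" using w0 by auto
    then have "integrable haar (?C s)" using L(1) False by (simp add: L_defined_def)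
    then show ?thesis unfolding f_def[abs_def] by (intro integrable_mult_right)
  qed (simp add: f_def[abs_def])
  have nf: "norm (f s p) = 2 * \<bar>?w s\<bar> * ?C s p" for s p
    using C0[of s p] by (simp add: f_def abs_mult)
  have w_le: "\<bar>?w s\<bar> \<le> 2 * \<bar>eh s\<bar>" for s
  proof -
    have "\<bar>cos (pair ((1/2) *\<^sub>R k) s) - cos (pair ((1/2) *\<^sub>R k0) s)\<bar> \<le> 2"
      using abs_cos_le_one[of "pair ((1/2) *\<^sub>R k) s"] abs_cos_le_one[of "pair ((1/2) *\<^sub>R k0) s"] by linarith
    from mult_left_mono[OF this, of "\<bar>eh s\<bar>"] show ?thesis by (simp add: L_weight_def abs_mult)
  qed
  have w_sum: "(\<lambda>s. \<bar>?w s\<bar>) summable_on UNIV"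
    by (rule summable_on_comparison_test[OF summable_on_cmult_right[OF eh_summable, of 2]]) (use w_le in auto)
  \<comment> \<open>This holds at every p: where a gap vanishes, the quotient has the value
    0.\<close>
  have pw: "(\<lambda>s. norm (f s p)) summable_on UNIV" for p
  proof (rule summable_on_comparison_test[OF summable_on_cmult_left[OF w_sum, of "4 * (?A p / (gap eh k p * gap eh k0 p))"]])
    fix s
    have "1 - cos (pair p s) \<le> 2" using abs_cos_le_one[of "pair p s"] by linarith
    moreover have "?A p / (gap eh k p * gap eh k0 p) \<ge> 0"
      using gap_nonneg[of k p] gap_nonneg[of k0 p] by simp
    ultimately have "?C s p \<le> 2 * (?A p / (gap eh k p * gap eh k0 p))"
      unfolding C times_divide_eq_right[symmetric] by (rule mult_right_mono)
    from mult_left_mono[OF this, of "2 * \<bar>?w s\<bar>"]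
    show "norm (f s p) \<le> \<bar>?w s\<bar> * (4 * (?A p / (gap eh k p * gap eh k0 p)))"
      unfolding nf by (simp add: mult_ac)
  qed auto
  have neutral: "(\<lambda>s. ?w s * C_coeff eh vh s k k0 \<psi>) summable_on UNIV \<longleftrightarrow>
      (\<lambda>s. ?w s * C_coeff eh vh s k k0 \<psi>) summable_on {s. s \<noteq> 0}"
    "(\<Sum>\<^sub>\<infinity>s. ?w s * C_coeff eh vh s k k0 \<psi>) = (\<Sum>\<^sub>\<infinity>s\<in>{s. s \<noteq> 0}. ?w s * C_coeff eh vh s k k0 \<psi>)"
    by (rule summable_on_cong_neutral infsum_cong_neutral; auto simp: w0)+
  have C_coeff_nonneg: "C_coeff eh vh s k k0 \<psi> \<ge> 0" for s
    unfolding C_coeff_def by (rule integral_nonneg_AE) (simp add: C0)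
  \<comment> \<open>As \<open>C_coeff\<close> is nonnegative, the L1 norms are twice the absolute
    values of the terms of the series for L. Unconditional summability of real terms is absolute,
    which is what permits exchanging sum and integral.\<close>
  have intn: "(LINT p|haar. norm (f s p)) = 2 * norm (?w s * C_coeff eh vh s k k0 \<psi>)" for s
  proof -
    have "(LINT p|haar. norm (f s p)) = 2 * \<bar>?w s\<bar> * C_coeff eh vh s k k0 \<psi>"
      unfolding nf C_coeff_def by (rule integral_mult_right_zero)
    then show ?thesis using C_coeff_nonneg[of s] by (simp add: abs_mult)
  qed
  have sum: "(\<lambda>s. LINT p|haar. norm (f s p)) summable_on UNIV"
  proof -
    have "(\<lambda>s. ?w s * C_coeff eh vh s k k0 \<psi>) summable_on UNIV"
      using L(1) neutral(1) by (simp add: L_defined_def)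
    then have "(\<lambda>s. norm (?w s * C_coeff eh vh s k k0 \<psi>)) summable_on UNIV"
      by (rule summable_on_iff_abs_summable_on_real[THEN iffD1])
    then show ?thesis unfolding intn by (rule summable_on_cmult_right)
  qed
  have series: "(\<Sum>\<^sub>\<infinity>s. f s p) = ?D p" for p
  proof -
    have "(\<Sum>\<^sub>\<infinity>s. f s p) = (\<Sum>\<^sub>\<infinity>s. 2 * ?w s * (1 - cos (pair p s)) * (?A p / (gap eh k p * gap eh k0 p)))"
      by (intro infsum_cong) (simp add: f_def C)
    also have "\<dots> = ?D p"
      unfolding infsum_cmult_left' gap_diff_series[OF k k0] by simp
    finally show ?thesis .
  qed
  have D_int: "integrable haar ?D" and D_eq: "(LINT p|haar. ?D p) = (\<Sum>\<^sub>\<infinity>s. integral\<^sup>L haar (f s))"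
    using integral_infsum[of haar f, OF int pw sum] by (simp_all add: series)
  have "integral\<^sup>L haar (f s) = 2 * (?w s * C_coeff eh vh s k k0 \<psi>)" for s
    unfolding f_def[abs_def] C_coeff_def integral_mult_right_zero by simp
  then have D_L: "(LINT p|haar. ?D p) = L_fun eh vh k k0 \<psi>"
    unfolding D_eq L_fun_def neutral(2)[symmetric] by (simp only: infsum_cmult_right')
  note k0form = dispersion_form_eigenvector[OF inv \<psi>]
  \<comment> \<open>The cancellation needs both gaps to be positive, which is the case almost
    everywhere. It yields the integrability for \<open>k\<close> along with the value of the
    integral.\<close>
  have alg: "(b - a) * t / (a * b) + t / b = t / a" if "a > 0" "b > 0" for a b t :: real
    using that by (simp add: field_simps)
  have ae: "AE p in haar. ?D p + ?A p / gap eh k0 p = ?A p / gap eh k p"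
    using AE_gap_pos[OF k] AE_gap_pos[OF k0] by eventually_elim (rule alg)
  have sum_int: "integrable haar (\<lambda>p. ?D p + ?A p / gap eh k0 p)"
    by (rule Bochner_Integration.integrable_add[OF D_int k0form(1)])
  have sq: "sqsum \<psi>" using \<psi> by (simp add: eigenspace_def ell2e_iff)
  have meas: "(\<lambda>p. ?A p / gap eh k p) \<in> borel_measurable haar"
    using measurable_amp[OF sq] measurable_gap[of k] by measurable
  show "integrable haar (\<lambda>p. ?A p / gap eh k p)"
    using integrable_cong_AE_imp[OF sum_int meas] ae by (simp add: eq_commute)
  have "dispersion_form k \<psi> = (LINT p|haar. ?D p + ?A p / gap eh k0 p)"
    unfolding dispersion_form_def
    by (rule integral_cong_AE[OF meas borel_measurable_integrable[OF sum_int]]) (use ae in \<open>simp add: eq_commute\<close>)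
  also have "\<dots> = L_fun eh vh k k0 \<psi> + (ell2_norm \<psi>)\<^sup>2"
    using Bochner_Integration.integral_add[OF D_int k0form(1)] k0form(2)
    by (simp add: D_L dispersion_form_def)
  finally show "dispersion_form k \<psi> \<ge> (ell2_norm \<psi>)\<^sup>2" using L(2) by simp
qed

end


section \<open>Eigenvalues below the threshold\<close>

lemma cmod_sum_mult_le:
  assumes "(\<Sum>i<(n::nat). (cmod (c i))\<^sup>2) = 1"
  shows "(cmod (\<Sum>i<n. c i * g i))\<^sup>2 \<le> (\<Sum>i<n. (cmod (g i))\<^sup>2)"
proof -
  have "cmod (\<Sum>i<n. c i * g i) \<le> (\<Sum>i<n. cmod (c i) * cmod (g i))"
    by (rule order_trans[OF norm_sum]) (simp add: norm_mult)
  then have "(cmod (\<Sum>i<n. c i * g i))\<^sup>2 \<le> (\<Sum>i<n. cmod (c i) * cmod (g i))\<^sup>2"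
    by (intro power_mono) auto
  also have "\<dots> \<le> (\<Sum>i<n. (cmod (c i))\<^sup>2) * (\<Sum>i<n. (cmod (g i))\<^sup>2)"
    by (rule Cauchy_Schwarz_ineq_sum)
  finally show ?thesis using assms by simp
qed

context lattice_pair
begin

abbreviation comb :: "nat \<Rightarrow> (nat \<Rightarrow> int ^ 'd \<Rightarrow> complex) \<Rightarrow> (nat \<Rightarrow> complex) \<Rightarrow> int ^ 'd \<Rightarrow> complex" where
  "comb n \<psi> c \<equiv> \<lambda>x. \<Sum>i<n. c i * \<psi> i x"

text \<open>Regularizing by a single positive \<open>\<delta>\<close> loses little of the dispersion form, uniformly on the unit
  sphere of the span: by Cauchy--Schwarz the loss is dominated by that of the trace.\<close>

lemma uniform_regularization:
  fixes \<psi> :: "nat \<Rightarrow> int ^ 'd \<Rightarrow> complex"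
  assumes k: "k \<in> G_nbhd eh" and \<psi>: "\<And>i. i < n \<Longrightarrow> sqsum (\<psi> i)"
    and int: "\<And>c. (\<Sum>i<n. (cmod (c i))\<^sup>2) = 1 \<Longrightarrow> integrable haar (\<lambda>p. (cmod (amp (comb n \<psi> c) p))\<^sup>2 / gap eh k p)"
    and "\<epsilon> > 0"
  obtains \<delta> where "\<delta> > 0" "\<And>c. (\<Sum>i<n. (cmod (c i))\<^sup>2) = 1 \<Longrightarrow>
    (LINT p|haar. (cmod (amp (comb n \<psi> c) p))\<^sup>2 / (gap eh k p + \<delta>)) > dispersion_form k (comb n \<psi> c) - \<epsilon>"
proof -
  let ?w = "gap eh k"
  define G where "G p = (\<Sum>i<n. (cmod (amp (\<psi> i) p))\<^sup>2)" for p
  have amp_comb: "amp (comb n \<psi> c) p = (\<Sum>i<n. c i * amp (\<psi> i) p)" for c p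
    by (rule amp_sum) (use \<psi> in auto)
  have G0: "G p \<ge> 0" for p by (simp add: G_def sum_nonneg)
  have meas_i [measurable]: "amp (\<psi> i) \<in> borel_measurable borel" if "i < n" for i
    by (rule measurable_amp[OF \<psi>[OF that]])
  have measG: "G \<in> borel_measurable borel"
    unfolding G_def[abs_def]
    by (intro borel_measurable_sum borel_measurable_power borel_measurable_norm meas_i) auto
  note [measurable] = measG measurable_gap[of k]
  have int_i: "integrable haar (\<lambda>p. (cmod (amp (\<psi> i) p))\<^sup>2 / ?w p)" if "i < n" for i
  proof -
    \<comment> \<open>Coordinate vectors lie on the unit sphere, so each single
      \<open>\<psi> i\<close> is covered by the hypothesis, and with it the trace
      \<open>G\<close>.\<close>
    define c where "c j = (if j = i then 1 else 0 :: complex)" for j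
    have "(\<Sum>j<n. (cmod (c j))\<^sup>2) = (\<Sum>j<n. if j = i then 1 else 0)"
      by (intro sum.cong) (auto simp: c_def)
    then have "(\<Sum>j<n. (cmod (c j))\<^sup>2) = 1" using that by simp
    moreover have "comb n \<psi> c = \<psi> i"
    proof
      fix x
      have "comb n \<psi> c x = (\<Sum>j<n. if j = i then \<psi> j x else 0)"
        by (intro sum.cong) (auto simp: c_def)
      then show "comb n \<psi> c x = \<psi> i x" using that by simp
    qed
    ultimately show ?thesis using int[of c] by simp
  qed
  have intG: "integrable haar (\<lambda>p. G p / ?w p)"
    unfolding G_def sum_divide_distrib using int_i by (intro Bochner_Integration.integrable_sum) auto
  \<comment> \<open>The loss of the trace under regularization by 1/(j+1). It tends to 0 and is
    dominated by \<open>G p / ?w p\<close> almost everywhere.\<close>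
  define s where "s j p = G p / ?w p - G p / (?w p + 1 / real (Suc j))" for j p
  have s_bounds: "0 \<le> s j p \<and> s j p \<le> G p / ?w p" if "?w p > 0" for j p
    using that G0[of p] by (auto simp: s_def intro!: divide_left_mono mult_pos_pos add_pos_pos)
  have s_norm: "norm (s j p) \<le> G p / ?w p" if "?w p > 0" for j p
    using s_bounds[OF that, of j] by simp
  have "(\<lambda>j. integral\<^sup>L haar (s j)) \<longlonglongrightarrow> integral\<^sup>L haar (\<lambda>p :: real ^ 'd. 0 :: real)"
  proof (rule integral_dominated_convergence[OF _ _ intG])
    show "AE p in haar. (\<lambda>j. s j p) \<longlonglongrightarrow> 0"
      using AE_gap_pos[OF k]
    proof eventually_elim
      fix p assume p: "?w p > 0"
      have lim: "(\<lambda>j. G p / (?w p + 1 / real (Suc j))) \<longlonglongrightarrow> G p / (?w p + 0)"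
        using LIMSEQ_inverse_real_of_nat p
        by (intro tendsto_intros) (auto simp: inverse_eq_divide)
      have "(\<lambda>j. s j p) \<longlonglongrightarrow> G p / ?w p - G p / (?w p + 0)"
        unfolding s_def by (rule tendsto_diff[OF tendsto_const lim])
      then show "(\<lambda>j. s j p) \<longlonglongrightarrow> 0" by simp
    qed
    show "AE p in haar. norm (s j p) \<le> G p / ?w p" for j
      using AE_gap_pos[OF k] by eventually_elim (rule s_norm)
    show "s j \<in> borel_measurable haar" for j unfolding s_def[abs_def] by measurable
  qed simp
  then have "(\<lambda>j. integral\<^sup>L haar (s j)) \<longlonglongrightarrow> 0" by simp
  from order_tendstoD(2)[OF this \<open>\<epsilon> > 0\<close>] obtain j where j: "integral\<^sup>L haar (s j) < \<epsilon>"
    by (auto simp: eventually_sequentially)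
  have s_int: "integrable haar (s j)"
  proof (rule Bochner_Integration.integrable_bound[OF intG])
    show "s j \<in> borel_measurable haar" unfolding s_def[abs_def] by measurable
    show "AE p in haar. norm (s j p) \<le> norm (G p / ?w p)"
      using AE_gap_pos[OF k]
      by eventually_elim (rule order_trans[OF s_norm]; simp add: G0)
  qed
  let ?\<delta> = "1 / real (Suc j)"
  have "(LINT p|haar. (cmod (amp (comb n \<psi> c) p))\<^sup>2 / (?w p + ?\<delta>)) > dispersion_form k (comb n \<psi> c) - \<epsilon>"
    if c: "(\<Sum>i<n. (cmod (c i))\<^sup>2) = 1" for c
  proof -
    let ?A = "\<lambda>p. (cmod (amp (comb n \<psi> c) p))\<^sup>2"
    have [measurable]: "amp (comb n \<psi> c) \<in> borel_measurable borel"
      by (intro measurable_amp sqsum_sum sqsum_cmult) (use \<psi> in auto)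
    have AG: "?A p \<le> G p" for p unfolding amp_comb G_def by (rule cmod_sum_mult_le[OF c])
    have int\<delta>: "integrable haar (\<lambda>p. ?A p / (?w p + ?\<delta>))"
    proof (rule Bochner_Integration.integrable_bound[OF int[OF c]])
      show "(\<lambda>p. ?A p / (?w p + ?\<delta>)) \<in> borel_measurable haar" by measurable
      show "AE p in haar. norm (?A p / (?w p + ?\<delta>)) \<le> norm (?A p / ?w p)"
        using AE_gap_pos[OF k]
        by eventually_elim (auto simp: norm_divide intro!: divide_left_mono mult_pos_pos add_pos_pos)
    qed
    have "dispersion_form k (comb n \<psi> c) - (LINT p|haar. ?A p / (?w p + ?\<delta>)) =
        (LINT p|haar. ?A p / ?w p - ?A p / (?w p + ?\<delta>))"
      unfolding dispersion_form_def by (rule Bochner_Integration.integral_diff[symmetric, OF int[OF c] int\<delta>])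
    also have "\<dots> \<le> integral\<^sup>L haar (s j)"
    proof (rule integral_mono_AE[OF Bochner_Integration.integrable_diff[OF int[OF c] int\<delta>] s_int])
      show "AE p in haar. ?A p / ?w p - ?A p / (?w p + ?\<delta>) \<le> s j p"
        using AE_gap_pos[OF k]
      proof eventually_elim
        fix p assume p: "?w p > 0"
        \<comment> \<open>Both losses carry this same nonnegative factor, so
          \<open>?A p \<le> G p\<close> passes to them.\<close>
        have "1 / ?w p - 1 / (?w p + ?\<delta>) \<ge> 0"
          using p by (simp add: divide_left_mono add_pos_pos)
        from mult_right_mono[OF AG[of p] this]
        show "?A p / ?w p - ?A p / (?w p + ?\<delta>) \<le> s j p" by (simp add: s_def right_diff_distrib)
      qed
    qed
    finally show ?thesis using j by linarith
  qed
  then show ?thesis using that[of ?\<delta>] by simp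
qed

lemma eigenvectors_below_threshold:
  fixes \<psi> :: "nat \<Rightarrow> int ^ 'd \<Rightarrow> complex"
  assumes k: "k \<in> G_nbhd eh" and \<mu>: "\<mu> > 1"
    and \<psi>: "orthonormal n \<psi>" "\<And>i. i < n \<Longrightarrow> \<psi> i \<in> ell2e"
    and form: "\<And>c. (\<Sum>i<n. (cmod (c i))\<^sup>2) = 1 \<Longrightarrow>
      integrable haar (\<lambda>p. (cmod (amp (comb n \<psi> c) p))\<^sup>2 / gap eh k p) \<and> dispersion_form k (comb n \<psi> c) \<ge> 1"
  obtains e z where "orthonormal n e" "\<And>i. i < n \<Longrightarrow> e i \<in> eigenspace (H_op eh vh \<mu> k) (z i)"
    "\<And>i. i < n \<Longrightarrow> z i < Emin eh k"
proof -
  interpret O: lattice_operator "gap_hat eh k" "\<lambda>x. \<mu> * vh x" by (rule lattice_operator)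
  have sq: "sqsum (\<psi> i)" if "i < n" for i using \<psi>(2)[OF that] by (simp add: ell2e_iff)
  \<comment> \<open>With this tolerance a dispersion form of at least 1 stays above 1/\<mu> after
    regularization, which is the condition for a negative trial form.\<close>
  have pos: "1 - 1 / \<mu> > 0" using \<mu> by simp
  obtain \<delta> where \<delta>: "\<delta> > 0" "\<And>c. (\<Sum>i<n. (cmod (c i))\<^sup>2) = 1 \<Longrightarrow>
      (LINT p|haar. (cmod (amp (comb n \<psi> c) p))\<^sup>2 / (gap eh k p + \<delta>)) > dispersion_form k (comb n \<psi> c) - (1 - 1 / \<mu>)"
    using uniform_regularization[where n = n and \<psi> = \<psi>, OF k sq _ pos] form by blast
  let ?R = "\<lambda>f. f \<in> ell2e \<and> (\<exists>y<0. \<forall>x. O.Op f x = complex_of_real y * f x)"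
  obtain e where e: "orthonormal n e" "\<And>i. i < n \<Longrightarrow> ?R (e i)"
  proof (rule orthonormal_extend[of ?R n])
    show "sqsum f" if "?R f" for f using that by (simp add: ell2e_iff)
    fix m :: nat and e assume m: "m < n" and e: "\<And>i. i < m \<Longrightarrow> ?R (e i)"
    obtain y where y: "\<And>i x. i < m \<Longrightarrow> O.Op (e i) x = complex_of_real (y i) * e i x"
      using e by metis
    have e_sq: "sqsum (e i)" if "i < m" for i using e[OF that] by (simp add: ell2e_iff)
    \<comment> \<open>The conditions concern the trial functions but are solved for coefficients of
      the \<open>\<psi> i\<close>, which is legitimate because one \<delta> makes
      \<open>trial k \<delta>\<close> linear.\<close>
    obtain c where c: "\<exists>i<n. c i \<noteq> 0"
      "\<And>j. j < m \<Longrightarrow> (\<Sum>i<n. c i * ell2_inner (trial k \<delta> (\<psi> i)) (e j)) = 0"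
      using exists_nontrivial_solution[of "{..<n}" m "\<lambda>j i. ell2_inner (trial k \<delta> (\<psi> i)) (e j)"] m by auto
    \<comment> \<open>After rescaling the coefficients to the unit sphere, orthonormality of
      \<open>\<psi>\<close> makes their combination a unit vector.\<close>
    define N where "N = sqrt (\<Sum>i<n. (cmod (c i))\<^sup>2)"
    obtain i where i: "i < n" "c i \<noteq> 0" using c(1) by blast
    have "(\<Sum>i<n. (cmod (c i))\<^sup>2) > 0"
      by (rule sum_pos2[of _ i]) (use i in auto)
    then have N: "N > 0" "N\<^sup>2 = (\<Sum>i<n. (cmod (c i))\<^sup>2)" by (auto simp: N_def)
    define c' where "c' i = c i / of_real N" for i
    have c': "(\<Sum>i<n. (cmod (c' i))\<^sup>2) = 1"
    proof -
      have "(\<Sum>i<n. (cmod (c' i))\<^sup>2) = (\<Sum>i<n. (cmod (c i))\<^sup>2) / N\<^sup>2"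
        by (simp add: c'_def norm_divide power_divide sum_divide_distrib)
      then show ?thesis unfolding N(2)[symmetric] using N(1) by simp
    qed
    let ?f = "comb n \<psi> c'"
    have f_norm: "ell2_norm ?f = 1"
      using ell2_norm_orthonormal_sum[OF \<psi>(1) sq, of c'] c' ell2_norm_nonneg[of ?f]
      by (simp add: power2_eq_1_iff)
    have f_ell: "?f \<in> ell2e"
      using \<psi>(2) sq by (auto simp: ell2e_iff intro!: sqsum_sum sqsum_cmult sum.cong)
    then have f_sq: "sqsum ?f" by (simp add: ell2e_iff)
    have t_eq: "trial k \<delta> ?f = (\<lambda>x. \<Sum>i<n. c' i * trial k \<delta> (\<psi> i) x)"
      by (rule ext, rule trial_sum[OF \<delta>(1)]) (use sq in auto)
    have orth: "ell2_inner (trial k \<delta> ?f) (e j) = 0" if "j < m" for j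
    proof -
      have "ell2_inner (trial k \<delta> ?f) (e j) = (\<Sum>i<n. c' i * ell2_inner (trial k \<delta> (\<psi> i)) (e j))"
        unfolding t_eq by (rule inner_sum_left) (use sq sqsum_trial[OF \<delta>(1)] e_sq[OF that] in auto)
      also have "\<dots> = (\<Sum>i<n. c i * ell2_inner (trial k \<delta> (\<psi> i)) (e j)) / of_real N"
        by (simp add: c'_def sum_divide_distrib)
      finally show ?thesis using c(2)[OF that] by simp
    qed
    have "(LINT p|haar. (cmod (amp ?f p))\<^sup>2 / (gap eh k p + \<delta>)) > 1 / \<mu>"
      using \<delta>(2)[OF c'] form[OF c'] by linarith
    then have neg: "O.form (trial k \<delta> ?f) < 0"
      using form_trial_neg[OF \<delta>(1) f_sq f_norm] \<mu> by simp
    obtain f \<nu> where "f \<in> ell2e" "ell2_norm f = 1" "\<nu> < 0"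
      "\<And>i. i < m \<Longrightarrow> ell2_inner f (e i) = 0" "\<And>x. O.Op f x = of_real \<nu> * f x"
      by (rule O.exists_orthogonal_eigenvector[of m e y "trial k \<delta> ?f"])
         (use e y orth neg trial_ell2e[OF \<delta>(1) f_ell] in auto)
    then show "\<exists>f. ?R f \<and> ell2_norm f = 1 \<and> (\<forall>i<m. ell2_inner f (e i) = 0)" by blast
  qed blast
  obtain y where y: "\<And>i. i < n \<Longrightarrow> y i < 0" "\<And>i x. i < n \<Longrightarrow> O.Op (e i) x = complex_of_real (y i) * e i x"
    using e(2) by metis
  have "e i \<in> eigenspace (H_op eh vh \<mu> k) (y i + Emin eh k)" if "i < n" for i
  proof -
    have "e i \<in> ell2e" using e(2)[OF that] by blast
    moreover from this have "H_op eh vh \<mu> k (e i) x = O.Op (e i) x + of_real (Emin eh k) * e i x" for x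
      by (simp add: H_op_def V_op_def O.Op_def conv_gap_hat ell2e_iff)
    ultimately show ?thesis using y(2)[OF that] by (simp add: eigenspace_def distrib_right)
  qed
  then show ?thesis using that[of e "\<lambda>i. y i + Emin eh k"] e(1) y(1) by simp
qed

end

theorem corollary4p13:
  fixes eh vh :: "int ^ 'd \<Rightarrow> real"
    and k0 :: "real ^ 'd"
    and n :: nat
    and \<H> :: "(int ^ 'd \<Rightarrow> complex) set"
  assumes "CARD('d) \<ge> 3"
    and "(\<lambda>x. \<bar>eh x\<bar>) summable_on UNIV" and "\<forall>x. eh (- x) = eh x"
    and "C_class 3 (disp eh)" and "morse (disp eh)"
    and "\<forall>p \<in> cell. p \<noteq> 0 \<longrightarrow> disp eh 0 < disp eh p"
    and "(\<lambda>x. \<bar>vh x\<bar>) summable_on UNIV" and "\<forall>x. vh (- x) = vh x" and "\<forall>x. vh x \<le> 0"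
    and "k0 \<in> G_nbhd eh"
    and "n \<ge> 1" and "singular_point eh vh k0 n"
    and "bounded_below_by (H_op eh vh 1 k0) (Emin eh k0)"
    and "\<H> = eigenspace (B1 eh vh k0) 1"
  shows "(\<forall>\<mu> > 1. \<forall>k \<in> M_eq_some eh vh k0 \<H>.
            \<exists>z < Emin eh k. eigenvalue (H_op eh vh \<mu> k) z) \<and>
         (\<forall>\<mu> > 1. \<forall>k \<in> M_eq_all eh vh k0 \<H> \<union> M_gt_all eh vh k0 \<H>.
            eigenvalue_count_below (H_op eh vh \<mu> k) (Emin eh k) \<ge> enat n)"
proof -
  interpret lattice_pair eh vh
    by unfold_locales (use assms in auto)
  have inv: "integrable haar (\<lambda>p. 1 / gap eh k0 p)"
    using assms(12) by (intro inverse_gap_integrable) (simp add: singular_point_def)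
  have H_ell: "\<psi> \<in> ell2e" if "\<psi> \<in> \<H>" for \<psi> using that assms(14) by (simp add: eigenspace_def)
  have H_comb: "comb m \<psi> c \<in> \<H>" if "\<And>i. i < m \<Longrightarrow> \<psi> i \<in> \<H>" for m \<psi> c
    unfolding assms(14)
  proof (rule eigenspace_sum)
    show "B1 eh vh k0 (comb m \<psi> c) x = (\<Sum>i<m. c i * B1 eh vh k0 (\<psi> i) x)" for c x
      by (rule B1_sum[OF inv]) (use that H_ell in blast)
  qed (use that assms(14) in auto)
  \<comment> \<open>Both conditions, L = 0 and L > 0, act only through L \<ge> 0.\<close>
  have form: "integrable haar (\<lambda>p. (cmod (amp \<psi> p))\<^sup>2 / gap eh k p) \<and> dispersion_form k \<psi> \<ge> 1"
    if "\<psi> \<in> \<H>" "ell2_norm \<psi> = 1" "k \<in> M_eq eh vh k0 \<psi> \<union> M_gt eh vh k0 \<psi>" for k \<psi>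
    using dispersion_form_ge[OF _ assms(10) inv, of k \<psi>] that assms(14)
    by (auto simp: M_eq_def M_gt_def)
  show ?thesis
  proof (intro conjI allI impI ballI)
    fix \<mu> :: real and k assume \<mu>: "1 < \<mu>" and "k \<in> M_eq_some eh vh k0 \<H>"
    then obtain \<psi> where \<psi>: "\<psi> \<in> \<H>" "ell2_norm \<psi> = 1" "k \<in> M_eq eh vh k0 \<psi>"
      by (auto simp: M_eq_some_def)
    have sq: "sqsum \<psi>" using H_ell[OF \<psi>(1)] by (simp add: ell2e_iff)
    \<comment> \<open>Part (i) is the case of a one-element orthonormal family, formed by the vector
      \<psi> that puts \<open>k\<close> into the union.\<close>
    have ortho: "orthonormal 1 (\<lambda>i. \<psi>)" using inner_self[OF sq] \<psi>(2) by (simp add: orthonormal_def)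
    have kG: "k \<in> G_nbhd eh" using \<psi>(3) by (simp add: M_eq_def)
    \<comment> \<open>The unit combinations are multiples of \<psi> by numbers of modulus 1, which
      leave the modulus of \<open>amp\<close> unchanged.\<close>
    have comb_form: "integrable haar (\<lambda>p. (cmod (amp (comb 1 (\<lambda>i. \<psi>) c) p))\<^sup>2 / gap eh k p) \<and>
        dispersion_form k (comb 1 (\<lambda>i. \<psi>) c) \<ge> 1" if "(\<Sum>i<1. (cmod (c i))\<^sup>2) = 1" for c
    proof -
      have "cmod (c 0) = 1" using that by (simp add: power2_eq_1_iff) (smt (verit) norm_ge_zero)
      then have "cmod (amp (comb 1 (\<lambda>i. \<psi>) c) p) = cmod (amp \<psi> p)" for p
        using amp_sum[where I = "{..<1}" and \<psi> = "\<lambda>i. \<psi>" and c = c and p = p] sq by (simp add: norm_mult)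
      then show ?thesis using form[OF \<psi>(1,2)] \<psi>(3) by (simp only: dispersion_form_def) simp
    qed
    obtain e z where e: "orthonormal 1 e" "\<And>i. i < 1 \<Longrightarrow> e i \<in> eigenspace (H_op eh vh \<mu> k) (z i)"
      "\<And>i. i < 1 \<Longrightarrow> z i < Emin eh k"
      using eigenvectors_below_threshold[OF kG \<mu> ortho _ comb_form] H_ell[OF \<psi>(1)] by blast
    have "e 0 \<noteq> 0" using e(1) by (auto simp: orthonormal_def ell2_inner_def)
    then show "\<exists>z<Emin eh k. eigenvalue (H_op eh vh \<mu> k) z"
      using e(2,3)[of 0] by (auto simp: eigenvalue_def)
  next
    fix \<mu> :: real and k assume \<mu>: "1 < \<mu>" and kM: "k \<in> M_eq_all eh vh k0 \<H> \<union> M_gt_all eh vh k0 \<H>"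
    have M: "k \<in> M_eq eh vh k0 \<psi> \<union> M_gt eh vh k0 \<psi>" if "\<psi> \<in> \<H>" "ell2_norm \<psi> = 1" for \<psi>
      using kM that by (auto simp: M_eq_all_def M_gt_all_def)
    obtain \<psi> where \<psi>: "orthonormal n \<psi>" "\<And>i. i < n \<Longrightarrow> \<psi> i \<in> \<H>"
    proof (rule orthonormal_basis_eigenspace[of "B1 eh vh k0" 1 n])
      show "multiplicity_of (B1 eh vh k0) 1 = enat n" using assms(12) by (simp add: singular_point_def)
      show "B1 eh vh k0 (\<lambda>x. \<Sum>i<m. c i * e i x) x = (\<Sum>i<m. c i * B1 eh vh k0 (e i) x)"
        if "\<And>i. i < m \<Longrightarrow> e i \<in> eigenspace (B1 eh vh k0) 1" for m :: nat and e c x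
        by (rule B1_sum[OF inv]) (use that in \<open>auto simp: eigenspace_def\<close>)
    qed (use assms(14) in blast)
    have sq: "sqsum (\<psi> i)" if "i < n" for i using H_ell[OF \<psi>(2)[OF that]] by (simp add: ell2e_iff)
    have unit: "ell2_norm (comb n \<psi> c) = 1" if "(\<Sum>i<n. (cmod (c i))\<^sup>2) = 1" for c
      using ell2_norm_orthonormal_sum[OF \<psi>(1) sq, of c] that ell2_norm_nonneg[of "comb n \<psi> c"]
      by (simp add: power2_eq_1_iff)
    \<comment> \<open>An intersection reveals membership of \<open>k\<close> in
      \<open>G_nbhd\<close> only through an actual unit vector; n \<ge> 1 provides
      \<open>\<psi> 0\<close>.\<close>
    have "(ell2_norm (\<psi> 0))\<^sup>2 = 1"
      using inner_self[OF sq[of 0]] \<psi>(1) assms(11) by (simp add: orthonormal_def flip: of_real_power)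
    then have "ell2_norm (\<psi> 0) = 1" using ell2_norm_nonneg[of "\<psi> 0"] by (simp add: power2_eq_1_iff)
    then have k: "k \<in> G_nbhd eh"
      using M[of "\<psi> 0"] \<psi>(2)[of 0] assms(11) by (auto simp: M_eq_def M_gt_def)
    obtain e z where "orthonormal n e" "\<And>i. i < n \<Longrightarrow> e i \<in> eigenspace (H_op eh vh \<mu> k) (z i)"
      "\<And>i. i < n \<Longrightarrow> z i < Emin eh k"
      by (rule eigenvectors_below_threshold[OF k \<mu> \<psi>(1)])
         (use form unit M H_comb[OF \<psi>(2)] H_ell \<psi>(2) in auto)
    then show "enat n \<le> eigenvalue_count_below (H_op eh vh \<mu> k) (Emin eh k)"
      by (rule eigenvalue_count_below_ge)
  qed
qed

end
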